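(* Suppose that $X$ has an indefinite Wiener integral. Let the coefficients $a,\gamma,\underline c,G$ and the terminal condition $\xi\in L^2_X$ satisfy the standing assumptions listed in the context, let $\mathfrak c\in\mathfrak H$ be the element associated with $\underline c\in CM_X$, and suppose that $(Y,Z,\mathcal H)$ is a mild solution to the linear BSDE $$dY_t=\left(a(t)Y_t+G_t\right)d\gamma(t)+Z\,d\underline{c}(t)+Z\,d^{\diamond}X_t,\qquad Y_T=\xi.$$ Define $$\tilde\xi=\xi-\int_0^TA(s)G_s\,d\gamma(s),\qquad A(t)=e^{\int_t^Ta(s)\,d\gamma(s)}.$$ Then $\tilde\xi\in D_t^{\mathfrak c}$ for every $t\in[0,T]$, and $$Y_t=A(t)^{-1}\,\widetilde E^{\mathfrak c}\left[\tilde\xi\,|\,\mathcal F^X_t\right]+A(t)^{-1}\int_0^tA(s)G_s\,d\gamma(s).$$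
   Context: **Gaussian setting.** Let $T>0$ and let $X=(X_t)_{t\in[0,T]}$ be a measurable centered Gaussian process with $X_0=0$ on a complete probability space $(\Omega,\mathcal F,P)$, with covariance $R(t,s)=\mathbb E[X_tX_s]$. Let $(\mathcal F^X_t)_{t\in[0,T]}$ be the filtration generated by $X$ and $L^2_X=L^2(\Omega,\mathcal F^X_T,P)$. The first chaos $H_X$ is the closure in $L^2_X$ of $\mathrm{span}\{X_s:0\le s\le T\}$. The space of deterministic integrands $\mathfrak H=\mathfrak H_X$ is the Hilbert space obtained as closure (completion) of the linear span of the indicator functions $\mathbf 1_{(0,t]}$, $t\in[0,T]$, with inner product $\langle \mathbf 1_{(0,t]},\mathbf 1_{(0,s]}\rangle_{\mathfrak H}=R(t,s)$. The Wiener integral $I:\mathfrak H\to H_X$ is the unique linear isometry with $I(\mathbf 1_{(0,t]})=X_t$. For $h\in H_X$ put $\underline h(t)=\mathbb E[X_th]$, $t\in[0,T]$; the Cameron-Martin space $CM_X$ is the set of all functions $\underline h$, $h\in H_X$, with inner product $\langle\underline h_1,\underline h_2\rangle_{CM_X}=\mathbb E[h_1h_2]$. An element $h\in H_X$, the function $\underline h\in CM_X$ and $\mathfrak h=I^{-1}(h)\in\mathfrak H$ are associated with each other. For $h\in H_X$, the Wick exponential is $e^{\diamond h}=\exp\{h-\frac12\mathbb E[h^2]\}$. The $S$-transform of $\xi\in L^2_X$ is $(S\xi)(\mathfrak h)=\mathbb E[\xi e^{\diamond I(\mathfrak h)}]$, $\mathfrak h\in\mathfrak H$; it determines $\xi$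 uniquely. **Indefinite Wiener integral and shifted quasi-conditional expectation.** $X$ has an indefinite Wiener integral if for every $r\in[0,T]$ there is a continuous linear operator $\mathbb I_r:\mathfrak H\to\mathfrak H$ with $\mathbb I_r(\mathbf 1_{(0,t]})=\mathbf 1_{(0,t\wedge r]}$ for all $t\in[0,T]$. Then $\mathbb I_r^*$ is the adjoint and $\mathfrak h^r:=\mathbb I_r^*\mathfrak h$. For $r\in[0,T]$, $\mathfrak c\in\mathfrak H$, let $$D_r^{\mathfrak c}=\left\{\xi\in L^2_X:\ \exists\,\eta\in L^2_X\text{ such that }(S\xi)((\mathfrak h+\mathfrak c)^r-\mathfrak c)=(S\eta)(\mathfrak h)\ \ \forall\,\mathfrak h\in\mathfrak H\right\}.$$ For $\xi\in D_r^{\mathfrak c}$ the corresponding $\eta$ is unique and denoted $\widetilde E^{\mathfrak c}[\xi|\mathcal F^X_r]$. **Spaces of integrands.** Given $\underline c\in CM_X$, a Hilbert space $\mathcal H$ is a space of integrands for $\underline c$ if $\{\mathbf 1_{(0,t]}:t\in[0,T]\}$ is total in $\mathcal H$ and the map $\mathbf 1_{(0,t]}\mapsto\underline c(t)$ extends to a continuous linear functional $\mathcal H\to\mathbb R$, denoted $\int_0^T\cdot\,d^{\mathcal H}\underline c$. $\mathcal H$ is appropriate for $X$ if it is a space of integrands for all integrators from a dense subset of $CM_X$. Put $\mathcal A_{\mathcal H}=\{\mathfrak h\in\mathfrak H:\mathcal H\text{ is a space of integrands for }\underline h\}$. $\mathcal H$ satisfies (I$_{\mathcal H}$) if for every $r\in[0,T]$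 there is a continuous linear operator $\mathbb I^{\mathcal H}_r:\mathcal H\to\mathcal H$ with $\mathbb I^{\mathcal H}_r(\mathbf 1_{(0,t]})=\mathbf 1_{(0,t\wedge r]}$ for all $t$. **$\mathcal H$-Skorokhod integral.** Let $\mathcal H$ be appropriate for $X$ and $Z\in L^2(\Omega,\mathcal H)=L^2_X\otimes\mathcal H$. For $\mathfrak h\in\mathcal A_{\mathcal H}$, $(SZ)(\mathfrak h)\in\mathcal H$ is obtained by applying $\mathbb E[\,\cdot\,e^{\diamond I(\mathfrak h)}]$ to the $L^2_X$-coordinate of $Z$. $Z$ is in the domain of the $\mathcal H$-Skorokhod integral if there is a (necessarily unique) random variable $\int_0^TZ\,d^{\diamond_{\mathcal H}}X\in L^2_X$ with $\left(S\int_0^TZ\,d^{\diamond_{\mathcal H}}X\right)(\mathfrak h)=\int_0^T(SZ)(\mathfrak h)\,d^{\mathcal H}\underline h$ for every $\mathfrak h\in\mathcal A_{\mathcal H}$. If (I$_{\mathcal H}$) holds, put $\mathbb I^{\mathcal H}_{(a,b]}=\mathrm{id}_{L^2_X}\otimes(\mathbb I^{\mathcal H}_b-\mathbb I^{\mathcal H}_a)$ and $\int_a^bZ\,d^{\diamond_{\mathcal H}}X=\int_0^T\mathbb I^{\mathcal H}_{(a,b]}(Z)\,d^{\diamond_{\mathcal H}}X$, provided the right-hand side exists. Similarly $\int_a^bZ\,d^{\mathcal H}\underline c=\int_0^T\mathbb I^{\mathcal H}_{(a,b]}(Z)\,d^{\mathcal H}\underline c\in L^2_X$, the functional $\int_0^T\cdot\,d^{\mathcal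 H}\underline c$ being applied to the $\mathcal H$-coordinate. **Standing assumptions on the coefficients.** $\underline c\in CM_X$; $\gamma:[0,T]\to\mathbb R$ is continuous and of bounded variation, with total variation $|\gamma|$; $a:[0,T]\to\mathbb R$ is measurable; $G$ is a measurable process adapted to $(\mathcal F^X_t)$; and $\int_0^T|a(s)|\,d|\gamma|(s)+\mathbb E\left[\left(\int_0^T|G_s|\,d|\gamma|(s)\right)^2\right]<\infty$. The terminal condition satisfies $\xi\in L^2_X$. **Mild solution.** A triplet $(Y,Z,\mathcal H)$ is a mild solution of the BSDE if: (1) $\mathcal H$ is a Hilbert space appropriate for $X$, satisfying (I$_{\mathcal H}$), and is a space of integrands for $\underline c$; (2) $Y$ is an adapted measurable process with $Y_t\in L^2_X$ for every $t\in[0,T]$ and $\mathbb E\left[\left(\int_0^T|a(s)Y_s|\,d|\gamma|(s)\right)^2\right]<\infty$; (3) $Z\in L^2(\Omega,\mathcal H)$ and $\int_t^TZ\,d^{\diamond_{\mathcal H}}X$ exists for every $t\in[0,T]$; (4) for every $t\in[0,T]$, in $L^2_X$, $$Y_t=\xi-\int_t^T\left(a(s)Y_s+G_s\right)d\gamma(s)-\int_t^TZ\,d^{\mathcal H}\underline c-\int_t^TZ\,d^{\diamond_{\mathcal H}}X.$$ *)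

theory Defs
  imports "HOL-Probability.Probability"
begin

text \<open>
  Random variables are represented by functions on the sample space, and identities between
  elements of \<open>L\<^sup>2\<close> are almost sure identities.  Processes and functions on \<open>[0,T]\<close> are functions
  of a real argument whose values outside \<open>[0,T]\<close> are never used.
\<close>

section \<open>Gaussian processes and the first chaos\<close>

definition centered_gaussian_rv :: "'w measure \<Rightarrow> ('w \<Rightarrow> real) \<Rightarrow> bool" where
  "centered_gaussian_rv M V \<longleftrightarrow>
     V \<in> borel_measurable M \<and>
     ((AE \<omega> in M. V \<omega> = 0) \<or>
      (\<exists>\<sigma>>0. distributed M lborel V (\<lambda>x. ennreal (normal_density 0 \<sigma> x))))"

definition measurable_process :: "'w measure \<Rightarrow> real \<Rightarrow> (real \<Rightarrow> 'w \<Rightarrow> real) \<Rightarrow> bool" where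
  "measurable_process M T V \<longleftrightarrow>
     (\<lambda>(t, \<omega>). V t \<omega>) \<in> borel_measurable (restrict_space borel {0..T} \<Otimes>\<^sub>M M)"

definition gaussian_setting :: "'w measure \<Rightarrow> real \<Rightarrow> (real \<Rightarrow> 'w \<Rightarrow> real) \<Rightarrow> bool" where
  "gaussian_setting M T X \<longleftrightarrow>
     0 < T \<and> prob_space M \<and> complete_measure M \<and> measurable_process M T X \<and>
     (\<forall>F b. finite F \<longrightarrow> F \<subseteq> {0..T} \<longrightarrow>
        centered_gaussian_rv M (\<lambda>\<omega>. \<Sum>t\<in>F. b t * X t \<omega>)) \<and>
     (AE \<omega> in M. X 0 \<omega> = 0)"

text \<open>
  The filtration is augmented by the null sets, so that \<open>L\<^sup>2\<close> with respect to it is closed under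
  almost sure modification.  Adaptedness to the augmented filtration is implied by adaptedness to
  the raw one, and both give the same \<open>L\<^sup>2\<close> equivalence classes.
\<close>

definition filtr :: "'w measure \<Rightarrow> (real \<Rightarrow> 'w \<Rightarrow> real) \<Rightarrow> real \<Rightarrow> 'w measure" where
  "filtr M X t =
     sigma (space M)
       ({X s -` B \<inter> space M | s B. s \<in> {0..t} \<and> B \<in> sets borel} \<union> null_sets M)"

definition adapted_process ::
    "'w measure \<Rightarrow> real \<Rightarrow> (real \<Rightarrow> 'w \<Rightarrow> real) \<Rightarrow> (real \<Rightarrow> 'w \<Rightarrow> real) \<Rightarrow> bool" where
  "adapted_process M T X V \<longleftrightarrow> (\<forall>t\<in>{0..T}. V t \<in> borel_measurable (filtr M X t))"

definition L2X :: "'w measure \<Rightarrow> real \<Rightarrow> (real \<Rightarrow> 'w \<Rightarrow> real) \<Rightarrow> ('w \<Rightarrow> real) set" where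
  "L2X M T X =
     {\<xi>. \<xi> \<in> borel_measurable (filtr M X T) \<and> integrable M (\<lambda>\<omega>. (\<xi> \<omega>)\<^sup>2)}"

definition first_chaos :: "'w measure \<Rightarrow> real \<Rightarrow> (real \<Rightarrow> 'w \<Rightarrow> real) \<Rightarrow> ('w \<Rightarrow> real) set" where
  "first_chaos M T X =
     {h \<in> L2X M T X. \<forall>\<epsilon>>0. \<exists>F b. finite F \<and> F \<subseteq> {0..T} \<and>
        (LINT \<omega>|M. (h \<omega> - (\<Sum>t\<in>F. b t * X t \<omega>))\<^sup>2) < \<epsilon>}"

definition underline ::
    "'w measure \<Rightarrow> real \<Rightarrow> (real \<Rightarrow> 'w \<Rightarrow> real) \<Rightarrow> ('w \<Rightarrow> real) \<Rightarrow> real \<Rightarrow> real" where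
  "underline M T X h = (\<lambda>t\<in>{0..T}. LINT \<omega>|M. X t \<omega> * h \<omega>)"

definition cameron_martin :: "'w measure \<Rightarrow> real \<Rightarrow> (real \<Rightarrow> 'w \<Rightarrow> real) \<Rightarrow> (real \<Rightarrow> real) set" where
  "cameron_martin M T X = underline M T X ` first_chaos M T X"

text \<open>
  The squared Cameron--Martin norm of \<open>underline h - underline g\<close> is \<open>E[(h - g)\<^sup>2]\<close>.
\<close>

definition cm_dense :: "'w measure \<Rightarrow> real \<Rightarrow> (real \<Rightarrow> 'w \<Rightarrow> real) \<Rightarrow> (real \<Rightarrow> real) set \<Rightarrow> bool" where
  "cm_dense M T X D \<longleftrightarrow>
     D \<subseteq> cameron_martin M T X \<and>
     (\<forall>h\<in>first_chaos M T X. \<forall>\<epsilon>>0. \<exists>g\<in>first_chaos M T X.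
        underline M T X g \<in> D \<and> (LINT \<omega>|M. (h \<omega> - g \<omega>)\<^sup>2) < \<epsilon>)"


section \<open>Hilbert spaces containing the indicator functions\<close>

text \<open>
  A Hilbert space in which the indicators are total is a complete inner product space with a
  map \<open>e\<close>, where \<open>e t\<close> stands for \<open>1\<^bsub>(0,t]\<^esub>\<close>.  The indicators with \<open>0 < t\<close> are linearly independent
  functions, so any such map with \<open>e 0 = 0\<close> extends linearly to their span.  The map \<open>e\<close> need not be
  injective: \<open>1\<^bsub>(0,t]\<^esub>\<close> is null in the space \<open>\<HH>\<close> of the process whenever \<open>X\<^sub>t = 0\<close> almost surely.
\<close>

definition indicators_total :: "real \<Rightarrow> (real \<Rightarrow> 'h::{real_inner,complete_space}) \<Rightarrow> bool" where
  "indicators_total T e \<longleftrightarrow> e 0 = 0 \<and> closure (span (e ` {0..T})) = UNIV"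

definition is_truncation ::
    "real \<Rightarrow> (real \<Rightarrow> 'h::{real_inner,complete_space}) \<Rightarrow> real \<Rightarrow> ('h \<Rightarrow> 'h) \<Rightarrow> bool" where
  "is_truncation T e r L \<longleftrightarrow> bounded_linear L \<and> (\<forall>t\<in>{0..T}. L (e t) = e (min t r))"

definition has_truncations :: "real \<Rightarrow> (real \<Rightarrow> 'h::{real_inner,complete_space}) \<Rightarrow> bool" where
  "has_truncations T e \<longleftrightarrow> (\<forall>r\<in>{0..T}. \<exists>L. is_truncation T e r L)"

definition truncation ::
    "real \<Rightarrow> (real \<Rightarrow> 'h::{real_inner,complete_space}) \<Rightarrow> real \<Rightarrow> 'h \<Rightarrow> 'h" where
  "truncation T e r = (THE L. is_truncation T e r L)"

definition is_integrator_functional ::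
    "real \<Rightarrow> (real \<Rightarrow> 'h::{real_inner,complete_space}) \<Rightarrow> (real \<Rightarrow> real) \<Rightarrow> ('h \<Rightarrow> real) \<Rightarrow> bool" where
  "is_integrator_functional T e c \<phi> \<longleftrightarrow> bounded_linear \<phi> \<and> (\<forall>t\<in>{0..T}. \<phi> (e t) = c t)"

definition space_of_integrands ::
    "real \<Rightarrow> (real \<Rightarrow> 'h::{real_inner,complete_space}) \<Rightarrow> (real \<Rightarrow> real) \<Rightarrow> bool" where
  "space_of_integrands T e c \<longleftrightarrow>
     indicators_total T e \<and> (\<exists>\<phi>. is_integrator_functional T e c \<phi>)"

definition integral_wrt ::
    "real \<Rightarrow> (real \<Rightarrow> 'h::{real_inner,complete_space}) \<Rightarrow> (real \<Rightarrow> real) \<Rightarrow> 'h \<Rightarrow> real" where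
  "integral_wrt T e c = (THE \<phi>. is_integrator_functional T e c \<phi>)"

definition appropriate ::
    "'w measure \<Rightarrow> real \<Rightarrow> (real \<Rightarrow> 'w \<Rightarrow> real) \<Rightarrow> (real \<Rightarrow> 'h::{real_inner,complete_space}) \<Rightarrow> bool" where
  "appropriate M T X e \<longleftrightarrow>
     (\<exists>D. cm_dense M T X D \<and> (\<forall>c\<in>D. space_of_integrands T e c))"


section \<open>Deterministic integrands, Wiener integral and S-transform\<close>

definition deterministic_integrands ::
    "'w measure \<Rightarrow> real \<Rightarrow> (real \<Rightarrow> 'w \<Rightarrow> real) \<Rightarrow> (real \<Rightarrow> 'k::{real_inner,complete_space}) \<Rightarrow> bool" where
  "deterministic_integrands M T X e \<longleftrightarrow>
     indicators_total T e \<and>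
     (\<forall>t\<in>{0..T}. \<forall>s\<in>{0..T}. inner (e t) (e s) = (LINT \<omega>|M. X t \<omega> * X s \<omega>))"

definition wiener_integral ::
    "'w measure \<Rightarrow> real \<Rightarrow> (real \<Rightarrow> 'w \<Rightarrow> real) \<Rightarrow> (real \<Rightarrow> 'k::{real_inner,complete_space}) \<Rightarrow>
     ('k \<Rightarrow> 'w \<Rightarrow> real) \<Rightarrow> bool" where
  "wiener_integral M T X e I \<longleftrightarrow>
     (\<forall>x. I x \<in> first_chaos M T X) \<and>
     (\<forall>x y. AE \<omega> in M. I (x + y) \<omega> = I x \<omega> + I y \<omega>) \<and>
     (\<forall>r x. AE \<omega> in M. I (r *\<^sub>R x) \<omega> = r * I x \<omega>) \<and>
     (\<forall>x. (LINT \<omega>|M. (I x \<omega>)\<^sup>2) = (norm x)\<^sup>2) \<and>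
     (\<forall>t\<in>{0..T}. AE \<omega> in M. I (e t) \<omega> = X t \<omega>)"

definition wick_exp :: "'w measure \<Rightarrow> ('w \<Rightarrow> real) \<Rightarrow> 'w \<Rightarrow> real" where
  "wick_exp M h \<omega> = exp (h \<omega> - (LINT \<omega>'|M. (h \<omega>')\<^sup>2) / 2)"

definition S_transform :: "'w measure \<Rightarrow> ('k \<Rightarrow> 'w \<Rightarrow> real) \<Rightarrow> ('w \<Rightarrow> real) \<Rightarrow> 'k \<Rightarrow> real" where
  "S_transform M I \<xi> x = (LINT \<omega>|M. \<xi> \<omega> * wick_exp M (I x) \<omega>)"

definition integrand_upto ::
    "real \<Rightarrow> (real \<Rightarrow> 'k::{real_inner,complete_space}) \<Rightarrow> real \<Rightarrow> 'k \<Rightarrow> 'k" where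
  "integrand_upto T e r = adjoint (truncation T e r)"

definition is_quasi_cond_exp ::
    "'w measure \<Rightarrow> real \<Rightarrow> (real \<Rightarrow> 'w \<Rightarrow> real) \<Rightarrow> (real \<Rightarrow> 'k::{real_inner,complete_space}) \<Rightarrow>
     ('k \<Rightarrow> 'w \<Rightarrow> real) \<Rightarrow> 'k \<Rightarrow> real \<Rightarrow> ('w \<Rightarrow> real) \<Rightarrow> ('w \<Rightarrow> real) \<Rightarrow> bool" where
  "is_quasi_cond_exp M T X e I c r \<xi> \<eta> \<longleftrightarrow>
     \<eta> \<in> L2X M T X \<and>
     (\<forall>x. S_transform M I \<xi> (integrand_upto T e r (x + c) - c) = S_transform M I \<eta> x)"

definition quasi_dom ::
    "'w measure \<Rightarrow> real \<Rightarrow> (real \<Rightarrow> 'w \<Rightarrow> real) \<Rightarrow> (real \<Rightarrow> 'k::{real_inner,complete_space}) \<Rightarrow>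
     ('k \<Rightarrow> 'w \<Rightarrow> real) \<Rightarrow> 'k \<Rightarrow> real \<Rightarrow> ('w \<Rightarrow> real) set" where
  "quasi_dom M T X e I c r =
     {\<xi> \<in> L2X M T X. \<exists>\<eta>. is_quasi_cond_exp M T X e I c r \<xi> \<eta>}"

text \<open>A version; it is unique up to null sets.\<close>

definition quasi_cond_exp ::
    "'w measure \<Rightarrow> real \<Rightarrow> (real \<Rightarrow> 'w \<Rightarrow> real) \<Rightarrow> (real \<Rightarrow> 'k::{real_inner,complete_space}) \<Rightarrow>
     ('k \<Rightarrow> 'w \<Rightarrow> real) \<Rightarrow> 'k \<Rightarrow> real \<Rightarrow> ('w \<Rightarrow> real) \<Rightarrow> 'w \<Rightarrow> real" where
  "quasi_cond_exp M T X e I c r \<xi> = (SOME \<eta>. is_quasi_cond_exp M T X e I c r \<xi> \<eta>)"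


section \<open>Hilbert space valued random variables and the Skorokhod integral\<close>

text \<open>
  The library's Bochner integral needs a second countable space, which the Hilbert spaces of
  integrands need not be.  \<open>L\<^sup>2(\<Omega>,\<H>)\<close> is therefore defined as the \<open>L\<^sup>2\<close>-closure of the algebraic
  tensors (represented by lists of pairs), and \<open>\<Phi> \<otimes> id\<close> is extended to it by continuity.
  Measurability of the norms in \<open>tensor_approx\<close> ensures that the integrals are genuine \<open>L\<^sup>2\<close> distances.
\<close>

definition tensor_sum :: "(('w \<Rightarrow> real) \<times> 'h::real_vector) list \<Rightarrow> 'w \<Rightarrow> 'h" where
  "tensor_sum ps \<omega> = (\<Sum>(\<xi>, k)\<leftarrow>ps. \<xi> \<omega> *\<^sub>R k)"

definition tensor_approx ::
    "'w measure \<Rightarrow> real \<Rightarrow> (real \<Rightarrow> 'w \<Rightarrow> real) \<Rightarrow> ('w \<Rightarrow> 'h::{real_inner,complete_space}) \<Rightarrow>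
     (nat \<Rightarrow> (('w \<Rightarrow> real) \<times> 'h) list) \<Rightarrow> bool" where
  "tensor_approx M T X Z ps \<longleftrightarrow>
     (\<forall>n. fst ` set (ps n) \<subseteq> L2X M T X) \<and>
     (\<forall>n. (\<lambda>\<omega>. norm (Z \<omega> - tensor_sum (ps n) \<omega>)) \<in> borel_measurable M) \<and>
     (\<lambda>n. \<integral>\<^sup>+\<omega>. ennreal ((norm (Z \<omega> - tensor_sum (ps n) \<omega>))\<^sup>2) \<partial>M) \<longlonglongrightarrow> 0"

definition L2H ::
    "'w measure \<Rightarrow> real \<Rightarrow> (real \<Rightarrow> 'w \<Rightarrow> real) \<Rightarrow> ('w \<Rightarrow> 'h::{real_inner,complete_space}) set" where
  "L2H M T X = {Z. \<exists>ps. tensor_approx M T X Z ps}"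

definition S_transform_H ::
    "'w measure \<Rightarrow> real \<Rightarrow> (real \<Rightarrow> 'w \<Rightarrow> real) \<Rightarrow> ('k \<Rightarrow> 'w \<Rightarrow> real) \<Rightarrow>
     ('w \<Rightarrow> 'h::{real_inner,complete_space}) \<Rightarrow> 'k \<Rightarrow> 'h" where
  "S_transform_H M T X I Z x =
     (THE v. \<forall>ps. tensor_approx M T X Z ps \<longrightarrow>
        (\<lambda>n. \<Sum>(\<xi>, k)\<leftarrow>ps n. S_transform M I \<xi> x *\<^sub>R k) \<longlonglongrightarrow> v)"

definition admissible ::
    "'w measure \<Rightarrow> real \<Rightarrow> (real \<Rightarrow> 'w \<Rightarrow> real) \<Rightarrow> ('k \<Rightarrow> 'w \<Rightarrow> real) \<Rightarrow>
     (real \<Rightarrow> 'h::{real_inner,complete_space}) \<Rightarrow> 'k set" where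
  "admissible M T X I f = {x. space_of_integrands T f (underline M T X (I x))}"

definition is_skorokhod ::
    "'w measure \<Rightarrow> real \<Rightarrow> (real \<Rightarrow> 'w \<Rightarrow> real) \<Rightarrow> ('k \<Rightarrow> 'w \<Rightarrow> real) \<Rightarrow>
     (real \<Rightarrow> 'h::{real_inner,complete_space}) \<Rightarrow> ('w \<Rightarrow> 'h) \<Rightarrow> ('w \<Rightarrow> real) \<Rightarrow> bool" where
  "is_skorokhod M T X I f Z V \<longleftrightarrow>
     V \<in> L2X M T X \<and>
     (\<forall>x\<in>admissible M T X I f.
        S_transform M I V x =
          integral_wrt T f (underline M T X (I x)) (S_transform_H M T X I Z x))"

definition skorokhod ::
    "'w measure \<Rightarrow> real \<Rightarrow> (real \<Rightarrow> 'w \<Rightarrow> real) \<Rightarrow> ('k \<Rightarrow> 'w \<Rightarrow> real) \<Rightarrow>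
     (real \<Rightarrow> 'h::{real_inner,complete_space}) \<Rightarrow> ('w \<Rightarrow> 'h) \<Rightarrow> 'w \<Rightarrow> real" where
  "skorokhod M T X I f Z = (SOME V. is_skorokhod M T X I f Z V)"

definition cut ::
    "real \<Rightarrow> (real \<Rightarrow> 'h::{real_inner,complete_space}) \<Rightarrow> real \<Rightarrow> real \<Rightarrow> ('w \<Rightarrow> 'h) \<Rightarrow> 'w \<Rightarrow> 'h" where
  "cut T f s t Z \<omega> = truncation T f t (Z \<omega>) - truncation T f s (Z \<omega>)"


section \<open>Stieltjes integrals\<close>

definition variation_sums :: "(real \<Rightarrow> real) \<Rightarrow> real \<Rightarrow> real set" where
  "variation_sums \<gamma> t =
     {\<Sum>i<n. \<bar>\<gamma> (p (Suc i)) - \<gamma> (p i)\<bar> | (p :: nat \<Rightarrow> real) n. mono p \<and> range p \<subseteq> {0..t}}"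

definition variation :: "(real \<Rightarrow> real) \<Rightarrow> real \<Rightarrow> real" where
  "variation \<gamma> t = Sup (variation_sums \<gamma> t)"

definition clip :: "real \<Rightarrow> real \<Rightarrow> real" where
  "clip T t = max 0 (min T t)"

definition variation_measure :: "real \<Rightarrow> (real \<Rightarrow> real) \<Rightarrow> real measure" where
  "variation_measure T \<gamma> = interval_measure (\<lambda>t. variation \<gamma> (clip T t))"

text \<open>Jordan decomposition: positive and negative variation of \<open>\<gamma>\<close>.\<close>

definition stieltjes_pos :: "real \<Rightarrow> (real \<Rightarrow> real) \<Rightarrow> real measure" where
  "stieltjes_pos T \<gamma> =
     interval_measure (\<lambda>t. (variation \<gamma> (clip T t) + (\<gamma> (clip T t) - \<gamma> 0)) / 2)"

definition stieltjes_neg :: "real \<Rightarrow> (real \<Rightarrow> real) \<Rightarrow> real measure" where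
  "stieltjes_neg T \<gamma> =
     interval_measure (\<lambda>t. (variation \<gamma> (clip T t) - (\<gamma> (clip T t) - \<gamma> 0)) / 2)"

definition stieltjes_integral ::
    "real \<Rightarrow> (real \<Rightarrow> real) \<Rightarrow> real \<Rightarrow> real \<Rightarrow> (real \<Rightarrow> real) \<Rightarrow> real" where
  "stieltjes_integral T \<gamma> s t g =
     (LINT u:{s<..t}|stieltjes_pos T \<gamma>. g u) - (LINT u:{s<..t}|stieltjes_neg T \<gamma>. g u)"


section \<open>The linear BSDE\<close>

definition standing_assumptions ::
    "'w measure \<Rightarrow> real \<Rightarrow> (real \<Rightarrow> 'w \<Rightarrow> real) \<Rightarrow> (real \<Rightarrow> real) \<Rightarrow> (real \<Rightarrow> real) \<Rightarrow> (real \<Rightarrow> real) \<Rightarrow>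
     (real \<Rightarrow> 'w \<Rightarrow> real) \<Rightarrow> bool" where
  "standing_assumptions M T X a \<gamma> c G \<longleftrightarrow>
     c \<in> cameron_martin M T X \<and>
     continuous_on {0..T} \<gamma> \<and> bdd_above (variation_sums \<gamma> T) \<and>
     a \<in> borel_measurable (restrict_space borel {0..T}) \<and>
     measurable_process M T G \<and> adapted_process M T X G \<and>
     (\<integral>\<^sup>+s\<in>{0..T}. ennreal \<bar>a s\<bar> \<partial>variation_measure T \<gamma>) +
     (\<integral>\<^sup>+\<omega>. (\<integral>\<^sup>+s\<in>{0..T}. ennreal \<bar>G s \<omega>\<bar> \<partial>variation_measure T \<gamma>)\<^sup>2 \<partial>M) < \<infinity>"

definition mild_solution ::
    "'w measure \<Rightarrow> real \<Rightarrow> (real \<Rightarrow> 'w \<Rightarrow> real) \<Rightarrow> ('k \<Rightarrow> 'w \<Rightarrow> real) \<Rightarrow>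
     (real \<Rightarrow> real) \<Rightarrow> (real \<Rightarrow> real) \<Rightarrow> (real \<Rightarrow> real) \<Rightarrow> (real \<Rightarrow> 'w \<Rightarrow> real) \<Rightarrow> ('w \<Rightarrow> real) \<Rightarrow>
     (real \<Rightarrow> 'w \<Rightarrow> real) \<Rightarrow> ('w \<Rightarrow> 'h::{real_inner,complete_space}) \<Rightarrow> (real \<Rightarrow> 'h) \<Rightarrow> bool" where
  "mild_solution M T X I a \<gamma> c G \<xi> Y Z f \<longleftrightarrow>
     appropriate M T X f \<and> has_truncations T f \<and> space_of_integrands T f c \<and>
     adapted_process M T X Y \<and> measurable_process M T Y \<and>
     (\<forall>t\<in>{0..T}. Y t \<in> L2X M T X) \<and>
     (\<integral>\<^sup>+\<omega>. (\<integral>\<^sup>+s\<in>{0..T}. ennreal \<bar>a s * Y s \<omega>\<bar> \<partial>variation_measure T \<gamma>)\<^sup>2 \<partial>M) < \<infinity> \<and>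
     Z \<in> L2H M T X \<and>
     (\<forall>t\<in>{0..T}. \<exists>V. is_skorokhod M T X I f (cut T f t T Z) V) \<and>
     (\<forall>t\<in>{0..T}. AE \<omega> in M.
        Y t \<omega> = \<xi> \<omega> - stieltjes_integral T \<gamma> t T (\<lambda>s. a s * Y s \<omega> + G s \<omega>)
                - integral_wrt T f c (cut T f t T Z \<omega>)
                - skorokhod M T X I f (cut T f t T Z) \<omega>)"

end

theory Submission
  imports Defs
begin

text \<open>
  The S-transform turns the equation into scalar linear Stieltjes equations that can be solved
  explicitly.  Fix \<open>t\<close> and \<open>h\<close> and evaluate S-transforms at \<open>x = (h + c)\<^sup>t - c\<close>.  The functional
  integrating against the function associated with \<open>x\<close>, plus the one integrating against \<open>c\<close>,
  equals the functional of \<open>h + c\<close> composed with truncation at \<open>t\<close>; it annihilates the part of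
  \<open>Z\<close> after \<open>s\<close> for every \<open>s \<ge> t\<close>.  So the two integrals of \<open>Z\<close> cancel (lemmas \<open>shift_adm\<close> and
  \<open>Q_cut\<close>), and \<open>u \<mapsto> (S Y\<^sub>u)(x)\<close> solves on \<open>[t,T]\<close> a linear backward equation driven by \<open>\<gamma>\<close> with
  integrating factor \<open>A\<close> (\<open>S_equation\<close>, \<open>linear_backward_equation\<close>).  Rearranged, its solution says
  that \<open>\<xi>'\<close> has at \<open>x\<close> the same S-transform as \<open>\<eta> = A(t) Y\<^sub>t - \<integral>\<^sub>0\<^sup>t A G d\<gamma>\<close>.

  The variable \<open>\<eta>\<close> is measurable with respect to the past of \<open>t\<close>, and \<open>x\<close> and \<open>h\<close> have the same inner
  products with the indicators up to time \<open>t\<close>.  Hence \<open>\<eta>\<close> has the same S-transform at \<open>x\<close> and at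
  \<open>h\<close> (\<open>S_transform_adapted\<close>).  This gives the identity defining the quasi-conditional expectation
  of \<open>\<xi>'\<close>, at first for the \<open>h\<close> admissible as integrators; these are dense (\<open>adm_dense\<close>), and both
  sides are continuous in \<open>h\<close> (\<open>S_tendsto\<close>).  Injectivity of the S-transform
  (\<open>S_transform_injective\<close>) identifies \<open>\<eta>\<close> with the chosen version, and solving for \<open>Y\<^sub>t\<close> gives the
  formula.

  The probabilistic input is that a random variable orthogonal to all exponentials of finite linear
  combinations of the process up to time \<open>r\<close> is orthogonal to everything measurable by time \<open>r\<close>
  (\<open>exponentials_determine_cond_exp\<close>); this rests on uniqueness of the Laplace transform.  It applies
  to differences of Wick exponentials because \<open>E[e\<^bsup>I(x)\<^esup>] = e\<^bsup>|x|\<^sup>2/2\<^esup>\<close>.  The analytic input is that the variation of a continuous function is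
  continuous, so that its Stieltjes measure has no atoms and the ordinary product and chain rules
  hold.  That \<open>\<integral>\<^sub>0\<^sup>t A G d\<gamma>\<close> is adapted follows from Fubini's theorem applied to
  conditional probabilities (\<open>signed_integral_adapted\<close>).
\<close>

section \<open>Bounded operators on a Hilbert space\<close>

lemma Cauchy_inverse_bound:
  fixes x :: "nat \<Rightarrow> 'a::real_normed_vector"
  assumes bound: "\<And>p q. (norm (x p - x q))\<^sup>2 \<le> 2 / real (Suc p) + 2 / real (Suc q)"
  shows "Cauchy x"
proof (rule metric_CauchyI)
  fix e :: real assume "0 < e"
  obtain N where N: "1 / real (Suc N) < e\<^sup>2 / 4"
    using \<open>0 < e\<close> nat_approx_posE[of "e\<^sup>2 / 4"] by auto
  have "dist (x p) (x q) < e" if "N \<le> p" "N \<le> q" for p q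
  proof -
    have "1 / real (Suc p) \<le> 1 / real (Suc N)" "1 / real (Suc q) \<le> 1 / real (Suc N)"
      using that by (auto intro!: divide_left_mono)
    then have "(norm (x p - x q))\<^sup>2 < e\<^sup>2"
      using bound[of p q] N by auto
    then show ?thesis
      using \<open>0 < e\<close> by (simp add: dist_norm power2_less_imp_less)
  qed
  then show "\<exists>M. \<forall>p\<ge>M. \<forall>q\<ge>M. dist (x p) (x q) < e" by blast
qed

text \<open>
  The representing vector is the minimiser of \<open>x \<mapsto> |x|\<^sup>2 - 2 \<phi>(x)\<close>: by the parallelogram law minimising
  sequences are Cauchy, and the first order condition at the minimiser is the representation.
\<close>

lemma riesz_representation:
  fixes \<phi> :: "'h::{real_inner,complete_space} \<Rightarrow> real"
  assumes \<phi>: "bounded_linear \<phi>"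
  obtains y where "\<And>x. \<phi> x = inner x y"
proof -
  interpret \<phi>: bounded_linear \<phi> by fact
  define J where "J x = (norm x)\<^sup>2 - 2 * \<phi> x" for x
  define m where "m = Inf (range J)"
  obtain K where K: "\<And>x. norm (\<phi> x) \<le> norm x * K"
    using \<phi>.bounded by blast
  have J_ge: "- K\<^sup>2 \<le> J x" for x
  proof -
    have "0 \<le> (norm x - K)\<^sup>2" by simp
    moreover have "\<phi> x \<le> norm x * K" using K[of x] by auto
    ultimately show ?thesis
      unfolding J_def by (simp add: power2_diff)
  qed
  have bdd: "bdd_below (range J)"
    using J_ge by (intro bdd_belowI[of _ "- K\<^sup>2"]) auto
  have m_le: "m \<le> J x" for x
    unfolding m_def using bdd by (intro cInf_lower) auto
  have near: "(norm (u - v))\<^sup>2 \<le> 2 * (J u + J v - 2 * m)" for u v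
  proof -
    have "J u + J v - 2 * J ((1/2) *\<^sub>R (u + v)) = (norm (u - v))\<^sup>2 / 2"
      unfolding J_def power2_norm_eq_inner
      by (simp add: \<phi>.scaleR \<phi>.add inner_simps inner_commute algebra_simps)
    with m_le[of "(1/2) *\<^sub>R (u + v)"] show ?thesis by simp
  qed
  have "\<exists>x. J x < m + 1 / real (Suc n)" for n
  proof -
    have "Inf (range J) < m + 1 / real (Suc n)" by (simp add: m_def)
    then show ?thesis using cInf_lessD[of "range J"] by auto
  qed
  then obtain x where x: "\<And>n. J (x n) < m + 1 / real (Suc n)" by metis
  have "Cauchy x"
  proof (rule Cauchy_inverse_bound)
    show "(norm (x p - x q))\<^sup>2 \<le> 2 / real (Suc p) + 2 / real (Suc q)" for p q
      using near[of "x p" "x q"] x[of p] x[of q] by simp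
  qed
  then obtain y where y: "x \<longlonglongrightarrow> y"
    using Cauchy_convergent convergent_def by blast
  have "(\<lambda>n. J (x n)) \<longlonglongrightarrow> J y"
    unfolding J_def by (intro tendsto_intros y \<phi>.tendsto)
  moreover have "(\<lambda>n. m + 1 / real (Suc n)) \<longlonglongrightarrow> m + 0"
    by (intro tendsto_intros LIMSEQ_Suc[OF lim_1_over_n])
  moreover have "J (x n) \<le> m + 1 / real (Suc n)" for n
    using x[of n] by (rule less_imp_le)
  ultimately have Jy: "J y \<le> m"
    by (metis (no_types, lifting) LIMSEQ_le add.right_neutral)
  have "\<phi> z = inner z y" for z
  proof (cases "z = 0")
    case False
    define d where "d = inner z y - \<phi> z"
    \<comment> \<open>along the line through \<open>y\<close> in direction \<open>z\<close> the functional is a quadratic polynomial, minimal at \<open>s\<close>\<close>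
    define s where "s = - d / (norm z)\<^sup>2"
    have "J y \<le> J (y + s *\<^sub>R z)" using Jy m_le order_trans by blast
    also have "J (y + s *\<^sub>R z) = J y + (s\<^sup>2 * (norm z)\<^sup>2 + 2 * s * d)"
      unfolding J_def power2_norm_eq_inner d_def
      by (simp add: \<phi>.scaleR \<phi>.add inner_simps inner_commute algebra_simps power2_eq_square)
    also have "s\<^sup>2 * (norm z)\<^sup>2 + 2 * s * d = - (d\<^sup>2 / (norm z)\<^sup>2)"
      using False unfolding s_def by (simp add: power2_eq_square field_simps)
    finally have "d\<^sup>2 / (norm z)\<^sup>2 \<le> 0" by simp
    then have "d = 0"
      using False by (simp add: divide_le_0_iff)
    then show ?thesis by (simp add: d_def)
  qed (simp add: \<phi>.zero)
  then show ?thesis by (rule that)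
qed

text \<open>
  By the Riesz representation the adjoint of a bounded operator exists, so that the choice in the
  definition of \<open>adjoint\<close> is meaningful also in infinite dimension.
\<close>

lemma adjoint_hilbert:
  fixes L :: "'h::{real_inner,complete_space} \<Rightarrow> 'h"
  assumes L: "bounded_linear L"
  shows adjoint_hilbert_inner: "inner (L x) y = inner x (adjoint L y)"
    and bounded_linear_adjoint_hilbert: "bounded_linear (adjoint L)"
proof -
  interpret L: bounded_linear L by fact
  have "\<exists>g. \<forall>x. inner (L x) y = inner x g" for y
    by (rule riesz_representation[of "\<lambda>x. inner (L x) y"])
      (auto intro: bounded_linear_compose[OF bounded_linear_inner_left L])
  then have "\<exists>g. \<forall>x y. inner (L x) y = inner x (g y)" by metis
  then have *: "inner (L x) y = inner x (adjoint L y)" for x y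
    unfolding adjoint_def by (rule someI2_ex) auto
  show "inner (L x) y = inner x (adjoint L y)" by (rule *)
  obtain K where K: "\<And>x. norm (L x) \<le> norm x * K" "0 < K"
    using L.pos_bounded by blast
  show "bounded_linear (adjoint L)"
  proof (rule bounded_linear_intro[where K = K])
    show "adjoint L (x + y) = adjoint L x + adjoint L y" for x y
      by (rule iffD1[OF vector_eq_ldot]) (simp add: inner_simps flip: *)
    show "adjoint L (r *\<^sub>R x) = r *\<^sub>R adjoint L x" for r x
      by (rule iffD1[OF vector_eq_ldot]) (simp add: inner_simps flip: *)
    show "norm (adjoint L y) \<le> norm y * K" for y
    proof -
      have "norm (adjoint L y) * norm (adjoint L y) = inner (L (adjoint L y)) y"
        by (simp add: * flip: power2_eq_square power2_norm_eq_inner)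
      also have "\<dots> \<le> norm (L (adjoint L y)) * norm y" by (rule norm_cauchy_schwarz)
      also have "\<dots> \<le> (norm (adjoint L y) * K) * norm y"
        by (intro mult_right_mono K) auto
      finally have "norm (adjoint L y) * norm (adjoint L y) \<le> norm (adjoint L y) * (norm y * K)"
        by (simp add: mult_ac)
      then show ?thesis
        using K(2) by (cases "adjoint L y = 0") auto
    qed
  qed
qed

lemma bounded_linear_eq_on_total:
  assumes "bounded_linear L" "bounded_linear L'" "indicators_total T e"
    and "\<And>t. t \<in> {0..T} \<Longrightarrow> L (e t) = L' (e t)"
  shows "L = L'"
proof
  fix x
  interpret L: bounded_linear L by fact
  interpret L': bounded_linear L' by fact
  have "L v = L' v" if "v \<in> span (e ` {0..T})" for v
    using that assms(4)
    by (intro linear_eq_on_span[of L L' "e ` {0..T}" v] L.linear_axioms L'.linear_axioms) auto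
  then have "span (e ` {0..T}) \<subseteq> {v. L v = L' v}" by auto
  moreover have "closed {v. L v = L' v}"
    by (intro closed_Collect_eq L.continuous_on L'.continuous_on continuous_on_id)
  ultimately have "closure (span (e ` {0..T})) \<subseteq> {v. L v = L' v}"
    by (rule closure_minimal)
  with assms(3) show "L x = L' x" by (auto simp: indicators_total_def)
qed

text \<open>
  Totality of the indicators makes the operator unique, which discharges the definite description in
  \<open>truncation\<close>; the integral functionals below are treated in the same way.
\<close>

lemma truncation_works:
  assumes "indicators_total T e" "has_truncations T e" "r \<in> {0..T}"
  shows bounded_linear_truncation: "bounded_linear (truncation T e r)"
    and truncation_indicator: "t \<in> {0..T} \<Longrightarrow> truncation T e r (e t) = e (min t r)"
proof -
  have "\<exists>!L. is_truncation T e r L"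
  proof -
    obtain L where "is_truncation T e r L" using assms(2,3) unfolding has_truncations_def by blast
    moreover have "L' = L" if "is_truncation T e r L'" for L'
      using that calculation assms(1)
      by (intro bounded_linear_eq_on_total[of L' L T e]) (auto simp: is_truncation_def)
    ultimately show ?thesis by blast
  qed
  then have "is_truncation T e r (truncation T e r)"
    unfolding truncation_def by (rule theI')
  then show "bounded_linear (truncation T e r)"
    and "t \<in> {0..T} \<Longrightarrow> truncation T e r (e t) = e (min t r)"
    by (auto simp: is_truncation_def)
qed

lemma integral_wrt_eqI:
  assumes "indicators_total T e" "bounded_linear \<phi>" "\<And>t. t \<in> {0..T} \<Longrightarrow> \<phi> (e t) = c t"
  shows "integral_wrt T e c = \<phi>"
  unfolding integral_wrt_def
proof (rule the_equality)
  show "is_integrator_functional T e c \<phi>"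
    using assms by (auto simp: is_integrator_functional_def)
  show "\<psi> = \<phi>" if "is_integrator_functional T e c \<psi>" for \<psi>
    using that assms by (intro bounded_linear_eq_on_total[of \<psi> \<phi> T e])
      (auto simp: is_integrator_functional_def)
qed

lemma integral_wrt_works:
  assumes "space_of_integrands T e c"
  shows bounded_linear_integral_wrt: "bounded_linear (integral_wrt T e c)"
    and integral_wrt_indicator: "t \<in> {0..T} \<Longrightarrow> integral_wrt T e c (e t) = c t"
proof -
  obtain \<phi> where \<phi>: "bounded_linear \<phi>" "\<And>t. t \<in> {0..T} \<Longrightarrow> \<phi> (e t) = c t"
    using assms by (auto simp: space_of_integrands_def is_integrator_functional_def)
  then have "integral_wrt T e c = \<phi>"
    using assms by (intro integral_wrt_eqI) (auto simp: space_of_integrands_def)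
  with \<phi> show "bounded_linear (integral_wrt T e c)"
    and "t \<in> {0..T} \<Longrightarrow> integral_wrt T e c (e t) = c t" by auto
qed

section \<open>The variation of a continuous function and its Stieltjes measures\<close>

lemma variation_sumsI:
  "mono p \<Longrightarrow> range p \<subseteq> {0..t} \<Longrightarrow> (\<Sum>i<n. \<bar>\<gamma> (p (Suc i)) - \<gamma> (p i)\<bar>) \<in> variation_sums \<gamma> t"
  unfolding variation_sums_def by blast

lemma variation_sums_mono: "s \<le> t \<Longrightarrow> variation_sums \<gamma> s \<subseteq> variation_sums \<gamma> t"
proof
  fix S assume "s \<le> t" "S \<in> variation_sums \<gamma> s"
  then obtain p n where "mono p" "range p \<subseteq> {0..s}" "S = (\<Sum>i<n. \<bar>\<gamma> (p (Suc i)) - \<gamma> (p i)\<bar>)"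
    unfolding variation_sums_def by blast
  with \<open>s \<le> t\<close> show "S \<in> variation_sums \<gamma> t"
    using variation_sumsI[of p t \<gamma> n] by (simp add: image_subset_iff) (meson order_trans)
qed

lemma zero_in_variation_sums: "0 \<le> t \<Longrightarrow> 0 \<in> variation_sums \<gamma> t"
  using variation_sumsI[of "\<lambda>_. 0" t \<gamma> 0] by (auto simp: mono_def)

locale bounded_variation =
  fixes T :: real and \<gamma> :: "real \<Rightarrow> real"
  assumes T_pos: "0 < T" and cont: "continuous_on {0..T} \<gamma>"
    and bdd: "bdd_above (variation_sums \<gamma> T)"
begin

lemma bdd_above_variation_sums: "t \<le> T \<Longrightarrow> bdd_above (variation_sums \<gamma> t)"
  using bdd_above_mono[OF bdd variation_sums_mono] .

lemma variation_upper: "S \<in> variation_sums \<gamma> t \<Longrightarrow> t \<le> T \<Longrightarrow> S \<le> variation \<gamma> t"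
  unfolding variation_def by (intro cSup_upper bdd_above_variation_sums)

lemma variation_superadditive:
  assumes "0 \<le> v" "v \<le> t" "t \<le> T" "mono q" "range q \<subseteq> {v..t}"
  shows "variation \<gamma> v + (\<Sum>i<m. \<bar>\<gamma> (q (Suc i)) - \<gamma> (q i)\<bar>) \<le> variation \<gamma> t"
proof -
  let ?Q = "\<Sum>i<m. \<bar>\<gamma> (q (Suc i)) - \<gamma> (q i)\<bar>"
  have "S \<le> variation \<gamma> t - ?Q" if S: "S \<in> variation_sums \<gamma> v" for S
  proof -
    obtain p n where p: "mono p" "range p \<subseteq> {0..v}" "S = (\<Sum>i<n. \<bar>\<gamma> (p (Suc i)) - \<gamma> (p i)\<bar>)"
      using S unfolding variation_sums_def by auto
    \<comment> \<open>run through \<open>p\<close>, jump to \<open>q 0\<close>, run through \<open>q\<close>; the jump only adds a nonnegative term\<close>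
    define r where "r i = (if i \<le> n then p i else q (i - Suc n))" for i
    have le: "p i \<le> q j" for i j
      using p(2) assms(5) by (meson atLeastAtMost_iff order_trans range_subsetD)
    have "mono r"
      unfolding r_def mono_def using le monoD[OF p(1)] monoD[OF assms(4)]
      by (simp add: diff_le_mono)
    moreover have "range r \<subseteq> {0..t}"
    proof
      fix x assume "x \<in> range r"
      then obtain i where "x = p i \<or> x = q i" by (auto simp: r_def split: if_splits)
      moreover have "p i \<in> {0..v}" "q i \<in> {v..t}" using p(2) assms(5) by blast+
      ultimately show "x \<in> {0..t}" using assms(1,2) by auto
    qed
    ultimately have "(\<Sum>i<Suc n + m. \<bar>\<gamma> (r (Suc i)) - \<gamma> (r i)\<bar>) \<le> variation \<gamma> t"
      using assms(3) by (intro variation_upper variation_sumsI)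
    moreover have "(\<Sum>i<Suc n + m. \<bar>\<gamma> (r (Suc i)) - \<gamma> (r i)\<bar>) =
        (\<Sum>i<Suc n. \<bar>\<gamma> (r (Suc i)) - \<gamma> (r i)\<bar>) + (\<Sum>i<m. \<bar>\<gamma> (r (Suc (Suc n + i))) - \<gamma> (r (Suc n + i))\<bar>)"
    proof (induction m)
      case (Suc m)
      have "Suc n + Suc m = Suc (Suc n + m)" by simp
      with Suc show ?case by (simp only: sum.lessThan_Suc)
    qed simp
    moreover have "(\<Sum>i<m. \<bar>\<gamma> (r (Suc (Suc n + i))) - \<gamma> (r (Suc n + i))\<bar>) = ?Q"
      unfolding r_def by simp
    moreover have "S \<le> (\<Sum>i<Suc n. \<bar>\<gamma> (r (Suc i)) - \<gamma> (r i)\<bar>)"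
    proof -
      have "S = (\<Sum>i<n. \<bar>\<gamma> (r (Suc i)) - \<gamma> (r i)\<bar>)"
        unfolding p(3) r_def by simp
      then show ?thesis by simp
    qed
    ultimately show ?thesis by linarith
  qed
  then have "variation \<gamma> v \<le> variation \<gamma> t - ?Q"
    unfolding variation_def using zero_in_variation_sums[OF assms(1)] by (intro cSup_least) auto
  then show ?thesis by simp
qed

lemma abs_increment_le_variation:
  assumes "0 \<le> s" "s \<le> t" "t \<le> T"
  shows "\<bar>\<gamma> t - \<gamma> s\<bar> \<le> variation \<gamma> t - variation \<gamma> s"
proof -
  have "mono (\<lambda>i::nat. if i = 0 then s else t)" using assms(2) by (auto simp: mono_def)
  moreover have "range (\<lambda>i::nat. if i = 0 then s else t) \<subseteq> {s..t}" using assms(2) by auto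
  ultimately show ?thesis
    using variation_superadditive[OF assms(1,2,3), of "\<lambda>i. if i = 0 then s else t" 1] by simp
qed

lemma variation_mono: "0 \<le> s \<Longrightarrow> s \<le> t \<Longrightarrow> t \<le> T \<Longrightarrow> variation \<gamma> s \<le> variation \<gamma> t"
  using abs_increment_le_variation[of s t] by linarith

text \<open>
  Each increment of the partition is at most the sum of the increments of the partition clamped to
  \<open>[0,u]\<close>, to \<open>[u,v]\<close> and to \<open>[v,T]\<close>.  Without partition points between \<open>u\<close> and \<open>v\<close> the middle part is at
  most a single jump from \<open>u\<close> to \<open>v\<close>, so a nearly optimal partition leaves little variation there beyond that
  jump.
\<close>

lemma variation_gap:
  assumes p: "mono p" "range p \<subseteq> {0..T}"
    and S: "variation \<gamma> T - \<epsilon> < (\<Sum>i<n. \<bar>\<gamma> (p (Suc i)) - \<gamma> (p i)\<bar>)"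
    and uv: "0 \<le> u" "u \<le> v" "v \<le> T" and gap: "\<And>i. i \<le> n \<Longrightarrow> p i \<le> u \<or> v \<le> p i"
  shows "variation \<gamma> v - variation \<gamma> u \<le> \<bar>\<gamma> v - \<gamma> u\<bar> + \<epsilon>"
proof -
  let ?inc = "\<lambda>q i. \<bar>\<gamma> (q (Suc i)) - \<gamma> (q i)\<bar>"
  define l where "l i = min (p i) u" for i
  define h where "h i = max (p i) v" for i
  \<comment> \<open>\<open>c\<close> jumps at most once, where the partition crosses the gap\<close>
  define c where "c i = (if p i \<le> u then 0 else 1::real)" for i
  have p_range: "0 \<le> p i" "p i \<le> T" for i using p(2) by (auto simp: image_subset_iff)
  have "mono l" "mono h" using p(1) by (auto simp: l_def h_def mono_def intro: min.coboundedI1 max.coboundedI1)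
  have "(\<Sum>i<n. ?inc l i) \<le> variation \<gamma> u"
    using uv p_range
    by (intro variation_upper variation_sumsI \<open>mono l\<close>) (auto simp: l_def)
  moreover have "variation \<gamma> v + (\<Sum>i<n. ?inc h i) \<le> variation \<gamma> T"
    using uv p_range by (intro variation_superadditive \<open>mono h\<close>) (auto simp: h_def)
  moreover have "(\<Sum>i<n. ?inc p i) \<le> (\<Sum>i<n. ?inc l i + \<bar>\<gamma> v - \<gamma> u\<bar> * (c (Suc i) - c i) + ?inc h i)"
  proof (rule sum_mono)
    fix i assume "i \<in> {..<n}"
    then have g: "p i \<le> u \<or> v \<le> p i" "p (Suc i) \<le> u \<or> v \<le> p (Suc i)"
      using gap[of i] gap[of "Suc i"] by auto
    have m: "p i \<le> p (Suc i)" using p(1) by (simp add: mono_def)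
    consider "p (Suc i) \<le> u" | "p i \<le> u" "u < p (Suc i)" "v \<le> p (Suc i)" | "u < p i" "v \<le> p i"
      using g m by fastforce
    then show "?inc p i \<le> ?inc l i + \<bar>\<gamma> v - \<gamma> u\<bar> * (c (Suc i) - c i) + ?inc h i"
    proof cases
      case 3
      then have "h i = p i" "h (Suc i) = p (Suc i)" using m by (auto simp: h_def)
      then show ?thesis using 3 m by (auto simp: c_def)
    qed (use m uv in \<open>auto simp: l_def h_def c_def min_def max_def\<close>)
  qed
  moreover have "(\<Sum>i<n. ?inc l i + \<bar>\<gamma> v - \<gamma> u\<bar> * (c (Suc i) - c i) + ?inc h i)
    \<le> (\<Sum>i<n. ?inc l i) + \<bar>\<gamma> v - \<gamma> u\<bar> + (\<Sum>i<n. ?inc h i)"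
  proof -
    have "(\<Sum>i<n. c (Suc i) - c i) = c n - c 0" by (rule sum_lessThan_telescope)
    also have "\<dots> \<le> 1" by (simp add: c_def)
    finally have "\<bar>\<gamma> v - \<gamma> u\<bar> * (\<Sum>i<n. c (Suc i) - c i) \<le> \<bar>\<gamma> v - \<gamma> u\<bar>"
      by (metis abs_ge_zero mult.right_neutral mult_left_mono)
    then show ?thesis by (simp add: sum.distrib flip: sum_distrib_left)
  qed
  ultimately show ?thesis using S by linarith
qed

text \<open>
  If a partition nearly exhausts the total variation, then between two of its points the variation
  exceeds the increment of \<open>\<gamma>\<close> by little; continuity of \<open>\<gamma>\<close> therefore passes to its variation.
\<close>

lemma continuous_variation: "continuous_on {0..T} (variation \<gamma>)"
proof (rule continuous_onI)
  fix t \<epsilon> :: real assume t: "t \<in> {0..T}" and "0 < \<epsilon>"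
  have "variation \<gamma> T - \<epsilon>/4 < Sup (variation_sums \<gamma> T)"
    using \<open>0 < \<epsilon>\<close> by (simp add: variation_def)
  then obtain S where "S \<in> variation_sums \<gamma> T" "variation \<gamma> T - \<epsilon>/4 < S"
    using less_cSupD[of "variation_sums \<gamma> T"] zero_in_variation_sums[of T \<gamma>] T_pos by auto
  then obtain p n where p: "mono p" "range p \<subseteq> {0..T}"
    and S: "variation \<gamma> T - \<epsilon>/4 < (\<Sum>i<n. \<bar>\<gamma> (p (Suc i)) - \<gamma> (p i)\<bar>)"
    unfolding variation_sums_def by auto
  obtain d1 where d1: "0 < d1" "\<And>s. s \<in> {0..T} \<Longrightarrow> dist s t < d1 \<Longrightarrow> dist (\<gamma> s) (\<gamma> t) < \<epsilon>/4"
    using cont t \<open>0 < \<epsilon>\<close> unfolding continuous_on_iff by (metis divide_pos_pos zero_less_numeral)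
  \<comment> \<open>of the points \<open>p 0, \<dots>, p n\<close> at most \<open>t\<close> itself lies within distance less than \<open>d2\<close> of \<open>t\<close>\<close>
  define d2 where "d2 = Min (insert d1 ((\<lambda>i. \<bar>p i - t\<bar>) ` {i. i \<le> n \<and> p i \<noteq> t}))"
  have d2: "0 < d2" "d2 \<le> d1" "\<And>i. i \<le> n \<Longrightarrow> p i \<noteq> t \<Longrightarrow> d2 \<le> \<bar>p i - t\<bar>"
    unfolding d2_def using d1(1) by (auto intro!: Min_le)
  have "dist (variation \<gamma> s) (variation \<gamma> t) \<le> \<epsilon>" if s: "s \<in> {0..T}" "dist s t < d2" for s
  proof -
    define u where "u = min s t"
    define v where "v = max s t"
    have "\<bar>\<gamma> v - \<gamma> u\<bar> < \<epsilon>/4"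
      using d1(2)[OF s(1)] s(2) d2(2) by (auto simp: u_def v_def dist_real_def min_def max_def abs_minus_commute)
    moreover have "p i \<le> u \<or> v \<le> p i" if "i \<le> n" for i
      using d2(3)[OF that] s(2) by (cases "p i = t") (auto simp: u_def v_def dist_real_def min_def max_def)
    then have "variation \<gamma> v - variation \<gamma> u \<le> \<bar>\<gamma> v - \<gamma> u\<bar> + \<epsilon>/4"
      using s t by (intro variation_gap[OF p S]) (auto simp: u_def v_def)
    moreover have "variation \<gamma> u \<le> variation \<gamma> v"
      using s t by (intro variation_mono) (auto simp: u_def v_def)
    moreover have "dist (variation \<gamma> s) (variation \<gamma> t) = \<bar>variation \<gamma> v - variation \<gamma> u\<bar>"
      by (auto simp: u_def v_def dist_real_def min_def max_def)
    ultimately show ?thesis using \<open>0 < \<epsilon>\<close> by simp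
  qed
  then show "\<exists>d>0. \<forall>s\<in>{0..T}. dist s t < d \<longrightarrow> dist (variation \<gamma> s) (variation \<gamma> t) \<le> \<epsilon>"
    using d2(1) by blast
qed

end

lemma clip_in: "0 \<le> T \<Longrightarrow> clip T t \<in> {0..T}"
  by (auto simp: clip_def)

lemma clip_id: "t \<in> {0..T} \<Longrightarrow> clip T t = t"
  by (auto simp: clip_def)

lemma continuous_on_clip: "continuous_on UNIV (clip T)"
  unfolding clip_def by (intro continuous_intros)

text \<open>
  The Radon--Nikodym derivative is at most \<open>1\<close> almost everywhere because it integrates to at most the
  measure of the set where it exceeds \<open>1\<close>; cutting it off there gives a version with values in \<open>[0,1]\<close>.
\<close>

lemma density_of_dominated_measure:
  assumes "finite_measure \<nu>" "finite_measure P" and sets: "sets P = sets \<nu>"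
    and le: "\<And>A. A \<in> sets \<nu> \<Longrightarrow> emeasure P A \<le> emeasure \<nu> A"
  obtains p :: "'a \<Rightarrow> real" where "p \<in> borel_measurable \<nu>" "\<And>x. 0 \<le> p x" "\<And>x. p x \<le> 1"
    "P = density \<nu> (\<lambda>x. ennreal (p x))"
proof -
  interpret nu: finite_measure \<nu> by fact
  have ac: "absolutely_continuous \<nu> P"
    unfolding absolutely_continuous_def
  proof
    fix A assume "A \<in> null_sets \<nu>"
    then show "A \<in> null_sets P"
      using le[of A] sets by (auto simp: null_sets_def)
  qed
  define D where "D = RN_deriv \<nu> P"
  have [measurable]: "D \<in> borel_measurable \<nu>" by (simp add: D_def)
  have D: "density \<nu> D = P" unfolding D_def by (rule nu.density_RN_deriv[OF ac sets])
  define B where "B = {x \<in> space \<nu>. 1 < D x}"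
  have B [measurable]: "B \<in> sets \<nu>" unfolding B_def by measurable
  have "(\<integral>\<^sup>+x. D x * indicator B x - indicator B x \<partial>\<nu>) =
      (\<integral>\<^sup>+x. D x * indicator B x \<partial>\<nu>) - (\<integral>\<^sup>+x. indicator B x \<partial>\<nu>)"
  proof (rule nn_integral_diff)
    show "(\<integral>\<^sup>+x. indicator B x \<partial>\<nu>) \<noteq> \<infinity>" using nu.emeasure_finite[of B] by simp
  qed (auto simp: B_def indicator_def intro: less_imp_le)
  also have "(\<integral>\<^sup>+x. D x * indicator B x \<partial>\<nu>) = emeasure P B"
    unfolding D[symmetric] by (rule emeasure_density[symmetric]) auto
  also have "(\<integral>\<^sup>+x. indicator B x \<partial>\<nu>) = emeasure \<nu> B" by simp
  also have "emeasure P B - emeasure \<nu> B = 0"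
  proof -
    have "emeasure P B < \<top>"
      using le[OF B] nu.emeasure_finite[of B] by (rule le_less_trans[OF _ less_top[THEN iffD1]])
    then show ?thesis using le[OF B] by (simp add: diff_eq_0_iff_ennreal)
  qed
  finally have "AE x in \<nu>. D x * indicator B x - indicator B x = 0"
    by (subst (asm) nn_integral_0_iff_AE) auto
  then have AE: "AE x in \<nu>. D x \<le> 1"
    using AE_space
  proof eventually_elim
    case (elim x)
    then show ?case
      by (cases "1 < D x") (auto simp: B_def indicator_def diff_eq_0_iff_ennreal not_less)
  qed
  define p where "p x = enn2real (min 1 (D x))" for x
  have p: "ennreal (p x) = min 1 (D x)" for x
    unfolding p_def by (rule ennreal_enn2real) (simp add: min_less_iff_disj)
  show ?thesis
  proof (rule that[of p])
    show "p \<in> borel_measurable \<nu>" unfolding p_def by measurable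
    show "0 \<le> p x" for x by (simp add: p_def)
    show "p x \<le> 1" for x
      using p[of x] by (metis ennreal_1 ennreal_le_iff min.cobounded1 zero_le_one)
    show "P = density \<nu> (\<lambda>x. ennreal (p x))"
      unfolding D[symmetric] p using AE by (intro density_cong) (auto simp: min_def)
  qed
qed

context bounded_variation
begin

definition clipped_variation :: "real \<Rightarrow> real" where "clipped_variation t = variation \<gamma> (clip T t)"
definition clipped_increment :: "real \<Rightarrow> real" where "clipped_increment t = \<gamma> (clip T t) - \<gamma> 0"

lemma variation_0: "variation \<gamma> 0 = 0"
proof -
  have "variation_sums \<gamma> 0 = {0}"
  proof
    show "variation_sums \<gamma> 0 \<subseteq> {0}"
    proof
      fix S assume "S \<in> variation_sums \<gamma> 0"
      then obtain p n where "range p \<subseteq> {0..0::real}" "S = (\<Sum>i<n. \<bar>\<gamma> (p (Suc i)) - \<gamma> (p i)\<bar>)"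
        unfolding variation_sums_def by blast
      moreover from this have "p i = 0" for i by auto
      ultimately show "S \<in> {0}" by simp
    qed
  qed (use zero_in_variation_sums[of 0 \<gamma>] in auto)
  then show ?thesis by (simp add: variation_def)
qed

lemma clip_mem: "clip T t \<in> {0..T}" using clip_in[of T t] T_pos by simp

lemma continuous_clipped_variation: "continuous_on UNIV clipped_variation"
  unfolding clipped_variation_def
  by (rule continuous_on_compose2[OF continuous_variation continuous_on_clip]) (use clip_mem in auto)

lemma continuous_clipped_increment: "continuous_on UNIV clipped_increment"
  unfolding clipped_increment_def
  by (intro continuous_on_diff continuous_on_const
      continuous_on_compose2[OF cont continuous_on_clip]) (use clip_mem in auto)

lemma clipped_increment_le: "s \<le> t \<Longrightarrow> \<bar>clipped_increment t - clipped_increment s\<bar> \<le> clipped_variation t - clipped_variation s"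
proof -
  assume "s \<le> t"
  then have "clip T s \<le> clip T t" by (auto simp: clip_def)
  then show ?thesis
    using abs_increment_le_variation[of "clip T s" "clip T t"] clip_mem[of s] clip_mem[of t]
    by (auto simp: clipped_increment_def clipped_variation_def)
qed

text \<open>
  Continuity of the distribution function is what makes the interval measure free of atoms.
\<close>

lemma interval_measure_clipped:
  assumes mono: "\<And>s t. s \<le> t \<Longrightarrow> F s \<le> F t" and cont: "continuous_on UNIV F"
    and F: "\<And>t. t \<le> 0 \<Longrightarrow> F t = 0" "\<And>t. T \<le> t \<Longrightarrow> F t = F T"
  shows "finite_measure (interval_measure F)"
    and "a \<le> b \<Longrightarrow> measure (interval_measure F) {a<..b} = F b - F a"
    and "measure (interval_measure F) UNIV = F T"
    and "emeasure (interval_measure F) {x} = 0"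
proof -
  have rc: "continuous (at_right a) F" for a
    using cont by (simp add: continuous_on_eq_continuous_at continuous_at_imp_continuous_at_within)
  have bot: "(F \<longlongrightarrow> 0) at_bot"
    by (rule tendsto_eventually) (auto simp: eventually_at_bot_linorder F intro!: exI[of _ 0])
  have top: "(F \<longlongrightarrow> F T) at_top"
    by (rule tendsto_eventually) (rule eventually_mono[OF eventually_ge_at_top[of T] F(2)])
  have FT: "0 \<le> F T" using mono[of 0 T] F(1)[of 0] T_pos by simp
  note facts = mono rc bot top FT
  show "finite_measure (interval_measure F)"
    using finite_borel_measure_interval_measure[OF facts] by (simp add: finite_borel_measure_def)
  show "measure (interval_measure F) {a<..b} = F b - F a" if "a \<le> b"
    by (rule measure_interval_measure_Ioc[OF that mono rc])
  show "measure (interval_measure F) UNIV = F T"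
    using interval_measure_UNIV[OF facts] FT by (simp add: measure_def)
  show "emeasure (interval_measure F) {x} = 0"
    using emeasure_interval_measure_Icc[of x x F] mono cont by (simp add: continuous_on_subset)
qed

text \<open>
  The positive and the negative variation increase because the increments of \<open>\<gamma>\<close> are dominated by those
  of its variation.
\<close>

lemma Jordan_parts:
  assumes "F = clipped_variation \<or> F = (\<lambda>t. (clipped_variation t + clipped_increment t) / 2) \<or> F = (\<lambda>t. (clipped_variation t - clipped_increment t) / 2)"
  shows "s \<le> t \<Longrightarrow> F s \<le> F t" "continuous_on UNIV F" "t \<le> 0 \<Longrightarrow> F t = 0" "T \<le> t \<Longrightarrow> F t = F T"
proof -
  show "F s \<le> F t" if "s \<le> t"
    using clipped_increment_le[OF that] assms by (auto simp: field_simps abs_le_iff)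
  show "continuous_on UNIV F" using assms
    by (auto intro!: continuous_intros continuous_clipped_variation continuous_clipped_increment)
  have "clipped_variation t = 0" "clipped_increment t = 0" if "t \<le> 0"
    using that variation_0 T_pos by (auto simp: clipped_variation_def clipped_increment_def clip_def)
  then show "t \<le> 0 \<Longrightarrow> F t = 0" using assms by auto
  have "clipped_variation t = clipped_variation T" "clipped_increment t = clipped_increment T" if "T \<le> t"
    using that T_pos by (auto simp: clipped_variation_def clipped_increment_def clip_def)
  then show "T \<le> t \<Longrightarrow> F t = F T" using assms by auto
qed

lemma Jordan_interval_measure:
  assumes "F = clipped_variation \<or> F = (\<lambda>t. (clipped_variation t + clipped_increment t) / 2) \<or> F = (\<lambda>t. (clipped_variation t - clipped_increment t) / 2)"
  shows "finite_measure (interval_measure F)"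
    and "a \<le> b \<Longrightarrow> measure (interval_measure F) {a<..b} = F b - F a"
    and "measure (interval_measure F) UNIV = F T"
    and "emeasure (interval_measure F) {x} = 0"
  using interval_measure_clipped[of F, OF Jordan_parts[OF assms]] by blast+

lemma stieltjes_measures:
  "variation_measure T \<gamma> = interval_measure clipped_variation"
  "stieltjes_pos T \<gamma> = interval_measure (\<lambda>t. (clipped_variation t + clipped_increment t) / 2)"
  "stieltjes_neg T \<gamma> = interval_measure (\<lambda>t. (clipped_variation t - clipped_increment t) / 2)"
  by (simp_all add: variation_measure_def stieltjes_pos_def stieltjes_neg_def clipped_variation_def[abs_def] clipped_increment_def)

lemma sets_stieltjes [measurable_cong, simp]:
  "sets (variation_measure T \<gamma>) = sets borel"
  "sets (stieltjes_pos T \<gamma>) = sets borel"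
  "sets (stieltjes_neg T \<gamma>) = sets borel"
  by (simp_all add: stieltjes_measures)

lemma finite_stieltjes:
  "finite_measure (variation_measure T \<gamma>)"
  "finite_measure (stieltjes_pos T \<gamma>)"
  "finite_measure (stieltjes_neg T \<gamma>)"
  unfolding stieltjes_measures by (rule Jordan_interval_measure, simp)+

lemma variation_measure_singleton: "emeasure (variation_measure T \<gamma>) {x} = 0"
  unfolding stieltjes_measures by (rule Jordan_interval_measure, simp)

text \<open>
  Equality holds on half-open intervals, which form a stable generator of the Borel sets.
\<close>

lemma variation_measure_eq_sum:
  assumes "A \<in> sets borel"
  shows "measure (variation_measure T \<gamma>) A = measure (stieltjes_pos T \<gamma>) A + measure (stieltjes_neg T \<gamma>) A"
proof -
  interpret nu: finite_measure "variation_measure T \<gamma>" by (rule finite_stieltjes)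
  interpret P: finite_measure "stieltjes_pos T \<gamma>" by (rule finite_stieltjes)
  interpret N: finite_measure "stieltjes_neg T \<gamma>" by (rule finite_stieltjes)
  have [simp]: "space (variation_measure T \<gamma>) = UNIV" "space (stieltjes_pos T \<gamma>) = UNIV" "space (stieltjes_neg T \<gamma>) = UNIV"
    by (simp_all add: stieltjes_measures)
  let ?G = "range (\<lambda>(a::real, b). {a<..b})"
  have Ioc: "measure (variation_measure T \<gamma>) {a<..b} = measure (stieltjes_pos T \<gamma>) {a<..b} + measure (stieltjes_neg T \<gamma>) {a<..b}"
    for a b
  proof (cases "a \<le> b")
    case True
    have "measure (variation_measure T \<gamma>) {a<..b} = clipped_variation b - clipped_variation a"
      "measure (stieltjes_pos T \<gamma>) {a<..b} = (clipped_variation b + clipped_increment b) / 2 - (clipped_variation a + clipped_increment a) / 2"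
      "measure (stieltjes_neg T \<gamma>) {a<..b} = (clipped_variation b - clipped_increment b) / 2 - (clipped_variation a - clipped_increment a) / 2"
      unfolding stieltjes_measures by (rule Jordan_interval_measure(2)[OF _ True], simp)+
    then show ?thesis by (simp add: field_simps)
  qed simp
  have univ: "measure (variation_measure T \<gamma>) UNIV = measure (stieltjes_pos T \<gamma>) UNIV + measure (stieltjes_neg T \<gamma>) UNIV"
  proof -
    have "measure (variation_measure T \<gamma>) UNIV = clipped_variation T"
      "measure (stieltjes_pos T \<gamma>) UNIV = (clipped_variation T + clipped_increment T) / 2"
      "measure (stieltjes_neg T \<gamma>) UNIV = (clipped_variation T - clipped_increment T) / 2"
      unfolding stieltjes_measures by (rule Jordan_interval_measure(3), simp)+
    then show ?thesis by (simp add: field_simps)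
  qed
  have "Int_stable ?G" by (auto simp: Int_stable_def)
  moreover have "?G \<subseteq> Pow UNIV" by simp
  moreover have "A \<in> sigma_sets UNIV ?G" using assms unfolding borel_sigma_sets_Ioc by simp
  ultimately show ?thesis
  proof (induction rule: sigma_sets_induct_disjoint)
    case (basic A)
    then show ?case using Ioc by auto
  next
    case empty
    then show ?case by simp
  next
    case (compl A)
    have "A \<in> sets borel" using compl(1) unfolding borel_sigma_sets_Ioc by simp
    then show ?case
      using compl(2) univ nu.finite_measure_compl[of A] P.finite_measure_compl[of A] N.finite_measure_compl[of A]
      by simp
  next
    case (union A)
    have A: "range A \<subseteq> sets borel" using union(2) unfolding borel_sigma_sets_Ioc by auto
    have "(\<lambda>i. measure (stieltjes_pos T \<gamma>) (A i) + measure (stieltjes_neg T \<gamma>) (A i)) sums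
        (measure (stieltjes_pos T \<gamma>) (\<Union>i. A i) + measure (stieltjes_neg T \<gamma>) (\<Union>i. A i))"
      using A union(1) by (intro sums_add P.finite_measure_UNION N.finite_measure_UNION) auto
    moreover have "(\<lambda>i. measure (variation_measure T \<gamma>) (A i)) sums measure (variation_measure T \<gamma>) (\<Union>i. A i)"
      using A union(1) by (intro nu.finite_measure_UNION) auto
    ultimately show ?case using union(3) by (simp add: sums_unique2)
  qed
qed

text \<open>
  Both Jordan parts are dominated by the variation measure, so the signed integral is an ordinary one
  against the variation measure, with the difference \<open>\<sigma>\<close> of their densities as a weight.
\<close>

lemma stieltjes_density:
  obtains \<sigma> :: "real \<Rightarrow> real" where "\<sigma> \<in> borel_measurable borel" "\<And>u. \<bar>\<sigma> u\<bar> \<le> 1"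
    "\<And>s t k. k \<in> borel_measurable borel \<Longrightarrow> set_integrable (variation_measure T \<gamma>) {s<..t} k \<Longrightarrow>
      stieltjes_integral T \<gamma> s t k = (LINT u:{s<..t}|variation_measure T \<gamma>. k u * \<sigma> u)"
proof -
  let ?nu = "variation_measure T \<gamma>"
  interpret nu: finite_measure ?nu by (rule finite_stieltjes)
  interpret P: finite_measure "stieltjes_pos T \<gamma>" by (rule finite_stieltjes)
  interpret N: finite_measure "stieltjes_neg T \<gamma>" by (rule finite_stieltjes)
  have le: "emeasure (stieltjes_pos T \<gamma>) A \<le> emeasure ?nu A" "emeasure (stieltjes_neg T \<gamma>) A \<le> emeasure ?nu A"
    if "A \<in> sets ?nu" for A
    using variation_measure_eq_sum[of A] that
    by (auto simp: P.emeasure_eq_measure N.emeasure_eq_measure nu.emeasure_eq_measure)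
  obtain p where p: "p \<in> borel_measurable ?nu" "\<And>x. 0 \<le> p x" "\<And>x. p x \<le> 1"
      "stieltjes_pos T \<gamma> = density ?nu (\<lambda>x. ennreal (p x))"
    using density_of_dominated_measure[OF finite_stieltjes(1,2) _ le(1)] by auto
  obtain q where q: "q \<in> borel_measurable ?nu" "\<And>x. 0 \<le> q x" "\<And>x. q x \<le> 1"
      "stieltjes_neg T \<gamma> = density ?nu (\<lambda>x. ennreal (q x))"
    using density_of_dominated_measure[OF finite_stieltjes(1,3) _ le(2)] by auto
  show ?thesis
  proof (rule that[of "\<lambda>u. p u - q u"])
    show "(\<lambda>u. p u - q u) \<in> borel_measurable borel" using p(1) q(1) by simp
    show "\<bar>p u - q u\<bar> \<le> 1" for u using p(2,3)[of u] q(2,3)[of u] by auto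
    fix s t and k :: "real \<Rightarrow> real"
    assume [measurable]: "k \<in> borel_measurable borel" and "set_integrable ?nu {s<..t} k"
    then have int: "integrable ?nu (\<lambda>u. indicator {s<..t} u * k u)" by (simp add: set_integrable_def)
    have int2: "integrable ?nu (\<lambda>u. w u * (indicator {s<..t} u * k u))"
      if "w \<in> borel_measurable ?nu" "\<And>x. 0 \<le> w x" "\<And>x. w x \<le> 1" for w :: "real \<Rightarrow> real"
      using that by (intro Bochner_Integration.integrable_bound[OF int])
        (auto simp: abs_mult intro!: mult_left_le_one_le)
    show "stieltjes_integral T \<gamma> s t k = (LINT u:{s<..t}|?nu. k u * (p u - q u))"
      unfolding stieltjes_integral_def set_lebesgue_integral_def p(4) q(4)
      using p(1,2) q(1,2) int2[OF p(1-3)] int2[OF q(1-3)]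
      by (simp add: integral_density algebra_simps flip: Bochner_Integration.integral_diff)
  qed
qed

end

section \<open>Linear backward equations for an atomless measure\<close>

locale atomless_measure = finite_measure \<nu> for \<nu> :: "real measure" +
  assumes sets_borel [measurable_cong, simp]: "sets \<nu> = sets borel"
    and atomless: "emeasure \<nu> {x} = 0"
begin

definition tail_integral :: "real \<Rightarrow> (real \<Rightarrow> real) \<Rightarrow> real \<Rightarrow> real" where
  "tail_integral T \<alpha> s = (LINT u:{s<..T}|\<nu>. \<alpha> u)"

lemma tail_integral_eq: "tail_integral T \<alpha> s = (\<integral>u. (if s < u \<and> u \<le> T then \<alpha> u else 0) \<partial>\<nu>)"
  unfolding tail_integral_def set_lebesgue_integral_def
  by (intro Bochner_Integration.integral_cong) (auto simp: indicator_def)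

lemma borel_measurable_tail_integral [measurable]:
  assumes [measurable]: "\<alpha> \<in> borel_measurable borel"
  shows "tail_integral T \<alpha> \<in> borel_measurable borel"
  unfolding tail_integral_eq[abs_def] by measurable

lemma integrable_if_tail:
  fixes \<alpha> :: "real \<Rightarrow> real"
  assumes "integrable \<nu> \<alpha>"
  shows "integrable \<nu> (\<lambda>u. if s < u \<and> u \<le> T then \<alpha> u else 0)"
proof -
  have [measurable]: "\<alpha> \<in> borel_measurable \<nu>" using assms by simp
  show ?thesis by (rule Bochner_Integration.integrable_bound[OF assms]) auto
qed

lemma tail_integral_bound:
  assumes "integrable \<nu> \<alpha>"
  shows "\<bar>tail_integral T \<alpha> s\<bar> \<le> (\<integral>u. \<bar>\<alpha> u\<bar> \<partial>\<nu>)"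
proof -
  have "\<bar>tail_integral T \<alpha> s\<bar> \<le> (\<integral>u. \<bar>if s < u \<and> u \<le> T then \<alpha> u else 0\<bar> \<partial>\<nu>)"
    unfolding tail_integral_eq by (rule integral_abs_bound)
  also have "\<dots> \<le> (\<integral>u. \<bar>\<alpha> u\<bar> \<partial>\<nu>)"
    using assms integrable_if_tail[OF assms] by (intro integral_mono) auto
  finally show ?thesis .
qed

lemma integrable_times_bounded:
  fixes \<alpha> :: "real \<Rightarrow> real"
  assumes "integrable \<nu> \<alpha>" "g \<in> borel_measurable borel" "\<And>u. \<bar>g u\<bar> \<le> C"
  shows "integrable \<nu> (\<lambda>u. \<alpha> u * g u)"
proof (rule Bochner_Integration.integrable_bound[of _ "\<lambda>u. C * \<alpha> u"])
  have [measurable]: "\<alpha> \<in> borel_measurable \<nu>" using assms by simp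
  show "(\<lambda>u. \<alpha> u * g u) \<in> borel_measurable \<nu>" using assms(2) by measurable
  show "AE u in \<nu>. norm (\<alpha> u * g u) \<le> norm (C * \<alpha> u)"
  proof (rule AE_I2)
    fix u
    have "\<bar>g u\<bar> \<le> \<bar>C\<bar>" using assms(3)[of u] by linarith
    then show "norm (\<alpha> u * g u) \<le> norm (C * \<alpha> u)"
      by (simp add: abs_mult mult.commute[of "\<bar>C\<bar>"] mult_left_mono)
  qed
qed (use assms in auto)

lemma integrable_times_tail:
  assumes "integrable \<nu> \<alpha>" "integrable \<nu> \<beta>"
  shows "integrable \<nu> (\<lambda>u. \<alpha> u * tail_integral T \<beta> u)"
proof (rule integrable_times_bounded[OF assms(1)])
  show "tail_integral T \<beta> \<in> borel_measurable borel"
    using assms(2) by (intro borel_measurable_tail_integral) auto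
  show "\<bar>tail_integral T \<beta> u\<bar> \<le> (\<integral>u. \<bar>\<beta> u\<bar> \<partial>\<nu>)" for u
    by (rule tail_integral_bound[OF assms(2)])
qed

lemma tail_integral_cong:
  "(\<And>u. s < u \<Longrightarrow> u \<le> T \<Longrightarrow> \<alpha> u = \<beta> u) \<Longrightarrow> tail_integral T \<alpha> s = tail_integral T \<beta> s"
  unfolding tail_integral_eq by (intro Bochner_Integration.integral_cong) auto

lemma tail_integral_add:
  assumes "integrable \<nu> \<alpha>" "integrable \<nu> \<beta>"
  shows "tail_integral T (\<lambda>u. \<alpha> u + \<beta> u) s = tail_integral T \<alpha> s + tail_integral T \<beta> s"
  unfolding tail_integral_eq Bochner_Integration.integral_add[OF integrable_if_tail[OF assms(1)] integrable_if_tail[OF assms(2)], symmetric]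
  by (intro Bochner_Integration.integral_cong) auto

lemma tail_integral_mult:
  "tail_integral T (\<lambda>u. c * \<alpha> u) s = c * tail_integral T \<alpha> s"
  unfolding tail_integral_eq integral_mult_right_zero[symmetric]
  by (intro Bochner_Integration.integral_cong) auto

lemma tail_integral_diff:
  assumes "integrable \<nu> \<alpha>" "integrable \<nu> \<beta>"
  shows "tail_integral T (\<lambda>u. \<alpha> u - \<beta> u) s = tail_integral T \<alpha> s - tail_integral T \<beta> s"
  using tail_integral_add[of \<alpha> "\<lambda>u. (-1) * \<beta> u"] assms tail_integral_mult[of T "-1" \<beta> s] by simp

text \<open>
  Split the square \<open>(s, T] \<times> (s, T]\<close> along its diagonal, which is null because \<open>\<nu>\<close> has no atoms.
\<close>

lemma tail_integral_product:
  assumes \<alpha>: "integrable \<nu> \<alpha>" and \<beta>: "integrable \<nu> \<beta>"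
  shows "tail_integral T \<alpha> s * tail_integral T \<beta> s =
    tail_integral T (\<lambda>u. \<alpha> u * tail_integral T \<beta> u + \<beta> u * tail_integral T \<alpha> u) s"
proof -
  interpret P: pair_sigma_finite \<nu> \<nu> ..
  have [measurable]: "\<alpha> \<in> borel_measurable borel" "\<beta> \<in> borel_measurable borel"
    using \<alpha> \<beta> by auto
  define a where "a u = (if s < u \<and> u \<le> T then \<alpha> u else 0)" for u
  define b where "b u = (if s < u \<and> u \<le> T then \<beta> u else 0)" for u
  have [measurable]: "a \<in> borel_measurable borel" "b \<in> borel_measurable borel"
    unfolding a_def b_def by measurable
  have a: "integrable \<nu> a" and b: "integrable \<nu> b"
    unfolding a_def b_def by (intro integrable_if_tail \<alpha> \<beta>)+
  have ab: "integrable (\<nu> \<Otimes>\<^sub>M \<nu>) (\<lambda>(u, v). a u * b v)"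
    using a b by (intro P.Fubini_integrable) (auto simp: abs_mult)
  define h where "h = (\<lambda>(u, v). if u < v then a u * b v else 0)"
  define k where "k = (\<lambda>(u, v). if v \<le> u then a u * b v else 0)"
  have h: "integrable (\<nu> \<Otimes>\<^sub>M \<nu>) h"
    unfolding h_def by (rule Bochner_Integration.integrable_bound[OF ab]) auto
  have k: "integrable (\<nu> \<Otimes>\<^sub>M \<nu>) k"
    unfolding k_def by (rule Bochner_Integration.integrable_bound[OF ab]) auto
  have "tail_integral T \<alpha> s * tail_integral T \<beta> s = (\<integral>u. (\<integral>v. a u * b v \<partial>\<nu>) \<partial>\<nu>)"
    unfolding tail_integral_eq a_def[symmetric] b_def[symmetric] by simp
  also have "\<dots> = (\<integral>z. (\<lambda>(u, v). a u * b v) z \<partial>(\<nu> \<Otimes>\<^sub>M \<nu>))"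
    using P.integral_fst'[OF ab] by simp
  also have "\<dots> = (\<integral>z. h z + k z \<partial>(\<nu> \<Otimes>\<^sub>M \<nu>))"
    by (intro Bochner_Integration.integral_cong) (auto simp: h_def k_def)
  also have "\<dots> = (\<integral>z. h z \<partial>(\<nu> \<Otimes>\<^sub>M \<nu>)) + (\<integral>z. k z \<partial>(\<nu> \<Otimes>\<^sub>M \<nu>))"
    using h k by simp
  also have "(\<integral>z. h z \<partial>(\<nu> \<Otimes>\<^sub>M \<nu>)) = (\<integral>u. (\<integral>v. h (u, v) \<partial>\<nu>) \<partial>\<nu>)"
    using P.integral_fst'[OF h] by simp
  also have "\<dots> = (\<integral>u. a u * tail_integral T \<beta> u \<partial>\<nu>)"
  proof (intro Bochner_Integration.integral_cong refl)
    fix u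
    have "(\<integral>v. h (u, v) \<partial>\<nu>) = (\<integral>v. a u * (if u < v \<and> v \<le> T then \<beta> v else 0) \<partial>\<nu>)"
      by (intro Bochner_Integration.integral_cong) (auto simp: h_def a_def b_def)
    then show "(\<integral>v. h (u, v) \<partial>\<nu>) = a u * tail_integral T \<beta> u"
      by (simp add: tail_integral_eq)
  qed
  also have "(\<integral>z. k z \<partial>(\<nu> \<Otimes>\<^sub>M \<nu>)) = (\<integral>v. (\<integral>u. k (u, v) \<partial>\<nu>) \<partial>\<nu>)"
    using P.integral_snd[of "\<lambda>u v. k (u, v)"] k by (simp add: case_prod_beta')
  also have "\<dots> = (\<integral>v. b v * tail_integral T \<alpha> v \<partial>\<nu>)"
  proof (intro Bochner_Integration.integral_cong refl)
    fix v
    have "AE u in \<nu>. u \<noteq> v"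
      using atomless by (intro AE_not_in[of "{v}", simplified]) (auto simp: null_sets_def)
    then have "(\<integral>u. k (u, v) \<partial>\<nu>) = (\<integral>u. b v * (if v < u \<and> u \<le> T then \<alpha> u else 0) \<partial>\<nu>)"
      by (intro integral_cong_AE) (auto simp: k_def a_def b_def)
    then show "(\<integral>u. k (u, v) \<partial>\<nu>) = b v * tail_integral T \<alpha> v"
      by (simp add: tail_integral_eq)
  qed
  also have "(\<integral>u. a u * tail_integral T \<beta> u \<partial>\<nu>) = tail_integral T (\<lambda>u. \<alpha> u * tail_integral T \<beta> u) s"
    unfolding tail_integral_eq[of T _ s] by (intro Bochner_Integration.integral_cong) (auto simp: a_def)
  also have "(\<integral>u. b u * tail_integral T \<alpha> u \<partial>\<nu>) = tail_integral T (\<lambda>u. \<beta> u * tail_integral T \<alpha> u) s"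
    unfolding tail_integral_eq[of T _ s] by (intro Bochner_Integration.integral_cong) (auto simp: b_def)
  finally show ?thesis
    using tail_integral_add[OF integrable_times_tail[OF \<alpha> \<beta>] integrable_times_tail[OF \<beta> \<alpha>]] by simp
qed

text \<open>
  Induction on the product rule: the power \<open>F\<^sup>n\<close> of a tail integral \<open>F\<close> with density \<open>\<alpha>\<close> is itself one,
  with density \<open>n \<alpha> F\<^bsup>n-1\<^esup>\<close>.
\<close>

lemma tail_integral_power:
  assumes \<alpha>: "integrable \<nu> \<alpha>"
  shows "tail_integral T \<alpha> s ^ Suc n = tail_integral T (\<lambda>u. real (Suc n) * (\<alpha> u * tail_integral T \<alpha> u ^ n)) s"
proof (induction n arbitrary: s)
  case (Suc n)
  have [measurable]: "\<alpha> \<in> borel_measurable borel" using \<alpha> by auto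
  let ?\<beta> = "\<lambda>u. real (Suc n) * (\<alpha> u * tail_integral T \<alpha> u ^ n)"
  have "integrable \<nu> ?\<beta>"
  proof (intro integrable_mult_right integrable_times_bounded[OF \<alpha>])
    show "\<bar>tail_integral T \<alpha> u ^ n\<bar> \<le> (\<integral>u. \<bar>\<alpha> u\<bar> \<partial>\<nu>) ^ n" for u
      unfolding power_abs by (intro power_mono tail_integral_bound \<alpha>) auto
  qed measurable
  have "tail_integral T \<alpha> s ^ Suc (Suc n) = tail_integral T \<alpha> s * tail_integral T ?\<beta> s"
    using Suc by simp
  also have "\<dots> = tail_integral T (\<lambda>u. \<alpha> u * tail_integral T ?\<beta> u + ?\<beta> u * tail_integral T \<alpha> u) s"
    by (rule tail_integral_product[OF \<alpha> \<open>integrable \<nu> ?\<beta>\<close>])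
  also have "\<dots> = tail_integral T (\<lambda>u. real (Suc (Suc n)) * (\<alpha> u * tail_integral T \<alpha> u ^ Suc n)) s"
    unfolding Suc[symmetric] by (intro tail_integral_cong) (simp add: algebra_simps)
  finally show ?case .
qed simp

text \<open>
  Sum the power rule over the exponential series.  Tail integrals are bounded, so \<open>\<bar>\<alpha>\<bar> e\<^sup>C\<close> dominates the
  partial sums.
\<close>

lemma tail_integral_exp:
  assumes \<alpha>: "integrable \<nu> \<alpha>"
  shows "exp (tail_integral T \<alpha> s) = 1 + tail_integral T (\<lambda>u. \<alpha> u * exp (tail_integral T \<alpha> u)) s"
proof -
  have [measurable]: "\<alpha> \<in> borel_measurable borel" using \<alpha> by auto
  let ?F = "tail_integral T \<alpha>"
  let ?e = "\<lambda>n x. \<Sum>k<n. x ^ k / fact k :: real"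
  define C where "C = (\<integral>u. \<bar>\<alpha> u\<bar> \<partial>\<nu>)"
  have e_lim: "(\<lambda>n. ?e n x) \<longlonglongrightarrow> exp x" for x
    using exp_converges[of x] by (simp add: sums_def divide_inverse mult.commute)
  have e_bound: "\<bar>?e n (?F u)\<bar> \<le> exp C" for n u
  proof -
    have "\<bar>?e n (?F u)\<bar> \<le> (\<Sum>k<n. \<bar>?F u ^ k / fact k\<bar>)" by (rule sum_abs)
    also have "\<dots> \<le> (\<Sum>k<n. C ^ k / fact k)"
      using tail_integral_bound[OF \<alpha>, of T u]
      by (intro sum_mono) (auto simp: power_abs C_def intro!: divide_right_mono power_mono)
    also have "\<dots> \<le> exp C"
    proof -
      have "(\<lambda>k. C ^ k / fact k) sums exp C"
        using exp_converges[of C] by (simp add: divide_inverse mult.commute)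
      then show ?thesis
        by (intro sum_le_suminf[THEN order_trans]) (auto simp: sums_iff C_def)
    qed
    finally show ?thesis .
  qed
  have step: "?e (Suc n) (?F s) = 1 + tail_integral T (\<lambda>u. \<alpha> u * ?e n (?F u)) s" for n
  proof (induction n)
    case (Suc n)
    have int: "integrable \<nu> (\<lambda>u. \<alpha> u * ?e n (?F u))"
      by (intro integrable_times_bounded[OF \<alpha> _ e_bound]) measurable
    have int': "integrable \<nu> (\<lambda>u. \<alpha> u * (?F u ^ n))"
    proof (intro integrable_times_bounded[OF \<alpha>])
      show "\<bar>?F u ^ n\<bar> \<le> C ^ n" for u
        unfolding power_abs C_def by (intro power_mono tail_integral_bound \<alpha>) auto
    qed measurable
    have "?e (Suc (Suc n)) (?F s) = 1 + tail_integral T (\<lambda>u. \<alpha> u * ?e n (?F u)) s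
        + ?F s ^ Suc n / fact (Suc n)"
      using Suc by simp
    also have "?F s ^ Suc n / fact (Suc n) = tail_integral T (\<lambda>u. (1 / fact n) * (\<alpha> u * ?F u ^ n)) s"
      unfolding tail_integral_power[OF \<alpha>] tail_integral_mult by (simp add: fact_Suc del: of_nat_Suc)
    also have "1 + tail_integral T (\<lambda>u. \<alpha> u * ?e n (?F u)) s + \<dots> =
        1 + tail_integral T (\<lambda>u. \<alpha> u * ?e n (?F u) + (1 / fact n) * (\<alpha> u * ?F u ^ n)) s"
      using int int' by (subst tail_integral_add) auto
    also have "(\<lambda>u. \<alpha> u * ?e n (?F u) + (1 / fact n) * (\<alpha> u * ?F u ^ n)) = (\<lambda>u. \<alpha> u * ?e (Suc n) (?F u))"
      by (auto simp: algebra_simps)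
    finally show ?case .
  qed (simp add: tail_integral_eq)
  have "(\<lambda>n. tail_integral T (\<lambda>u. \<alpha> u * ?e n (?F u)) s) \<longlonglongrightarrow> tail_integral T (\<lambda>u. \<alpha> u * exp (?F u)) s"
    unfolding tail_integral_eq[of T _ s]
  proof (rule integral_dominated_convergence[where w = "\<lambda>u. \<bar>\<alpha> u\<bar> * exp C"])
    show "AE u in \<nu>. (\<lambda>n. if s < u \<and> u \<le> T then \<alpha> u * ?e n (?F u) else 0)
        \<longlonglongrightarrow> (if s < u \<and> u \<le> T then \<alpha> u * exp (?F u) else 0)"
      by (auto intro!: tendsto_intros e_lim)
    show "AE u in \<nu>. norm (if s < u \<and> u \<le> T then \<alpha> u * ?e n (?F u) else 0) \<le> \<bar>\<alpha> u\<bar> * exp C" for n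
      by (rule AE_I2) (auto simp: abs_mult intro!: mult_left_mono e_bound)
  qed (use \<alpha> in \<open>auto\<close>)
  then have "(\<lambda>n. 1 + tail_integral T (\<lambda>u. \<alpha> u * ?e n (?F u)) s)
      \<longlonglongrightarrow> 1 + tail_integral T (\<lambda>u. \<alpha> u * exp (?F u)) s"
    by (intro tendsto_intros)
  moreover have "(\<lambda>n. ?e (Suc n) (?F s)) \<longlonglongrightarrow> exp (?F s)"
    using LIMSEQ_Suc[OF e_lim[of "?F s"]] .
  then have "(\<lambda>n. 1 + tail_integral T (\<lambda>u. \<alpha> u * ?e n (?F u)) s) \<longlonglongrightarrow> exp (?F s)"
    by (simp only: step)
  ultimately show ?thesis by (rule LIMSEQ_unique[rotated])
qed

text \<open>
  Multiply the equation for \<open>y\<close> by the integrating factor \<open>E = exp (\<integral>\<^sub>s\<^sup>T \<alpha> d\<nu>)\<close>.  In the product rule the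
  terms \<open>\<alpha> E y\<close> cancel.
\<close>

lemma linear_backward_equation:
  assumes \<alpha>: "integrable \<nu> \<alpha>" and g: "integrable \<nu> g" and \<alpha>y: "integrable \<nu> (\<lambda>u. \<alpha> u * y u)"
    and "t \<le> T"
    and eq: "\<And>s. t \<le> s \<Longrightarrow> s \<le> T \<Longrightarrow> y s = \<eta> - tail_integral T (\<lambda>u. \<alpha> u * y u + g u) s"
  shows "exp (tail_integral T \<alpha> t) * y t = \<eta> - tail_integral T (\<lambda>u. exp (tail_integral T \<alpha> u) * g u) t"
proof -
  let ?E = "\<lambda>u. exp (tail_integral T \<alpha> u)"
  let ?\<beta> = "\<lambda>u. \<alpha> u * y u + g u"
  let ?\<delta> = "\<lambda>u. \<alpha> u * ?E u"
  have [measurable]: "\<alpha> \<in> borel_measurable borel" using \<alpha> by auto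
  have E_bound: "\<bar>?E u\<bar> \<le> exp (\<integral>u. \<bar>\<alpha> u\<bar> \<partial>\<nu>)" for u
    using tail_integral_bound[OF \<alpha>, of T u] by simp
  have E_int: "integrable \<nu> (\<lambda>u. h u * ?E u)" if "integrable \<nu> h" for h
    by (rule integrable_times_bounded[OF that _ E_bound]) measurable
  have \<beta>: "integrable \<nu> ?\<beta>" using \<alpha>y g by simp
  have \<delta>: "integrable \<nu> ?\<delta>" by (rule E_int[OF \<alpha>])
  have E: "?E s = 1 + tail_integral T ?\<delta> s" for s by (rule tail_integral_exp[OF \<alpha>])
  have ints: "integrable \<nu> (\<lambda>u. (\<alpha> u * y u) * ?E u)" "integrable \<nu> (\<lambda>u. g u * ?E u)"
    using E_int[OF \<alpha>y] E_int[OF g] by auto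
  have "tail_integral T ?\<delta> t * tail_integral T ?\<beta> t =
      tail_integral T (\<lambda>u. ?\<delta> u * tail_integral T ?\<beta> u + ?\<beta> u * tail_integral T ?\<delta> u) t"
    by (rule tail_integral_product[OF \<delta> \<beta>])
  also have "\<dots> = tail_integral T (\<lambda>u. (\<eta> * ?\<delta> u + g u * ?E u) - ?\<beta> u) t"
  proof (rule tail_integral_cong)
    fix u assume u: "t < u" "u \<le> T"
    have 1: "tail_integral T ?\<beta> u = \<eta> - y u" using eq[of u] u by simp
    have 2: "tail_integral T ?\<delta> u = ?E u - 1" using E[of u] by simp
    show "?\<delta> u * tail_integral T ?\<beta> u + ?\<beta> u * tail_integral T ?\<delta> u = (\<eta> * ?\<delta> u + g u * ?E u) - ?\<beta> u"
      unfolding 1 2 by (simp add: algebra_simps)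
  qed
  also have "\<dots> = \<eta> * tail_integral T ?\<delta> t + tail_integral T (\<lambda>u. g u * ?E u) t - tail_integral T ?\<beta> t"
    using \<delta> \<beta> ints by (simp add: tail_integral_diff tail_integral_add tail_integral_mult)
  finally have "(1 + tail_integral T ?\<delta> t) * (\<eta> - tail_integral T ?\<beta> t) = \<eta> - tail_integral T (\<lambda>u. g u * ?E u) t"
    by (simp add: algebra_simps)
  moreover have "y t = \<eta> - tail_integral T ?\<beta> t" using eq[of t] \<open>t \<le> T\<close> by simp
  moreover have "tail_integral T (\<lambda>u. g u * ?E u) t = tail_integral T (\<lambda>u. ?E u * g u) t"
    by (simp only: mult.commute)
  ultimately show ?thesis unfolding E[of t] by metis
qed

end

section \<open>Uniqueness of the Laplace transform\<close>

lemma power_series_zero_coeff: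
  fixes a :: "nat \<Rightarrow> real"
  assumes sums: "\<And>b. (\<lambda>n. a n * b ^ n) sums 0"
  shows "a n = 0"
proof (induction n rule: less_induct)
  case (less n)
  have "(\<lambda>k. a (k + n) * b ^ k) sums 0" if "b \<noteq> 0" for b
  proof -
    have "(\<lambda>k. a (k + n) * b ^ (k + n)) sums (0 - (\<Sum>k<n. a k * b ^ k))"
      using sums[of b] by (rule sums_split_initial_segment)
    also have "(\<Sum>k<n. a k * b ^ k) = 0" using less by simp
    finally have "(\<lambda>k. a (k + n) * b ^ (k + n) / b ^ n) sums ((0 - 0) / b ^ n)" by (rule sums_divide)
    then show ?thesis using that by (simp add: power_add)
  qed
  moreover define c where "c k = a (k + n)" for k
  ultimately have "((\<lambda>_. 0) \<longlongrightarrow> c 0) (at (0::real))"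
    by (intro powser_limit_0_strong[where s = 1 and a = c and f = "\<lambda>_. 0"]) auto
  then have "c 0 = 0" by (simp add: tendsto_const_iff)
  then show ?case by (simp add: c_def)
qed

lemma integrable_times_indicator_vimage:
  fixes F :: "'a \<Rightarrow> real"
  assumes "integrable M F" "V \<in> measurable M N" "B \<in> sets N"
  shows "integrable M (\<lambda>\<omega>. F \<omega> * indicator B (V \<omega>))"
proof -
  have [measurable]: "F \<in> borel_measurable M" "V \<in> measurable M N" "B \<in> sets N" using assms by auto
  show ?thesis
    by (rule Bochner_Integration.integrable_bound[OF assms(1)]) (auto simp: indicator_def)
qed

context
  fixes M :: "'a measure" and F V :: "'a \<Rightarrow> real"
  assumes V: "V \<in> borel_measurable M"
    and int: "\<And>b. integrable M (\<lambda>\<omega>. F \<omega> * exp (b * V \<omega>))"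
begin

lemma laplace_integrable: "integrable M F" using int[of 0] by simp

lemma integrable_exp_abs:
  assumes "0 \<le> c"
  shows "integrable M (\<lambda>\<omega>. \<bar>F \<omega>\<bar> * exp (c * \<bar>V \<omega>\<bar>))"
proof -
  note [measurable] = V
  have [measurable]: "F \<in> borel_measurable M" using laplace_integrable by simp
  show ?thesis
  proof (rule Bochner_Integration.integrable_bound)
    show "integrable M (\<lambda>\<omega>. \<bar>F \<omega> * exp (c * V \<omega>)\<bar> + \<bar>F \<omega> * exp ((- c) * V \<omega>)\<bar>)"
      using int[of c] int[of "- c"] by (intro Bochner_Integration.integrable_add integrable_abs)
    have "\<bar>F \<omega>\<bar> * exp (c * \<bar>V \<omega>\<bar>) \<le> \<bar>F \<omega>\<bar> * (exp (c * V \<omega>) + exp (- c * V \<omega>))" for \<omega>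
      by (intro mult_left_mono) (auto simp: abs_if)
    then show "AE \<omega> in M. norm (\<bar>F \<omega>\<bar> * exp (c * \<bar>V \<omega>\<bar>)) \<le> norm (\<bar>F \<omega> * exp (c * V \<omega>)\<bar> + \<bar>F \<omega> * exp ((- c) * V \<omega>)\<bar>)"
      by (simp add: abs_mult distrib_left)
  qed measurable
qed

text \<open>
  The moments \<open>E[F V\<^sup>n]\<close> are the coefficients of one entire function that gives the Laplace transform at
  real and the characteristic function at imaginary arguments.
\<close>

lemma exp_transform_power_series:
  "(\<lambda>n. (\<integral>\<omega>. complex_of_real (F \<omega> * V \<omega> ^ n) \<partial>M) / fact n * z ^ n) sums
    (\<integral>\<omega>. complex_of_real (F \<omega>) * exp (z * complex_of_real (V \<omega>)) \<partial>M)"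
proof -
  note [measurable] = V
  have [measurable]: "F \<in> borel_measurable M" using laplace_integrable by simp
  let ?t = "\<lambda>n \<omega>. complex_of_real (F \<omega>) * ((z * V \<omega>) ^ n / fact n)"
  let ?b = "\<lambda>\<omega>. \<bar>F \<omega>\<bar> * exp (norm z * \<bar>V \<omega>\<bar>)"
  have exp_sums: "(\<lambda>n. x ^ n / fact n) sums exp x" for x :: complex
    using exp_converges[of x] by (simp add: scaleR_conv_of_real divide_inverse mult.commute)
  have exp_sums': "(\<lambda>n. x ^ n / fact n) sums exp x" for x :: real
    using exp_converges[of x] by (simp add: divide_inverse mult.commute)
  have part: "(\<Sum>k<n. x ^ k / fact k) \<le> exp x" if "0 \<le> x" for x :: real and n
    using that exp_sums'[of x] by (intro sum_le_suminf[THEN order_trans]) (auto simp: sums_iff)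
  have b: "integrable M ?b" by (rule integrable_exp_abs) simp
  have bound: "norm (\<Sum>k<n. ?t k \<omega>) \<le> ?b \<omega>" for n \<omega>
  proof -
    have "norm (\<Sum>k<n. ?t k \<omega>) \<le> (\<Sum>k<n. norm (?t k \<omega>))" by (rule norm_sum)
    also have "\<dots> = \<bar>F \<omega>\<bar> * (\<Sum>k<n. (norm z * \<bar>V \<omega>\<bar>) ^ k / fact k)"
      by (simp add: norm_mult norm_divide norm_power sum_distrib_left)
    also have "\<dots> \<le> ?b \<omega>" by (intro mult_left_mono part) auto
    finally show ?thesis .
  qed
  have t: "integrable M (?t n)" for n
  proof (rule Bochner_Integration.integrable_bound[OF b])
    have "norm (?t n \<omega>) \<le> ?b \<omega>" for \<omega>
    proof -
      have "norm (?t n \<omega>) = \<bar>F \<omega>\<bar> * ((norm z * \<bar>V \<omega>\<bar>) ^ n / fact n)"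
        by (simp add: norm_mult norm_divide norm_power)
      also have "(norm z * \<bar>V \<omega>\<bar>) ^ n / fact n \<le> (\<Sum>k<Suc n. (norm z * \<bar>V \<omega>\<bar>) ^ k / fact k)"
        by (simp add: sum_nonneg)
      also have "\<dots> \<le> exp (norm z * \<bar>V \<omega>\<bar>)" by (rule part) simp
      finally show ?thesis by (simp add: mult_left_mono)
    qed
    then show "AE \<omega> in M. norm (?t n \<omega>) \<le> norm (?b \<omega>)" by simp
  qed measurable
  have "(\<lambda>n. \<integral>\<omega>. (\<Sum>k<n. ?t k \<omega>) \<partial>M) \<longlonglongrightarrow> (\<integral>\<omega>. complex_of_real (F \<omega>) * exp (z * V \<omega>) \<partial>M)"
  proof (rule integral_dominated_convergence[OF _ _ b])
    show "AE \<omega> in M. (\<lambda>n. \<Sum>k<n. ?t k \<omega>) \<longlonglongrightarrow> complex_of_real (F \<omega>) * exp (z * V \<omega>)"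
      using exp_sums by (intro AE_I2) (simp only: sums_def[symmetric] sums_mult)
    show "AE \<omega> in M. norm (\<Sum>k<n. ?t k \<omega>) \<le> ?b \<omega>" for n using bound by simp
  qed measurable
  then have "(\<lambda>n. \<integral>\<omega>. ?t n \<omega> \<partial>M) sums (\<integral>\<omega>. complex_of_real (F \<omega>) * exp (z * V \<omega>) \<partial>M)"
    unfolding sums_def using t by (simp only: Bochner_Integration.integral_sum)
  moreover have "(\<integral>\<omega>. ?t n \<omega> \<partial>M) = (\<integral>\<omega>. complex_of_real (F \<omega> * V \<omega> ^ n) \<partial>M) / fact n * z ^ n" for n
  proof -
    have "(\<integral>\<omega>. ?t n \<omega> \<partial>M) = (\<integral>\<omega>. complex_of_real (F \<omega> * V \<omega> ^ n) * (z ^ n / fact n) \<partial>M)"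
      by (intro Bochner_Integration.integral_cong) (auto simp: power_mult_distrib)
    then show ?thesis by simp
  qed
  ultimately show ?thesis by simp
qed

text \<open>
  A vanishing Laplace transform makes all moments \<open>E[F V\<^sup>n]\<close> vanish and with them the characteristic
  function of the signed law of \<open>V\<close> under \<open>F\<close>.  Normalised, the images under \<open>V\<close> of the positive and the
  negative part of \<open>F\<close> are probability laws with the same characteristic function, so Levy's
  uniqueness theorem applies.
\<close>

lemma laplace_uniqueness:
  assumes zero: "\<And>b. (\<integral>\<omega>. F \<omega> * exp (b * V \<omega>) \<partial>M) = 0" and B: "B \<in> sets borel"
  shows "(\<integral>\<omega>. F \<omega> * indicator B (V \<omega>) \<partial>M) = 0"
proof -
  note [measurable] = V
  let ?m = "\<lambda>n. \<integral>\<omega>. F \<omega> * V \<omega> ^ n \<partial>M"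
  have "(\<lambda>n. ?m n / fact n * b ^ n) sums 0" for b
  proof -
    have "(\<integral>\<omega>. complex_of_real (F \<omega>) * exp (of_real b * complex_of_real (V \<omega>)) \<partial>M) =
        (\<integral>\<omega>. complex_of_real (F \<omega> * exp (b * V \<omega>)) \<partial>M)"
      by (intro Bochner_Integration.integral_cong) (auto simp flip: exp_of_real)
    also have "\<dots> = 0" unfolding integral_complex_of_real zero by simp
    finally have "(\<lambda>n. complex_of_real (?m n / fact n * b ^ n)) sums complex_of_real 0"
      using exp_transform_power_series[of "of_real b"] unfolding of_real_mult of_real_power of_real_divide
      by (simp add: integral_complex_of_real flip: of_real_mult of_real_power)
    then show ?thesis by (simp only: sums_of_real_iff)
  qed
  from power_series_zero_coeff[OF this] have m: "?m n = 0" for n by simp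
  have char0: "(\<integral>\<omega>. complex_of_real (F \<omega>) * iexp (b * V \<omega>) \<partial>M) = 0" for b
  proof -
    have "(\<lambda>n. 0) sums (\<integral>\<omega>. complex_of_real (F \<omega>) * exp (\<i> * of_real b * complex_of_real (V \<omega>)) \<partial>M)"
      using exp_transform_power_series[of "\<i> * of_real b"] m by (simp add: integral_complex_of_real del: of_real_mult)
    then have "(\<integral>\<omega>. complex_of_real (F \<omega>) * exp (\<i> * of_real b * complex_of_real (V \<omega>)) \<partial>M) = 0"
      by (simp add: sums_iff)
    then show ?thesis by (simp add: mult.assoc)
  qed
  define P where "P \<omega> = max 0 (F \<omega>)" for \<omega>
  define N where "N \<omega> = max 0 (- F \<omega>)" for \<omega>
  have P: "integrable M P" and N: "integrable M N"
    unfolding P_def N_def using laplace_integrable by (auto intro!: integrable_max)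
  have [measurable]: "P \<in> borel_measurable M" "N \<in> borel_measurable M" using P N by auto
  have F_eq: "F \<omega> = P \<omega> - N \<omega>" for \<omega> by (simp add: P_def N_def max_def)
  have nonneg: "0 \<le> P \<omega>" "0 \<le> N \<omega>" for \<omega> by (auto simp: P_def N_def)
  define K where "K = (\<integral>\<omega>. P \<omega> \<partial>M)"
  have "(\<integral>\<omega>. F \<omega> \<partial>M) = 0" using zero[of 0] by simp
  then have KN: "K = (\<integral>\<omega>. N \<omega> \<partial>M)" unfolding K_def F_eq using P N by simp
  have "0 \<le> K" unfolding K_def using nonneg by simp
  show ?thesis
  proof (cases "K = 0")
    case True
    then have "AE \<omega> in M. P \<omega> = 0" "AE \<omega> in M. N \<omega> = 0"
      using integral_nonneg_eq_0_iff_AE[OF P] integral_nonneg_eq_0_iff_AE[OF N] nonneg K_def KN by auto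
    then have "AE \<omega> in M. F \<omega> * indicator B (V \<omega>) = 0"
      by eventually_elim (simp add: F_eq)
    then show ?thesis by (rule integral_eq_zero_AE)
  next
    case False
    with \<open>0 \<le> K\<close> have "0 < K" by simp
    let ?D = "\<lambda>Q. distr (density M (\<lambda>\<omega>. ennreal (Q \<omega> / K))) borel V"
    have dist: "real_distribution (?D Q)"
      and char: "char (?D Q) b = (\<integral>\<omega>. complex_of_real (Q \<omega>) * iexp (b * V \<omega>) \<partial>M) / K"
      and meas: "measure (?D Q) B = (\<integral>\<omega>. Q \<omega> * indicator B (V \<omega>) \<partial>M) / K"
      if Q: "integrable M Q" "\<And>\<omega>. 0 \<le> Q \<omega>" "(\<integral>\<omega>. Q \<omega> \<partial>M) = K" for Q :: "'a \<Rightarrow> real" and b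
    proof -
      have [measurable]: "Q \<in> borel_measurable M" using Q by simp
      have "prob_space (density M (\<lambda>\<omega>. ennreal (Q \<omega> / K)))"
      proof (rule prob_spaceI)
        have "(\<integral>\<^sup>+\<omega>. ennreal (Q \<omega> / K) \<partial>M) = ennreal (\<integral>\<omega>. Q \<omega> / K \<partial>M)"
          using Q \<open>0 < K\<close> by (intro nn_integral_eq_integral) auto
        also have "\<dots> = 1" using Q \<open>0 < K\<close> by simp
        finally have one: "(\<integral>\<^sup>+\<omega>. ennreal (Q \<omega> / K) \<partial>M) = 1" .
        have "(\<integral>\<^sup>+\<omega>. ennreal (Q \<omega> / K) * indicator (space M) \<omega> \<partial>M) = (\<integral>\<^sup>+\<omega>. ennreal (Q \<omega> / K) \<partial>M)"
          by (intro nn_integral_cong) auto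
        with one show "emeasure (density M (\<lambda>\<omega>. ennreal (Q \<omega> / K))) (space (density M (\<lambda>\<omega>. ennreal (Q \<omega> / K)))) = 1"
          by (simp add: emeasure_density)
      qed
      then interpret d: prob_space "density M (\<lambda>\<omega>. ennreal (Q \<omega> / K))" .
      show "real_distribution (?D Q)"
        by (rule d.real_distribution_distr) simp
      then interpret D: real_distribution "?D Q" .
      show "char (?D Q) b = (\<integral>\<omega>. complex_of_real (Q \<omega>) * iexp (b * V \<omega>) \<partial>M) / K"
      proof -
        have "char (?D Q) b = (\<integral>\<omega>. iexp (b * V \<omega>) \<partial>density M (\<lambda>\<omega>. ennreal (Q \<omega> / K)))"
          unfolding char_def by (subst integral_distr) auto
        also have "\<dots> = (\<integral>\<omega>. (Q \<omega> / K) *\<^sub>R iexp (b * V \<omega>) \<partial>M)"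
          using Q \<open>0 < K\<close> by (subst integral_density) auto
        also have "\<dots> = (\<integral>\<omega>. complex_of_real (Q \<omega>) * iexp (b * V \<omega>) / K \<partial>M)"
          by (intro Bochner_Integration.integral_cong) (auto simp: scaleR_conv_of_real)
        finally show ?thesis by simp
      qed
      have "measure (?D Q) B = (\<integral>x. indicator B x \<partial>?D Q)" using B by simp
      also have "\<dots> = (\<integral>\<omega>. indicator B (V \<omega>) \<partial>density M (\<lambda>\<omega>. ennreal (Q \<omega> / K)))"
        using B by (subst integral_distr) auto
      also have "\<dots> = (\<integral>\<omega>. (Q \<omega> / K) *\<^sub>R indicator B (V \<omega>) \<partial>M)"
        using Q \<open>0 < K\<close> B by (subst integral_density) auto
      finally show "measure (?D Q) B = (\<integral>\<omega>. Q \<omega> * indicator B (V \<omega>) \<partial>M) / K" by simp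
    qed
    note hP = P nonneg(1) K_def[symmetric] and hN = N nonneg(2) KN[symmetric]
    have ci: "integrable M (\<lambda>\<omega>. complex_of_real (Q \<omega>) * iexp (b * V \<omega>))" if "integrable M Q" for Q b
    proof -
      have [measurable]: "Q \<in> borel_measurable M" using that by simp
      show ?thesis
        by (rule Bochner_Integration.integrable_bound[OF that]) (auto simp: norm_mult)
    qed
    have "char (?D P) = char (?D N)"
    proof
      fix b
      have "(\<integral>\<omega>. complex_of_real (P \<omega>) * iexp (b * V \<omega>) \<partial>M) - (\<integral>\<omega>. complex_of_real (N \<omega>) * iexp (b * V \<omega>) \<partial>M) =
          (\<integral>\<omega>. complex_of_real (F \<omega>) * iexp (b * V \<omega>) \<partial>M)"
        unfolding Bochner_Integration.integral_diff[OF ci[OF P] ci[OF N], symmetric]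
        by (intro Bochner_Integration.integral_cong) (auto simp: F_eq algebra_simps)
      then show "char (?D P) b = char (?D N) b"
        using char[OF hP, of b] char[OF hN, of b] char0 by simp
    qed
    then have "?D P = ?D N" by (intro Levy_uniqueness dist hP hN)
    then have "(\<integral>\<omega>. P \<omega> * indicator B (V \<omega>) \<partial>M) = (\<integral>\<omega>. N \<omega> * indicator B (V \<omega>) \<partial>M)"
      using meas[OF hP] meas[OF hN] \<open>0 < K\<close> by simp
    moreover have "(\<integral>\<omega>. F \<omega> * indicator B (V \<omega>) \<partial>M) =
        (\<integral>\<omega>. P \<omega> * indicator B (V \<omega>) - N \<omega> * indicator B (V \<omega>) \<partial>M)"
      by (intro Bochner_Integration.integral_cong) (auto simp: F_eq algebra_simps)
    ultimately show ?thesis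
      using integrable_times_indicator_vimage[OF P V B] integrable_times_indicator_vimage[OF N V B] by simp
  qed
qed

end

text \<open>
  The coordinates are treated one at a time: with the other coefficients fixed, the remaining
  exponentials are absorbed into \<open>F\<close>, and the one-dimensional theorem replaces the exponential of one
  coordinate by an indicator.
\<close>

lemma laplace_uniqueness_finite:
  fixes F :: "'a \<Rightarrow> real" and V :: "'i \<Rightarrow> 'a \<Rightarrow> real"
  assumes "finite J" and "\<And>j. j \<in> J \<Longrightarrow> V j \<in> borel_measurable M"
    and "\<And>b. integrable M (\<lambda>\<omega>. F \<omega> * exp (\<Sum>j\<in>J. b j * V j \<omega>))"
    and "\<And>b. (\<integral>\<omega>. F \<omega> * exp (\<Sum>j\<in>J. b j * V j \<omega>) \<partial>M) = 0"
    and B: "\<And>j. j \<in> J \<Longrightarrow> B j \<in> sets borel"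
  shows "(\<integral>\<omega>. F \<omega> * (\<Prod>j\<in>J. indicator (B j) (V j \<omega>)) \<partial>M) = 0"
  using assms
proof (induction J arbitrary: F rule: finite_induct)
  case empty
  show ?case using empty.prems(3)[of "\<lambda>_. 0"] by simp
next
  case (insert i J)
  have sum_eq: "(\<Sum>j\<in>insert i J. (b(i := x)) j * V j \<omega>) = x * V i \<omega> + (\<Sum>j\<in>J. b j * V j \<omega>)" for b x \<omega>
  proof -
    have "(\<Sum>j\<in>J. (b(i := x)) j * V j \<omega>) = (\<Sum>j\<in>J. b j * V j \<omega>)"
      using insert.hyps by (intro sum.cong) auto
    then show ?thesis using insert.hyps by simp
  qed
  have Vi: "V i \<in> borel_measurable M" and Bi: "B i \<in> sets borel"
    using insert.prems(1,4)[of i] by auto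
  have eq: "F \<omega> * exp (\<Sum>j\<in>J. b j * V j \<omega>) * exp (x * V i \<omega>) = F \<omega> * exp (\<Sum>j\<in>insert i J. (b(i := x)) j * V j \<omega>)" for b x \<omega>
    unfolding sum_eq by (simp add: exp_add mult_ac)
  have int: "integrable M (\<lambda>\<omega>. F \<omega> * exp (\<Sum>j\<in>J. b j * V j \<omega>) * exp (x * V i \<omega>))"
    and zero: "(\<integral>\<omega>. F \<omega> * exp (\<Sum>j\<in>J. b j * V j \<omega>) * exp (x * V i \<omega>) \<partial>M) = 0" for b x
    unfolding eq by (rule insert.prems)+
  have "(\<integral>\<omega>. F \<omega> * indicator (B i) (V i \<omega>) * (\<Prod>j\<in>J. indicator (B j) (V j \<omega>)) \<partial>M) = 0"
  proof (rule insert.IH)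
    fix b
    have "integrable M (\<lambda>\<omega>. F \<omega> * exp (\<Sum>j\<in>J. b j * V j \<omega>))" using int[of b 0] by simp
    from integrable_times_indicator_vimage[OF this Vi Bi]
    show "integrable M (\<lambda>\<omega>. F \<omega> * indicator (B i) (V i \<omega>) * exp (\<Sum>j\<in>J. b j * V j \<omega>))"
      by (simp add: mult_ac)
    show "(\<integral>\<omega>. F \<omega> * indicator (B i) (V i \<omega>) * exp (\<Sum>j\<in>J. b j * V j \<omega>) \<partial>M) = 0"
      using laplace_uniqueness[OF Vi int zero Bi, of b] by (simp add: mult_ac)
  qed (use insert.prems(1,4) in auto)
  then show ?case using insert.hyps by (simp add: mult_ac)
qed

section \<open>Square integrable functions and Gaussian exponentials\<close>

definition L2 :: "'a measure \<Rightarrow> ('a \<Rightarrow> real) set" where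
  "L2 M = {f. f \<in> borel_measurable M \<and> integrable M (\<lambda>\<omega>. (f \<omega>)\<^sup>2)}"

lemma L2D [dest]: "f \<in> L2 M \<Longrightarrow> f \<in> borel_measurable M" "f \<in> L2 M \<Longrightarrow> integrable M (\<lambda>\<omega>. (f \<omega>)\<^sup>2)"
  by (simp_all add: L2_def)

lemma L2_mult_integrable:
  assumes "f \<in> L2 M" "g \<in> L2 M"
  shows "integrable M (\<lambda>\<omega>. f \<omega> * g \<omega>)"
proof (rule Bochner_Integration.integrable_bound)
  have [measurable]: "f \<in> borel_measurable M" "g \<in> borel_measurable M" using assms by auto
  show "integrable M (\<lambda>\<omega>. (f \<omega>)\<^sup>2 + (g \<omega>)\<^sup>2)" using assms by (simp add: L2D)
  have "\<bar>x * y\<bar> \<le> x\<^sup>2 + y\<^sup>2" for x y :: real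
    using sum_squares_bound[of "\<bar>x\<bar>" "\<bar>y\<bar>"] abs_ge_zero[of "x * y"]
    unfolding abs_mult power2_abs by linarith
  then show "AE \<omega> in M. norm (f \<omega> * g \<omega>) \<le> norm ((f \<omega>)\<^sup>2 + (g \<omega>)\<^sup>2)" by simp
  show "(\<lambda>\<omega>. f \<omega> * g \<omega>) \<in> borel_measurable M" by measurable
qed

lemma L2_add:
  assumes f: "f \<in> L2 M" and g: "g \<in> L2 M"
  shows "(\<lambda>\<omega>. f \<omega> + g \<omega>) \<in> L2 M"
proof -
  note [measurable] = L2D(1)[OF f] L2D(1)[OF g]
  have "integrable M (\<lambda>\<omega>. (f \<omega>)\<^sup>2 + (g \<omega>)\<^sup>2 + 2 * (f \<omega> * g \<omega>))"
    by (intro Bochner_Integration.integrable_add integrable_mult_right L2_mult_integrable L2D f g)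
  then show ?thesis by (simp add: L2_def power2_sum mult.assoc)
qed

lemma L2_scale:
  assumes f: "f \<in> L2 M"
  shows "(\<lambda>\<omega>. c * f \<omega>) \<in> L2 M"
proof -
  note [measurable] = L2D(1)[OF f]
  show ?thesis using L2D(2)[OF f] by (simp add: L2_def power_mult_distrib)
qed

lemma L2_diff: "f \<in> L2 M \<Longrightarrow> g \<in> L2 M \<Longrightarrow> (\<lambda>\<omega>. f \<omega> - g \<omega>) \<in> L2 M"
  using L2_add[of f M "\<lambda>\<omega>. (-1) * g \<omega>"] L2_scale[of g M "-1"] by simp

lemma L2_cong_AE:
  assumes "f \<in> L2 M" "g \<in> borel_measurable M" "AE \<omega> in M. f \<omega> = g \<omega>"
  shows "g \<in> L2 M"
proof -
  have [measurable]: "f \<in> borel_measurable M" "g \<in> borel_measurable M" using assms by auto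
  have "integrable M (\<lambda>\<omega>. (f \<omega>)\<^sup>2) \<longleftrightarrow> integrable M (\<lambda>\<omega>. (g \<omega>)\<^sup>2)"
    using assms(3) by (intro integrable_cong_AE) auto
  then show ?thesis using assms by (simp add: L2_def)
qed

lemma L2_Cauchy_Schwarz:
  assumes f: "f \<in> L2 M" and g: "g \<in> L2 M"
  shows "(\<integral>\<omega>. f \<omega> * g \<omega> \<partial>M)\<^sup>2 \<le> (\<integral>\<omega>. (f \<omega>)\<^sup>2 \<partial>M) * (\<integral>\<omega>. (g \<omega>)\<^sup>2 \<partial>M)"
proof -
  let ?a = "\<integral>\<omega>. (f \<omega>)\<^sup>2 \<partial>M" and ?b = "\<integral>\<omega>. f \<omega> * g \<omega> \<partial>M" and ?c = "\<integral>\<omega>. (g \<omega>)\<^sup>2 \<partial>M"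
  have quad: "0 \<le> ?a * x\<^sup>2 + 2 * ?b * x * y + ?c * y\<^sup>2" for x y
  proof -
    have "0 \<le> (\<integral>\<omega>. (x * f \<omega> + y * g \<omega>)\<^sup>2 \<partial>M)" by simp
    also have "\<dots> = (\<integral>\<omega>. x\<^sup>2 * (f \<omega>)\<^sup>2 + (2 * x * y) * (f \<omega> * g \<omega>) + y\<^sup>2 * (g \<omega>)\<^sup>2 \<partial>M)"
      by (intro Bochner_Integration.integral_cong) (auto simp: power2_sum power_mult_distrib)
    also have "\<dots> = x\<^sup>2 * ?a + (2 * x * y) * ?b + y\<^sup>2 * ?c"
      using f g L2_mult_integrable[OF f g] by (simp add: L2D)
    finally show ?thesis by (simp add: mult_ac)
  qed
  show ?thesis
  proof (cases "?a = 0")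
    case True
    have "?b = 0"
    proof (rule ccontr)
      assume "?b \<noteq> 0"
      \<comment> \<open>at this point the linear function takes the value \<open>-1\<close>\<close>
      have "0 \<le> 2 * ?b * (- (?c + 1) / (2 * ?b)) + ?c"
        using quad[of "- (?c + 1) / (2 * ?b)" 1] True by simp
      then show False using \<open>?b \<noteq> 0\<close> by simp
    qed
    then show ?thesis by simp
  next
    case False
    moreover have "0 \<le> ?a" by simp
    ultimately have "0 < ?a" by linarith
    have "0 \<le> ?a * (- ?b)\<^sup>2 + 2 * ?b * (- ?b) * ?a + ?c * ?a\<^sup>2" by (rule quad)
    also have "\<dots> = ?a * (?a * ?c - ?b\<^sup>2)" by (simp add: power2_eq_square algebra_simps)
    finally show ?thesis using \<open>0 < ?a\<close> by (simp add: zero_le_mult_iff)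
  qed
qed

lemma (in finite_measure) L2_integrable: "f \<in> L2 M \<Longrightarrow> integrable M f"
  using L2_mult_integrable[of f M "\<lambda>_. 1"] by (simp add: L2_def)

lemma borel_measurable_AE_cong_complete:
  assumes "complete_measure M" "space F = space M" "null_sets M \<subseteq> sets F"
    and f: "f \<in> borel_measurable F" and eq: "AE \<omega> in M. f \<omega> = g \<omega>"
  shows "g \<in> borel_measurable F"
proof (rule measurableI)
  interpret complete_measure M by fact
  fix B :: "'b set" assume B: "B \<in> sets borel"
  obtain N where N: "N \<in> null_sets M" "{\<omega> \<in> space M. f \<omega> \<noteq> g \<omega>} \<subseteq> N"
    using eq by (elim AE_E) (auto simp: null_sets_def)
  have "g -` B \<inter> space F = (f -` B \<inter> space F - N) \<union> (g -` B \<inter> space F \<inter> N)"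
    using N(2) assms(2) by auto
  moreover have "f -` B \<inter> space F \<in> sets F" using measurable_sets[OF f B] .
  moreover have "g -` B \<inter> space F \<inter> N \<in> null_sets M"
    using N(1) complete2[of "g -` B \<inter> space F \<inter> N" N] by auto
  moreover have "N \<in> sets F" using N(1) assms(3) by blast
  ultimately show "g -` B \<inter> space F \<in> sets F"
    using assms(3) by (metis sets.Diff sets.Un subsetD)
qed simp

text \<open>
  Completing the square: an exponential weight shifts the mean of a centred normal law by its variance.
\<close>

lemma normal_density_mult_exp:
  "\<sigma> \<noteq> 0 \<Longrightarrow> normal_density 0 \<sigma> x * exp x = exp (\<sigma>\<^sup>2 / 2) * normal_density (\<sigma>\<^sup>2) \<sigma> x"
proof -
  assume "\<sigma> \<noteq> 0"
  then have "- x\<^sup>2 / (2 * \<sigma>\<^sup>2) + x = \<sigma>\<^sup>2 / 2 + - (x - \<sigma>\<^sup>2)\<^sup>2 / (2 * \<sigma>\<^sup>2)"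
    by (simp add: field_simps power2_eq_square)
  then have "exp (- x\<^sup>2 / (2 * \<sigma>\<^sup>2)) * exp x = exp (\<sigma>\<^sup>2 / 2) * exp (- (x - \<sigma>\<^sup>2)\<^sup>2 / (2 * \<sigma>\<^sup>2))"
    by (simp only: exp_add[symmetric])
  then show ?thesis by (simp add: normal_density_def)
qed

lemma (in prob_space) centered_gaussian_exp:
  assumes V: "centered_gaussian_rv M V"
  shows "integrable M (\<lambda>\<omega>. (V \<omega>)\<^sup>2)" and "integrable M (\<lambda>\<omega>. exp (V \<omega>))"
    and "(\<integral>\<omega>. exp (V \<omega>) \<partial>M) = exp ((\<integral>\<omega>. (V \<omega>)\<^sup>2 \<partial>M) / 2)"
proof -
  have [measurable]: "V \<in> borel_measurable M" using V by (simp add: centered_gaussian_rv_def)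
  have "integrable M (\<lambda>\<omega>. (V \<omega>)\<^sup>2) \<and> integrable M (\<lambda>\<omega>. exp (V \<omega>)) \<and>
    (\<integral>\<omega>. exp (V \<omega>) \<partial>M) = exp ((\<integral>\<omega>. (V \<omega>)\<^sup>2 \<partial>M) / 2)"
  proof (cases "AE \<omega> in M. V \<omega> = 0")
    case True
    have "integrable M (\<lambda>\<omega>. (V \<omega>)\<^sup>2) \<longleftrightarrow> integrable M (\<lambda>\<omega>. 0::real)"
      using True by (intro integrable_cong_AE) auto
    moreover have "integrable M (\<lambda>\<omega>. exp (V \<omega>)) \<longleftrightarrow> integrable M (\<lambda>\<omega>. 1::real)"
      using True by (intro integrable_cong_AE) auto
    moreover have "(\<integral>\<omega>. (V \<omega>)\<^sup>2 \<partial>M) = (\<integral>\<omega>. 0 \<partial>M)"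
      using True by (intro integral_cong_AE) auto
    moreover have "(\<integral>\<omega>. exp (V \<omega>) \<partial>M) = (\<integral>\<omega>. 1 \<partial>M)"
      using True by (intro integral_cong_AE) auto
    ultimately show ?thesis by (simp add: prob_space)
  next
    case False
    then obtain \<sigma> where \<sigma>: "0 < \<sigma>" "distributed M lborel V (\<lambda>x. ennreal (normal_density 0 \<sigma> x))"
      using V by (auto simp: centered_gaussian_rv_def)
    have int2: "integrable M (\<lambda>\<omega>. (V \<omega>)\<^sup>2)"
      using distributed_integrable[OF \<sigma>(2), of "\<lambda>x. x\<^sup>2"] integrable_normal_moment[OF \<sigma>(1), of 0 2] by simp
    have var: "(\<integral>\<omega>. (V \<omega>)\<^sup>2 \<partial>M) = \<sigma>\<^sup>2"
      using distributed_integral[OF \<sigma>(2), of "\<lambda>x. x\<^sup>2"] integral_normal_moment_even[OF \<sigma>(1), of 0 1]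
      by (simp add: fact_numeral)
    have ints: "integrable lborel (\<lambda>x. normal_density 0 \<sigma> x * exp x)"
      using \<sigma>(1) by (simp add: normal_density_mult_exp)
    have "integrable M (\<lambda>\<omega>. exp (V \<omega>))"
      using distributed_integrable[OF \<sigma>(2), of exp] ints by simp
    moreover have "(\<integral>\<omega>. exp (V \<omega>) \<partial>M) = exp (\<sigma>\<^sup>2 / 2)"
      using distributed_integral[OF \<sigma>(2), of exp] \<sigma>(1) by (simp add: normal_density_mult_exp)
    ultimately show ?thesis using int2 var by simp
  qed
  then show "integrable M (\<lambda>\<omega>. (V \<omega>)\<^sup>2)" and "integrable M (\<lambda>\<omega>. exp (V \<omega>))"
    and "(\<integral>\<omega>. exp (V \<omega>) \<partial>M) = exp ((\<integral>\<omega>. (V \<omega>)\<^sup>2 \<partial>M) / 2)" by auto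
qed

section \<open>The filtration of a Gaussian process\<close>

lemma measurable_process_section:
  assumes "measurable_process M T V" "t \<in> {0..T}"
  shows "V t \<in> borel_measurable M"
proof -
  have "(\<lambda>\<omega>. (t, \<omega>)) \<in> measurable M (restrict_space borel {0..T} \<Otimes>\<^sub>M M)"
    using assms(2) by (intro measurable_Pair1') (auto simp: space_restrict_space)
  from measurable_compose[OF this assms(1)[unfolded measurable_process_def]] show ?thesis by simp
qed

locale gaussian_process =
  fixes M :: "'w measure" and T :: real and X :: "real \<Rightarrow> 'w \<Rightarrow> real"
  assumes gaussian: "gaussian_setting M T X"
begin

lemma T_pos: "0 < T" using gaussian by (simp add: gaussian_setting_def)

lemma complete: "complete_measure M" using gaussian by (simp add: gaussian_setting_def)

sublocale prob_space M using gaussian by (simp add: gaussian_setting_def)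

lemma X_measurable: "t \<in> {0..T} \<Longrightarrow> X t \<in> borel_measurable M"
  using gaussian by (intro measurable_process_section[of M T X]) (auto simp: gaussian_setting_def)

lemma filtr_generator: "{X s -` B \<inter> space M | s B. s \<in> {0..t} \<and> B \<in> sets borel} \<union> null_sets M \<subseteq> Pow (space M)"
  using sets.sets_into_space by (fastforce simp: null_sets_def)

lemma space_filtr [simp]: "space (filtr M X t) = space M"
  unfolding filtr_def using filtr_generator by (rule space_measure_of)

lemma sets_filtr: "sets (filtr M X t) =
    sigma_sets (space M) ({X s -` B \<inter> space M | s B. s \<in> {0..t} \<and> B \<in> sets borel} \<union> null_sets M)"
  unfolding filtr_def using filtr_generator by (rule sets_measure_of)

lemma null_sets_filtr: "null_sets M \<subseteq> sets (filtr M X t)"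
  unfolding sets_filtr by (auto intro: sigma_sets.Basic)

lemma sets_filtr_mono: "s \<le> t \<Longrightarrow> sets (filtr M X s) \<subseteq> sets (filtr M X t)"
  unfolding sets_filtr by (intro sigma_sets_mono' Un_mono) force+

lemma sets_filtr_subset: "t \<le> T \<Longrightarrow> sets (filtr M X t) \<subseteq> sets M"
  unfolding sets_filtr using X_measurable
  by (intro sets.sigma_sets_subset) (auto simp: null_sets_def intro!: measurable_sets)

lemma subalgebra_filtr: "t \<le> T \<Longrightarrow> subalgebra M (filtr M X t)"
  using sets_filtr_subset by (simp add: subalgebra_def)

lemma filtr_measurable_mono:
  "s \<le> t \<Longrightarrow> f \<in> borel_measurable (filtr M X s) \<Longrightarrow> f \<in> borel_measurable (filtr M X t)"
  using sets_filtr_mono[of s t] by (auto simp: measurable_def)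

lemma filtr_measurable: "t \<le> T \<Longrightarrow> f \<in> borel_measurable (filtr M X t) \<Longrightarrow> f \<in> borel_measurable M"
  using subalgebra_filtr[of t] by (rule measurable_from_subalg)

lemma filtr_measurable_AE_cong:
  assumes "f \<in> borel_measurable (filtr M X t)" "AE \<omega> in M. f \<omega> = g \<omega>"
  shows "g \<in> borel_measurable (filtr M X t)"
  by (rule borel_measurable_AE_cong_complete[OF complete space_filtr null_sets_filtr assms])

lemma L2X_iff: "\<xi> \<in> L2X M T X \<longleftrightarrow> \<xi> \<in> borel_measurable (filtr M X T) \<and> \<xi> \<in> L2 M"
  unfolding L2X_def L2_def using filtr_measurable[OF order_refl] by blast

lemma L2XD: "\<xi> \<in> L2X M T X \<Longrightarrow> \<xi> \<in> L2 M" by (simp add: L2X_iff)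

text \<open>
  Testing against exponentials of the values of the process up to time \<open>r\<close> determines the
  conditional expectation given \<open>filtr M X r\<close>: uniqueness of the Laplace transform passes from
  exponentials to finite-dimensional cylinders, and these generate the filtration up to null sets.
\<close>

lemma exponentials_determine_cond_exp:
  assumes F: "integrable M F" and r: "r \<le> T"
    and int: "\<And>J b. finite J \<Longrightarrow> J \<subseteq> {0..r} \<Longrightarrow> integrable M (\<lambda>\<omega>. F \<omega> * exp (\<Sum>t\<in>J. b t * X t \<omega>))"
    and zero: "\<And>J b. finite J \<Longrightarrow> J \<subseteq> {0..r} \<Longrightarrow> (\<integral>\<omega>. F \<omega> * exp (\<Sum>t\<in>J. b t * X t \<omega>) \<partial>M) = 0"
    and \<eta>: "\<eta> \<in> borel_measurable (filtr M X r)" "integrable M (\<lambda>\<omega>. \<eta> \<omega> * F \<omega>)"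
  shows "(\<integral>\<omega>. \<eta> \<omega> * F \<omega> \<partial>M) = 0"
proof -
  define cyl where "cyl J B = space M \<inter> (\<Inter>t\<in>J. X t -` B t \<inter> space M)" for J and B :: "real \<Rightarrow> real set"
  define \<C> where "\<C> = {cyl J B | J B. finite J \<and> J \<subseteq> {0..r} \<and> (\<forall>t\<in>J. B t \<in> sets borel)}"
  have cylE: thesis
    if "A \<in> \<C>" "\<And>J B. A = cyl J B \<Longrightarrow> finite J \<Longrightarrow> J \<subseteq> {0..r} \<Longrightarrow> (\<And>t. t \<in> J \<Longrightarrow> B t \<in> sets borel) \<Longrightarrow> thesis"
    for A thesis using that unfolding \<C>_def by blast
  have cylI: "cyl J B \<in> \<C>" if "finite J" "J \<subseteq> {0..r}" "\<And>t. t \<in> J \<Longrightarrow> B t \<in> sets borel" for J B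
    using that unfolding \<C>_def by blast
  have FM [measurable]: "F \<in> borel_measurable M" using F by simp
  have cyl_sets: "A \<in> sets M" if "A \<in> \<C>" for A
    using that
  proof (rule cylE)
    fix J B assume A: "A = cyl J B" "finite J" "J \<subseteq> {0..r}" "\<And>t. t \<in> J \<Longrightarrow> B t \<in> sets borel"
    have "X t -` B t \<inter> space M \<in> sets M" if "t \<in> J" for t
      using A(3,4) that r by (intro measurable_sets[OF X_measurable]) auto
    then have "(\<Inter>t\<in>J. X t -` B t \<inter> space M) \<in> sets M" if "J \<noteq> {}"
      using A(2) that by (intro sets.finite_INT) auto
    then show "A \<in> sets M"
      unfolding A(1) cyl_def by (cases "J = {}") (auto simp del: INT_simps)
  qed
  have gen_sets: "\<C> \<union> null_sets M \<subseteq> sets M"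
    using cyl_sets null_setsD2 by blast
  have stable: "Int_stable (\<C> \<union> null_sets M)"
  proof (rule Int_stableI)
    fix a b assume ab: "a \<in> \<C> \<union> null_sets M" "b \<in> \<C> \<union> null_sets M"
    have sets: "a \<in> sets M" "b \<in> sets M" using ab gen_sets by blast+
    show "a \<inter> b \<in> \<C> \<union> null_sets M"
    proof (cases "a \<in> null_sets M \<or> b \<in> null_sets M")
      case True
      then have "a \<inter> b \<in> null_sets M" using sets null_set_Int1 null_set_Int2 by metis
      then show ?thesis ..
    next
      case False
      then have "a \<in> \<C>" "b \<in> \<C>" using ab by blast+
      then obtain J B K D where a: "a = cyl J B" "finite J" "J \<subseteq> {0..r}" "\<And>t. t \<in> J \<Longrightarrow> B t \<in> sets borel"
        and b: "b = cyl K D" "finite K" "K \<subseteq> {0..r}" "\<And>t. t \<in> K \<Longrightarrow> D t \<in> sets borel"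
        by (elim cylE) metis
      define E where "E t = (if t \<in> J then B t else UNIV) \<inter> (if t \<in> K then D t else UNIV)" for t
      have "a \<inter> b = cyl (J \<union> K) E"
        unfolding a(1) b(1) cyl_def E_def by (auto split: if_splits)
      also have "\<dots> \<in> \<C>"
        using a b by (intro cylI) (auto simp: E_def)
      finally show ?thesis ..
    qed
  qed
  have total: "(\<integral>\<omega>. F \<omega> \<partial>M) = 0" using zero[of "{}"] by simp
  have set_int: "set_integrable M A F" if "A \<in> sets M" for A
    unfolding set_integrable_def using F that by (intro integrable_mult_indicator) auto
  have sub: "sigma_sets (space M) (\<C> \<union> null_sets M) \<subseteq> sets M"
    by (rule sets.sigma_sets_subset[OF gen_sets])
  have gen: "sets (filtr M X r) \<subseteq> sigma_sets (space M) (\<C> \<union> null_sets M)"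
    unfolding sets_filtr
  proof (intro sigma_sets_mono' Un_mono subsetI, goal_cases)
    case (1 A)
    then obtain s B where A: "A = X s -` B \<inter> space M" "s \<in> {0..r}" "B \<in> sets borel" by blast
    have "A = cyl {s} (\<lambda>_. B)" unfolding A(1) cyl_def by auto
    also have "\<dots> \<in> \<C>" using A by (intro cylI) auto
    finally show ?case .
  qed
  have indicators: "(LINT \<omega>:A|M. F \<omega>) = 0" if "A \<in> sets (filtr M X r)" for A
  proof -
    note stable
    moreover have "\<C> \<union> null_sets M \<subseteq> Pow (space M)" using gen_sets sets.space_closed by (rule order_trans)
    moreover have "A \<in> sigma_sets (space M) (\<C> \<union> null_sets M)" using gen that by (rule subsetD)
    ultimately show ?thesis
    proof (induction rule: sigma_sets_induct_disjoint)
      case (basic A)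
      show ?case
      proof (cases "A \<in> null_sets M")
        case True
        then have "AE \<omega> in M. indicator A \<omega> *\<^sub>R F \<omega> = 0"
          by (rule AE_mp[OF AE_not_in]) (auto simp: indicator_def)
        then show ?thesis unfolding set_lebesgue_integral_def by (rule integral_eq_zero_AE)
      next
        case False
        then have "A \<in> \<C>" using basic by blast
        then obtain J B where A: "A = cyl J B" "finite J" "J \<subseteq> {0..r}" "\<And>t. t \<in> J \<Longrightarrow> B t \<in> sets borel"
          by (elim cylE) metis
        have "(LINT \<omega>:A|M. F \<omega>) = (\<integral>\<omega>. F \<omega> * (\<Prod>t\<in>J. indicator (B t) (X t \<omega>)) \<partial>M)"
          unfolding set_lebesgue_integral_def
        proof (intro Bochner_Integration.integral_cong refl)
          fix \<omega> assume "\<omega> \<in> space M"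
          have "indicator A \<omega> = (\<Prod>t\<in>J. indicator (B t) (X t \<omega>) :: real)"
          proof (cases "\<forall>t\<in>J. X t \<omega> \<in> B t")
            case True
            then show ?thesis using \<open>\<omega> \<in> space M\<close> by (auto simp: A(1) cyl_def indicator_def)
          next
            case False
            then have "(\<Prod>t\<in>J. indicator (B t) (X t \<omega>) :: real) = 0"
              using A(2) by (intro prod_zero) (auto simp: indicator_def)
            then show ?thesis using False by (auto simp: A(1) cyl_def indicator_def)
          qed
          then show "indicator A \<omega> *\<^sub>R F \<omega> = F \<omega> * (\<Prod>t\<in>J. indicator (B t) (X t \<omega>))" by simp
        qed
        also have "\<dots> = 0"
          using A r by (intro laplace_uniqueness_finite int zero X_measurable) auto
        finally show ?thesis .
      qed
    next
      case empty
      show ?case by (simp add: set_lebesgue_integral_def)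
    next
      case (compl A)
      have A: "A \<in> sets M" using compl(1) sub by blast
      have "(LINT \<omega>:space M - A|M. F \<omega>) + (LINT \<omega>:A|M. F \<omega>) = (LINT \<omega>:(space M - A) \<union> A|M. F \<omega>)"
        using A by (intro set_integral_Un[symmetric] set_int) auto
      also have "(space M - A) \<union> A = space M" using sets.sets_into_space[OF A] by auto
      also have "(LINT \<omega>:space M|M. F \<omega>) = 0"
        using total set_integral_space[OF F] by simp
      finally show ?case using compl(2) by simp
    next
      case (union A)
      have A: "A i \<in> sets M" for i using union(2) sub by blast
      have "(LINT \<omega>:(\<Union>i. A i)|M. F \<omega>) = (\<Sum>i. (LINT \<omega>:(A i)|M. F \<omega>))"
        using union(1) A by (intro lebesgue_integral_countable_add set_int)
          (auto simp: disjoint_family_on_def)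
      then show ?case using union(3) by simp
    qed
  qed
  \<comment> \<open>orthogonality to events means that the conditional expectation vanishes, hence orthogonality to \<open>\<eta>\<close>\<close>
  interpret S: finite_measure_subalgebra M "filtr M X r"
    by unfold_locales (rule subalgebra_filtr[OF r])
  have "AE \<omega> in M. real_cond_exp M (filtr M X r) F \<omega> = 0"
    using indicators F by (intro S.real_cond_exp_charact) (auto simp: set_lebesgue_integral_def)
  then have "(\<integral>\<omega>. \<eta> \<omega> * real_cond_exp M (filtr M X r) F \<omega> \<partial>M) = 0"
    by (intro integral_eq_zero_AE) auto
  then show ?thesis
    using S.real_cond_exp_intg(2)[OF \<eta>(2,1) FM] by simp
qed

end

section \<open>Wick exponentials and the S-transform\<close>

locale wiener = gaussian_process M T X for M :: "'w measure" and T X +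
  fixes e :: "real \<Rightarrow> 'k::{real_inner,complete_space}" and I :: "'k \<Rightarrow> 'w \<Rightarrow> real"
  assumes det: "deterministic_integrands M T X e" and wien: "wiener_integral M T X e I"
begin

lemma total: "indicators_total T e" using det by (simp add: deterministic_integrands_def)

lemma I_chaos: "I x \<in> first_chaos M T X" using wien by (simp add: wiener_integral_def)

lemma I_L2X: "I x \<in> L2X M T X" using I_chaos by (simp add: first_chaos_def)

lemma I_L2: "I x \<in> L2 M" using L2XD[OF I_L2X] .

lemma I_measurable [measurable]: "I x \<in> borel_measurable M" using I_L2 by (rule L2D)

lemma I_add: "AE \<omega> in M. I (x + y) \<omega> = I x \<omega> + I y \<omega>" using wien by (simp add: wiener_integral_def)

lemma I_scale: "AE \<omega> in M. I (r *\<^sub>R x) \<omega> = r * I x \<omega>" using wien by (simp add: wiener_integral_def)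

lemma I_diff: "AE \<omega> in M. I (x - y) \<omega> = I x \<omega> - I y \<omega>"
  using I_add[of x "(-1) *\<^sub>R y"] I_scale[of "-1" y] by eventually_elim simp

lemma I_norm: "(\<integral>\<omega>. (I x \<omega>)\<^sup>2 \<partial>M) = (norm x)\<^sup>2" using wien by (simp add: wiener_integral_def)

lemma I_indicator: "t \<in> {0..T} \<Longrightarrow> AE \<omega> in M. I (e t) \<omega> = X t \<omega>" using wien by (simp add: wiener_integral_def)

lemma I_inner: "(\<integral>\<omega>. I x \<omega> * I y \<omega> \<partial>M) = inner x y"
proof -
  have "(norm (x + y))\<^sup>2 = (\<integral>\<omega>. (I x \<omega>)\<^sup>2 + 2 * (I x \<omega> * I y \<omega>) + (I y \<omega>)\<^sup>2 \<partial>M)"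
    unfolding I_norm[symmetric]
  proof (intro integral_cong_AE)
    show "AE \<omega> in M. (I (x + y) \<omega>)\<^sup>2 = (I x \<omega>)\<^sup>2 + 2 * (I x \<omega> * I y \<omega>) + (I y \<omega>)\<^sup>2"
      using I_add[of x y] by eventually_elim (simp add: power2_sum)
  qed measurable
  also have "\<dots> = (norm x)\<^sup>2 + 2 * (\<integral>\<omega>. I x \<omega> * I y \<omega> \<partial>M) + (norm y)\<^sup>2"
    using L2_mult_integrable[OF I_L2 I_L2, of x y] L2D(2)[OF I_L2] by (simp add: I_norm)
  finally show ?thesis
    by (simp add: power2_norm_eq_inner inner_simps inner_commute)
qed

lemma underline_I: "t \<in> {0..T} \<Longrightarrow> underline M T X (I x) t = inner (e t) x"
proof -
  assume t: "t \<in> {0..T}"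
  note [measurable] = X_measurable[OF t]
  have "underline M T X (I x) t = (\<integral>\<omega>. X t \<omega> * I x \<omega> \<partial>M)" using t by (simp add: underline_def)
  also have "\<dots> = (\<integral>\<omega>. I (e t) \<omega> * I x \<omega> \<partial>M)"
    using I_indicator[OF t] by (intro integral_cong_AE) auto
  finally show ?thesis by (simp add: I_inner)
qed

lemma I_sum: "finite J \<Longrightarrow> J \<subseteq> {0..T} \<Longrightarrow> AE \<omega> in M. I (\<Sum>t\<in>J. b t *\<^sub>R e t) \<omega> = (\<Sum>t\<in>J. b t * X t \<omega>)"
proof (induction J rule: finite_induct)
  case empty
  show ?case using I_scale[of 0 0] by simp
next
  case (insert t J)
  have "AE \<omega> in M. I (\<Sum>t\<in>J. b t *\<^sub>R e t) \<omega> = (\<Sum>t\<in>J. b t * X t \<omega>)"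
    "AE \<omega> in M. I (e t) \<omega> = X t \<omega>" using insert I_indicator by auto
  then show ?case
    using I_add[of "b t *\<^sub>R e t" "\<Sum>t\<in>J. b t *\<^sub>R e t"] I_scale[of "b t" "e t"]
    by eventually_elim (simp add: insert.hyps)
qed

lemma span_indicators:
  assumes "y \<in> span (e ` {0..T})"
  obtains J b where "finite J" "J \<subseteq> {0..T}" "y = (\<Sum>t\<in>J. b t *\<^sub>R e t)"
proof -
  obtain S r where S: "finite S" "S \<subseteq> e ` {0..T}" "y = (\<Sum>v\<in>S. r v *\<^sub>R v)"
    using assms unfolding span_explicit by blast
  obtain J where J: "J \<subseteq> {0..T}" "S = e ` J" "inj_on e J"
    using S(2) unfolding subset_image_inj by blast
  have "y = (\<Sum>t\<in>J. r (e t) *\<^sub>R e t)"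
    unfolding S(3) J(2) using J(3) by (simp add: sum.reindex)
  moreover have "finite J" using S(1) J(2,3) finite_imageD by blast
  ultimately show ?thesis using J(1) by (intro that[of J "\<lambda>t. r (e t)"])
qed

lemma exp_I_span:
  assumes "y \<in> span (e ` {0..T})"
  shows "integrable M (\<lambda>\<omega>. exp (I y \<omega>))" "(\<integral>\<omega>. exp (I y \<omega>) \<partial>M) = exp ((norm y)\<^sup>2 / 2)"
proof -
  obtain J b where J: "finite J" "J \<subseteq> {0..T}" "y = (\<Sum>t\<in>J. b t *\<^sub>R e t)"
    using span_indicators[OF assms] .
  let ?U = "\<lambda>\<omega>. \<Sum>t\<in>J. b t * X t \<omega>"
  have U: "centered_gaussian_rv M ?U" using gaussian J by (simp add: gaussian_setting_def)
  then have [measurable]: "?U \<in> borel_measurable M" by (simp add: centered_gaussian_rv_def)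
  have eq: "AE \<omega> in M. I y \<omega> = ?U \<omega>" unfolding J(3) using I_sum[OF J(1,2)] .
  have "integrable M (\<lambda>\<omega>. exp (I y \<omega>)) \<longleftrightarrow> integrable M (\<lambda>\<omega>. exp (?U \<omega>))"
    using eq by (intro integrable_cong_AE) auto
  then show "integrable M (\<lambda>\<omega>. exp (I y \<omega>))" using centered_gaussian_exp(2)[OF U] by simp
  have "(\<integral>\<omega>. exp (I y \<omega>) \<partial>M) = (\<integral>\<omega>. exp (?U \<omega>) \<partial>M)"
    using eq by (intro integral_cong_AE) auto
  also have "\<dots> = exp ((\<integral>\<omega>. (?U \<omega>)\<^sup>2 \<partial>M) / 2)" by (rule centered_gaussian_exp(3)[OF U])
  also have "(\<integral>\<omega>. (?U \<omega>)\<^sup>2 \<partial>M) = (\<integral>\<omega>. (I y \<omega>)\<^sup>2 \<partial>M)"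
    using eq by (intro integral_cong_AE) auto
  finally show "(\<integral>\<omega>. exp (I y \<omega>) \<partial>M) = exp ((norm y)\<^sup>2 / 2)" by (simp add: I_norm)
qed

lemma span_approx:
  obtains y where "\<And>n. y n \<in> span (e ` {0..T})" "y \<longlonglongrightarrow> x"
  using total closure_sequential[of x "span (e ` {0..T})"] by (auto simp: indicators_total_def)

text \<open>
  Approximate \<open>x\<close> from the span of the indicators, where \<open>I\<close> is Gaussian by assumption, and apply Fatou's
  lemma along an almost surely convergent subsequence.
\<close>

lemma integrable_exp_I: "integrable M (\<lambda>\<omega>. exp (I x \<omega>))"
proof -
  obtain y where y: "\<And>n. y n \<in> span (e ` {0..T})" "y \<longlonglongrightarrow> x" by (rule span_approx[of x]) blast
  have "(\<lambda>n. (norm (y n - x))\<^sup>2) \<longlonglongrightarrow> 0\<^sup>2"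
    by (intro tendsto_intros tendsto_norm_zero LIM_zero y)
  moreover have "(\<integral>\<omega>. norm ((I (y n - x) \<omega>)\<^sup>2) \<partial>M) = (norm (y n - x))\<^sup>2" for n
    by (simp add: I_norm)
  ultimately have "(\<lambda>n. \<integral>\<omega>. norm ((I (y n - x) \<omega>)\<^sup>2) \<partial>M) \<longlonglongrightarrow> 0" by simp
  from tendsto_L1_AE_subseq[OF L2D(2)[OF I_L2] this]
  obtain r where r: "strict_mono r" "AE \<omega> in M. (\<lambda>n. (I (y (r n) - x) \<omega>)\<^sup>2) \<longlonglongrightarrow> 0" by blast
  have "AE \<omega> in M. \<forall>n. I (y n - x) \<omega> = I (y n) \<omega> - I x \<omega>"
    using I_diff by (subst AE_all_countable) auto
  with r(2) have "AE \<omega> in M. (\<lambda>n. exp (I (y (r n)) \<omega>)) \<longlonglongrightarrow> exp (I x \<omega>)"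
  proof eventually_elim
    case (elim \<omega>)
    then have "(\<lambda>n. \<bar>I (y (r n)) \<omega> - I x \<omega>\<bar>) \<longlonglongrightarrow> 0"
      using tendsto_real_sqrt[OF elim(1)] by simp
    then have "(\<lambda>n. I (y (r n)) \<omega>) \<longlonglongrightarrow> I x \<omega>" by (simp add: LIM_zero_iff tendsto_rabs_zero_iff)
    then show ?case by (rule tendsto_exp)
  qed
  then have "AE \<omega> in M. ennreal (exp (I x \<omega>)) = liminf (\<lambda>n. ennreal (exp (I (y (r n)) \<omega>)))"
    by eventually_elim (metis lim_imp_Liminf sequentially_bot tendsto_ennrealI)
  then have "(\<integral>\<^sup>+\<omega>. ennreal (exp (I x \<omega>)) \<partial>M) = (\<integral>\<^sup>+\<omega>. liminf (\<lambda>n. ennreal (exp (I (y (r n)) \<omega>))) \<partial>M)"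
    by (rule nn_integral_cong_AE)
  also have "\<dots> \<le> liminf (\<lambda>n. \<integral>\<^sup>+\<omega>. ennreal (exp (I (y (r n)) \<omega>)) \<partial>M)"
    by (intro nn_integral_liminf) measurable
  also have "(\<lambda>n. \<integral>\<^sup>+\<omega>. ennreal (exp (I (y (r n)) \<omega>)) \<partial>M) = (\<lambda>n. ennreal (exp ((norm (y (r n)))\<^sup>2 / 2)))"
    using exp_I_span[OF y(1)] by (intro ext) (simp add: nn_integral_eq_integral)
  also have "liminf \<dots> = ennreal (exp ((norm x)\<^sup>2 / 2))"
    using LIMSEQ_subseq_LIMSEQ[OF y(2) r(1)]
    by (intro lim_imp_Liminf tendsto_ennrealI tendsto_intros) (auto simp: o_def)
  finally show ?thesis
    by (intro integrableI_bounded) (auto simp: less_top[symmetric] top_unique)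
qed

lemma exp_I_L2: "(\<lambda>\<omega>. exp (I x \<omega>)) \<in> L2 M"
proof -
  have "integrable M (\<lambda>\<omega>. exp (I (2 *\<^sub>R x) \<omega>)) \<longleftrightarrow> integrable M (\<lambda>\<omega>. (exp (I x \<omega>))\<^sup>2)"
    using I_scale[of 2 x]
    by (intro integrable_cong_AE) (auto simp: power2_eq_square simp flip: exp_add elim!: eventually_mono)
  then show ?thesis using integrable_exp_I by (simp add: L2_def)
qed

text \<open>
  On the span this is the exponential moment of a Gaussian variable.  It passes to the limit because
  \<open>\<bar>e\<^sup>u - e\<^sup>v\<bar> \<le> \<bar>u - v\<bar> (e\<^sup>u + e\<^sup>v)\<close> and the exponentials of \<open>I\<close> have square integrals bounded along the
  approximating sequence.
\<close>

lemma integral_exp_I: "(\<integral>\<omega>. exp (I x \<omega>) \<partial>M) = exp ((norm x)\<^sup>2 / 2)"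
proof -
  obtain y where y: "\<And>n. y n \<in> span (e ` {0..T})" "y \<longlonglongrightarrow> x" by (rule span_approx[of x]) blast
  let ?E = "\<lambda>n \<omega>. exp (I (y n) \<omega>) + exp (I x \<omega>)"
  have EL2: "?E n \<in> L2 M" for n by (intro L2_add exp_I_L2)
  have dL2: "(\<lambda>\<omega>. \<bar>I (y n - x) \<omega>\<bar>) \<in> L2 M" for n using I_L2[of "y n - x"] by (auto simp: L2_def)
  define K where "K = (\<integral>\<omega>. (exp (I x \<omega>))\<^sup>2 \<partial>M)"
  have E2: "(\<integral>\<omega>. (?E n \<omega>)\<^sup>2 \<partial>M) \<le> 2 * exp (2 * (norm (y n))\<^sup>2) + 2 * K" for n
  proof -
    have "(\<integral>\<omega>. (?E n \<omega>)\<^sup>2 \<partial>M) \<le> (\<integral>\<omega>. 2 * (exp (I (y n) \<omega>))\<^sup>2 + 2 * (exp (I x \<omega>))\<^sup>2 \<partial>M)"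
    proof (rule integral_mono)
      have "(a + b)\<^sup>2 \<le> 2 * a\<^sup>2 + 2 * b\<^sup>2" for a b :: real
        using sum_squares_bound[of a b] by (simp add: power2_sum)
      then show "(?E n \<omega>)\<^sup>2 \<le> 2 * (exp (I (y n) \<omega>))\<^sup>2 + 2 * (exp (I x \<omega>))\<^sup>2" for \<omega> .
    qed (use EL2[of n] L2D(2)[OF exp_I_L2] in \<open>auto\<close>)
    also have "\<dots> = 2 * (\<integral>\<omega>. (exp (I (y n) \<omega>))\<^sup>2 \<partial>M) + 2 * K"
      using L2D(2)[OF exp_I_L2] by (simp add: K_def)
    also have "(\<integral>\<omega>. (exp (I (y n) \<omega>))\<^sup>2 \<partial>M) = (\<integral>\<omega>. exp (I (2 *\<^sub>R y n) \<omega>) \<partial>M)"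
      using I_scale[of 2 "y n"]
      by (intro integral_cong_AE) (auto simp: power2_eq_square simp flip: exp_add elim!: eventually_mono)
    also have "\<dots> = exp (2 * (norm (y n))\<^sup>2)"
      using exp_I_span(2)[OF span_scale[OF y(1)], of 2 n] by (simp add: power_mult_distrib)
    finally show ?thesis .
  qed
  have diff: "\<bar>(\<integral>\<omega>. exp (I (y n) \<omega>) \<partial>M) - (\<integral>\<omega>. exp (I x \<omega>) \<partial>M)\<bar> \<le>
      sqrt ((norm (y n - x))\<^sup>2 * (2 * exp (2 * (norm (y n))\<^sup>2) + 2 * K))" for n
  proof -
    have "\<bar>(\<integral>\<omega>. exp (I (y n) \<omega>) \<partial>M) - (\<integral>\<omega>. exp (I x \<omega>) \<partial>M)\<bar> = \<bar>\<integral>\<omega>. exp (I (y n) \<omega>) - exp (I x \<omega>) \<partial>M\<bar>"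
      using integrable_exp_I by simp
    also have "\<dots> \<le> (\<integral>\<omega>. \<bar>exp (I (y n) \<omega>) - exp (I x \<omega>)\<bar> \<partial>M)" by (rule integral_abs_bound)
    also have "\<dots> \<le> (\<integral>\<omega>. \<bar>I (y n - x) \<omega>\<bar> * ?E n \<omega> \<partial>M)"
    proof (rule integral_mono_AE)
      have ineq: "\<bar>exp a - exp b\<bar> \<le> \<bar>a - b\<bar> * (exp a + exp b)" for a b :: real
      proof -
        have *: "exp u - exp v \<le> (u - v) * exp u" for u v :: real
        proof -
          have "exp u * (1 + (v - u)) \<le> exp u * exp (v - u)"
            using exp_ge_add_one_self[of "v - u"] by (intro mult_left_mono) auto
          then show ?thesis by (simp add: exp_diff algebra_simps)
        qed
        have "exp a - exp b \<le> \<bar>a - b\<bar> * (exp a + exp b)" if "b \<le> a" for a b :: real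
          using *[of a b] that by (simp add: distrib_left add_increasing2)
        from this[of a b] this[of b a] show ?thesis
          by (cases "a \<le> b") (auto simp: abs_if add.commute)
      qed
      show "AE \<omega> in M. \<bar>exp (I (y n) \<omega>) - exp (I x \<omega>)\<bar> \<le> \<bar>I (y n - x) \<omega>\<bar> * ?E n \<omega>"
        using I_diff[of "y n" x] by eventually_elim (simp add: ineq)
      show "integrable M (\<lambda>\<omega>. \<bar>I (y n - x) \<omega>\<bar> * ?E n \<omega>)" by (rule L2_mult_integrable[OF dL2 EL2])
    qed (use integrable_exp_I in auto)
    also have "\<dots> \<le> sqrt ((\<integral>\<omega>. \<bar>I (y n - x) \<omega>\<bar>\<^sup>2 \<partial>M) * (\<integral>\<omega>. (?E n \<omega>)\<^sup>2 \<partial>M))"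
      by (rule real_le_rsqrt[OF L2_Cauchy_Schwarz[OF dL2 EL2]])
    also have "\<dots> \<le> sqrt ((norm (y n - x))\<^sup>2 * (2 * exp (2 * (norm (y n))\<^sup>2) + 2 * K))"
      using E2[of n] by (simp add: I_norm mult_left_mono)
    finally show ?thesis .
  qed
  have "(\<lambda>n. sqrt ((norm (y n - x))\<^sup>2 * (2 * exp (2 * (norm (y n))\<^sup>2) + 2 * K)))
      \<longlonglongrightarrow> sqrt (0\<^sup>2 * (2 * exp (2 * (norm x)\<^sup>2) + 2 * K))"
    by (intro tendsto_intros y tendsto_norm_zero LIM_zero)
  then have "(\<lambda>n. sqrt ((norm (y n - x))\<^sup>2 * (2 * exp (2 * (norm (y n))\<^sup>2) + 2 * K))) \<longlonglongrightarrow> 0" by simp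
  then have "(\<lambda>n. (\<integral>\<omega>. exp (I (y n) \<omega>) \<partial>M) - (\<integral>\<omega>. exp (I x \<omega>) \<partial>M)) \<longlonglongrightarrow> 0"
    by (rule Lim_null_comparison[rotated]) (use diff in auto)
  then have "(\<lambda>n. \<integral>\<omega>. exp (I (y n) \<omega>) \<partial>M) \<longlonglongrightarrow> (\<integral>\<omega>. exp (I x \<omega>) \<partial>M)"
    by (simp add: LIM_zero_iff)
  moreover have "(\<lambda>n. exp ((norm (y n))\<^sup>2 / 2)) \<longlonglongrightarrow> exp ((norm x)\<^sup>2 / 2)"
    by (intro tendsto_intros y) auto
  ultimately show ?thesis
    unfolding exp_I_span(2)[OF y(1)] by (rule LIMSEQ_unique)
qed

lemma integral_exp_I_mult:
  "(\<integral>\<omega>. exp (I x \<omega>) * exp (I y \<omega>) \<partial>M) = exp (((norm x)\<^sup>2 + (norm y)\<^sup>2) / 2 + inner x y)"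
proof -
  have "(\<integral>\<omega>. exp (I x \<omega>) * exp (I y \<omega>) \<partial>M) = (\<integral>\<omega>. exp (I (x + y) \<omega>) \<partial>M)"
    using I_add[of x y] by (intro integral_cong_AE) (auto simp: exp_add elim!: eventually_mono)
  also have "\<dots> = exp (((norm x)\<^sup>2 + (norm y)\<^sup>2) / 2 + inner x y)"
    unfolding integral_exp_I by (simp add: power2_norm_eq_inner inner_simps inner_commute field_simps)
  finally show ?thesis .
qed

lemma wick_exp_I: "wick_exp M (I x) \<omega> = exp (- (norm x)\<^sup>2 / 2) * exp (I x \<omega>)"
  unfolding wick_exp_def I_norm exp_add[symmetric] by simp

lemma wick_L2: "wick_exp M (I x) \<in> L2 M"
  using L2_scale[OF exp_I_L2] unfolding wick_exp_I[abs_def] .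

lemma wick_mult_exp: "(\<integral>\<omega>. wick_exp M (I x) \<omega> * exp (I y \<omega>) \<partial>M) = exp ((norm y)\<^sup>2 / 2 + inner x y)"
proof -
  have "(\<integral>\<omega>. wick_exp M (I x) \<omega> * exp (I y \<omega>) \<partial>M) =
      exp (- (norm x)\<^sup>2 / 2) * exp (((norm x)\<^sup>2 + (norm y)\<^sup>2) / 2 + inner x y)"
    unfolding wick_exp_I mult.assoc by (simp add: integral_exp_I_mult)
  then show ?thesis by (simp add: add_divide_distrib flip: exp_add)
qed

lemma wick_inner: "(\<integral>\<omega>. wick_exp M (I x) \<omega> * wick_exp M (I y) \<omega> \<partial>M) = exp (inner x y)"
proof -
  have "(\<integral>\<omega>. wick_exp M (I x) \<omega> * wick_exp M (I y) \<omega> \<partial>M) =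
     (\<integral>\<omega>. exp (- (norm y)\<^sup>2 / 2) * (wick_exp M (I x) \<omega> * exp (I y \<omega>)) \<partial>M)"
    by (simp add: wick_exp_I[of y] mult_ac)
  then show ?thesis by (simp add: wick_mult_exp flip: exp_add)
qed

lemma S_integrable: "\<eta> \<in> L2 M \<Longrightarrow> integrable M (\<lambda>\<omega>. \<eta> \<omega> * wick_exp M (I x) \<omega>)"
  by (rule L2_mult_integrable[OF _ wick_L2])

lemma S_add: "\<eta> \<in> L2 M \<Longrightarrow> \<zeta> \<in> L2 M \<Longrightarrow>
    S_transform M I (\<lambda>\<omega>. \<eta> \<omega> + \<zeta> \<omega>) x = S_transform M I \<eta> x + S_transform M I \<zeta> x"
  unfolding S_transform_def by (simp add: S_integrable distrib_right)

lemma S_diff: "\<eta> \<in> L2 M \<Longrightarrow> \<zeta> \<in> L2 M \<Longrightarrow>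
    S_transform M I (\<lambda>\<omega>. \<eta> \<omega> - \<zeta> \<omega>) x = S_transform M I \<eta> x - S_transform M I \<zeta> x"
  unfolding S_transform_def by (simp add: S_integrable left_diff_distrib)

lemma S_scale: "S_transform M I (\<lambda>\<omega>. c * \<eta> \<omega>) x = c * S_transform M I \<eta> x"
  unfolding S_transform_def by (simp add: mult.assoc)

lemma S_cong_AE:
  assumes "\<eta> \<in> borel_measurable M" "\<zeta> \<in> borel_measurable M" "AE \<omega> in M. \<eta> \<omega> = \<zeta> \<omega>"
  shows "S_transform M I \<eta> x = S_transform M I \<zeta> x"
  unfolding S_transform_def using assms L2D(1)[OF wick_L2]
  by (intro integral_cong_AE) auto

text \<open>
  By Cauchy--Schwarz it suffices that the Wick exponentials converge in \<open>L\<^sup>2\<close>.  The squared distance of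
  those of \<open>x\<close> and \<open>y\<close> is
  \<open>e\<^bsup>|x|\<^sup>2\<^esup> - 2 e\<^bsup>(x,y)\<^esup> + e\<^bsup>|y|\<^sup>2\<^esup>\<close>.
\<close>

lemma S_tendsto:
  assumes \<eta>: "\<eta> \<in> L2 M" and x: "x \<longlonglongrightarrow> y"
  shows "(\<lambda>n. S_transform M I \<eta> (x n)) \<longlonglongrightarrow> S_transform M I \<eta> y"
proof -
  let ?d = "\<lambda>n \<omega>. wick_exp M (I (x n)) \<omega> - wick_exp M (I y) \<omega>"
  let ?N = "\<lambda>n. exp (inner (x n) (x n)) - 2 * exp (inner (x n) y) + exp (inner y y)"
  have d: "?d n \<in> L2 M" for n by (intro L2_diff wick_L2)
  have "(\<integral>\<omega>. (?d n \<omega>)\<^sup>2 \<partial>M) = ?N n" for n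
  proof -
    have "(\<integral>\<omega>. (?d n \<omega>)\<^sup>2 \<partial>M) = (\<integral>\<omega>. wick_exp M (I (x n)) \<omega> * wick_exp M (I (x n)) \<omega>
        - 2 * (wick_exp M (I (x n)) \<omega> * wick_exp M (I y) \<omega>) + wick_exp M (I y) \<omega> * wick_exp M (I y) \<omega> \<partial>M)"
      by (intro Bochner_Integration.integral_cong) (auto simp: power2_eq_square algebra_simps)
    also have "\<dots> = ?N n"
      using L2_mult_integrable[OF wick_L2 wick_L2] by (simp add: wick_inner)
    finally show ?thesis .
  qed
  moreover have "\<bar>S_transform M I \<eta> (x n) - S_transform M I \<eta> y\<bar> \<le> sqrt ((\<integral>\<omega>. (\<eta> \<omega>)\<^sup>2 \<partial>M) * (\<integral>\<omega>. (?d n \<omega>)\<^sup>2 \<partial>M))" for n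
  proof -
    have "S_transform M I \<eta> (x n) - S_transform M I \<eta> y = (\<integral>\<omega>. \<eta> \<omega> * ?d n \<omega> \<partial>M)"
      unfolding S_transform_def using S_integrable[OF \<eta>] by (simp add: right_diff_distrib)
    then show ?thesis using L2_Cauchy_Schwarz[OF \<eta> d, of n] by (simp add: real_le_rsqrt)
  qed
  ultimately have bound: "\<bar>S_transform M I \<eta> (x n) - S_transform M I \<eta> y\<bar> \<le> sqrt ((\<integral>\<omega>. (\<eta> \<omega>)\<^sup>2 \<partial>M) * ?N n)" for n
    by simp
  have "(\<lambda>n. sqrt ((\<integral>\<omega>. (\<eta> \<omega>)\<^sup>2 \<partial>M) * ?N n)) \<longlonglongrightarrow>
      sqrt ((\<integral>\<omega>. (\<eta> \<omega>)\<^sup>2 \<partial>M) * (exp (inner y y) - 2 * exp (inner y y) + exp (inner y y)))"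
    by (intro tendsto_intros x)
  then have "(\<lambda>n. sqrt ((\<integral>\<omega>. (\<eta> \<omega>)\<^sup>2 \<partial>M) * ?N n)) \<longlonglongrightarrow> 0" by simp
  then have "(\<lambda>n. S_transform M I \<eta> (x n) - S_transform M I \<eta> y) \<longlonglongrightarrow> 0"
    by (rule Lim_null_comparison[rotated]) (use bound in auto)
  then show ?thesis by (simp add: LIM_zero_iff)
qed

lemma integral_mult_exp_sum:
  assumes F: "F \<in> L2 M" and J: "finite J" "J \<subseteq> {0..T}"
  shows "integrable M (\<lambda>\<omega>. F \<omega> * exp (\<Sum>t\<in>J. b t * X t \<omega>))"
    and "(\<integral>\<omega>. F \<omega> * exp (\<Sum>t\<in>J. b t * X t \<omega>) \<partial>M) = (\<integral>\<omega>. F \<omega> * exp (I (\<Sum>t\<in>J. b t *\<^sub>R e t) \<omega>) \<partial>M)"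
proof -
  note [measurable] = L2D(1)[OF F]
  have [measurable]: "(\<lambda>\<omega>. \<Sum>t\<in>J. b t * X t \<omega>) \<in> borel_measurable M"
    using J(2) X_measurable by (intro borel_measurable_sum) auto
  have eq: "AE \<omega> in M. F \<omega> * exp (\<Sum>t\<in>J. b t * X t \<omega>) = F \<omega> * exp (I (\<Sum>t\<in>J. b t *\<^sub>R e t) \<omega>)"
    using I_sum[OF J, of b] by eventually_elim simp
  show "integrable M (\<lambda>\<omega>. F \<omega> * exp (\<Sum>t\<in>J. b t * X t \<omega>))"
    using L2_mult_integrable[OF F exp_I_L2] by (subst integrable_cong_AE[OF _ _ eq]) auto
  show "(\<integral>\<omega>. F \<omega> * exp (\<Sum>t\<in>J. b t * X t \<omega>) \<partial>M) = (\<integral>\<omega>. F \<omega> * exp (I (\<Sum>t\<in>J. b t *\<^sub>R e t) \<omega>) \<partial>M)"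
    using eq by (intro integral_cong_AE) auto
qed

text \<open>
  The difference of the two Wick exponentials is orthogonal to \<open>e\<^bsup>I(z)\<^esup>\<close> for each \<open>z\<close> in the span of the
  indicators up to time \<open>r\<close>, because \<open>E[e\<^bsup>I(z)\<^esup> e\<^bsup>\<diamond>I(x)\<^esup>]\<close> depends on \<open>x\<close> only through the inner product with
  \<open>z\<close>.
\<close>

lemma S_transform_adapted:
  assumes \<eta>: "\<eta> \<in> L2 M" "\<eta> \<in> borel_measurable (filtr M X r)" and r: "r \<le> T"
    and eq: "\<And>s. s \<in> {0..r} \<Longrightarrow> inner (e s) x = inner (e s) y"
  shows "S_transform M I \<eta> x = S_transform M I \<eta> y"
proof -
  let ?F = "\<lambda>\<omega>. wick_exp M (I x) \<omega> - wick_exp M (I y) \<omega>"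
  have F: "?F \<in> L2 M" by (intro L2_diff wick_L2)
  have "(\<integral>\<omega>. \<eta> \<omega> * ?F \<omega> \<partial>M) = 0"
  proof (rule exponentials_determine_cond_exp[OF L2_integrable[OF F] r])
    fix J :: "real set" and b assume J: "finite J" "J \<subseteq> {0..r}"
    then have J': "J \<subseteq> {0..T}" using r by auto
    show "integrable M (\<lambda>\<omega>. ?F \<omega> * exp (\<Sum>t\<in>J. b t * X t \<omega>))"
      by (rule integral_mult_exp_sum(1)[OF F J(1) J'])
    define z where "z = (\<Sum>t\<in>J. b t *\<^sub>R e t)"
    have "inner x z = inner y z"
      using eq J by (auto simp: z_def inner_sum_right inner_commute intro!: sum.cong)
    have "(\<integral>\<omega>. ?F \<omega> * exp (\<Sum>t\<in>J. b t * X t \<omega>) \<partial>M) = (\<integral>\<omega>. ?F \<omega> * exp (I z \<omega>) \<partial>M)"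
      unfolding z_def by (rule integral_mult_exp_sum(2)[OF F J(1) J'])
    also have "\<dots> = (\<integral>\<omega>. wick_exp M (I x) \<omega> * exp (I z \<omega>) \<partial>M) - (\<integral>\<omega>. wick_exp M (I y) \<omega> * exp (I z \<omega>) \<partial>M)"
      using L2_mult_integrable[OF wick_L2 exp_I_L2] by (simp add: left_diff_distrib)
    also have "\<dots> = 0" unfolding wick_mult_exp \<open>inner x z = inner y z\<close> by simp
    finally show "(\<integral>\<omega>. ?F \<omega> * exp (\<Sum>t\<in>J. b t * X t \<omega>) \<partial>M) = 0" .
  qed (use \<eta> L2_mult_integrable[OF \<eta>(1) F] in auto)
  then show ?thesis
    unfolding S_transform_def using S_integrable[OF \<eta>(1)] by (simp add: right_diff_distrib)
qed

lemma S_transform_injective: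
  assumes \<eta>: "\<eta> \<in> L2X M T X" and \<zeta>: "\<zeta> \<in> L2X M T X"
    and eq: "\<And>x. S_transform M I \<eta> x = S_transform M I \<zeta> x"
  shows "AE \<omega> in M. \<eta> \<omega> = \<zeta> \<omega>"
proof -
  let ?F = "\<lambda>\<omega>. \<eta> \<omega> - \<zeta> \<omega>"
  have F: "?F \<in> L2 M" using \<eta> \<zeta> by (intro L2_diff L2XD)
  have Fm: "?F \<in> borel_measurable (filtr M X T)" using \<eta> \<zeta> by (auto simp: L2X_iff)
  have "(\<integral>\<omega>. ?F \<omega> * ?F \<omega> \<partial>M) = 0"
  proof (rule exponentials_determine_cond_exp[OF L2_integrable[OF F] order_refl _ _ Fm L2_mult_integrable[OF F F]])
    fix J :: "real set" and b assume J: "finite J" "J \<subseteq> {0..T}"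
    show "integrable M (\<lambda>\<omega>. ?F \<omega> * exp (\<Sum>t\<in>J. b t * X t \<omega>))"
      by (rule integral_mult_exp_sum(1)[OF F J])
    define z where "z = (\<Sum>t\<in>J. b t *\<^sub>R e t)"
    have "(\<integral>\<omega>. ?F \<omega> * exp (\<Sum>t\<in>J. b t * X t \<omega>) \<partial>M) = (\<integral>\<omega>. ?F \<omega> * exp (I z \<omega>) \<partial>M)"
      unfolding z_def by (rule integral_mult_exp_sum(2)[OF F J])
    also have "\<dots> = (\<integral>\<omega>. exp ((norm z)\<^sup>2 / 2) * (?F \<omega> * wick_exp M (I z) \<omega>) \<partial>M)"
      by (intro Bochner_Integration.integral_cong) (auto simp: wick_exp_I mult_ac simp flip: exp_add)
    also have "\<dots> = exp ((norm z)\<^sup>2 / 2) * S_transform M I ?F z"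
      by (simp add: S_transform_def)
    also have "\<dots> = 0" using S_diff[OF L2XD[OF \<eta>] L2XD[OF \<zeta>]] eq by simp
    finally show "(\<integral>\<omega>. ?F \<omega> * exp (\<Sum>t\<in>J. b t * X t \<omega>) \<partial>M) = 0" .
  qed
  then have "AE \<omega> in M. ?F \<omega> * ?F \<omega> = 0"
    using integral_nonneg_eq_0_iff_AE[OF L2_mult_integrable[OF F F]] by simp
  then show ?thesis by eventually_elim simp
qed

text \<open>
  The Wiener integral is an isometry onto a set containing all finite linear combinations of the process,
  and its domain is complete; its range is therefore closed.
\<close>

lemma I_surjective:
  assumes g: "g \<in> first_chaos M T X"
  obtains y where "AE \<omega> in M. I y \<omega> = g \<omega>"
proof -
  have gL2: "g \<in> L2 M" using g L2XD by (auto simp: first_chaos_def)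
  note [measurable] = L2D(1)[OF gL2]
  have "\<exists>y. (\<integral>\<omega>. (g \<omega> - I y \<omega>)\<^sup>2 \<partial>M) < \<epsilon>" if "0 < \<epsilon>" for \<epsilon>
  proof -
    obtain J b where J: "finite J" "J \<subseteq> {0..T}" "(\<integral>\<omega>. (g \<omega> - (\<Sum>t\<in>J. b t * X t \<omega>))\<^sup>2 \<partial>M) < \<epsilon>"
      using g \<open>0 < \<epsilon>\<close> unfolding first_chaos_def by blast
    have [measurable]: "(\<lambda>\<omega>. \<Sum>t\<in>J. b t * X t \<omega>) \<in> borel_measurable M"
      using J(2) X_measurable by (intro borel_measurable_sum) auto
    have "(\<integral>\<omega>. (g \<omega> - I (\<Sum>t\<in>J. b t *\<^sub>R e t) \<omega>)\<^sup>2 \<partial>M) = (\<integral>\<omega>. (g \<omega> - (\<Sum>t\<in>J. b t * X t \<omega>))\<^sup>2 \<partial>M)"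
      using I_sum[OF J(1,2), of b] by (intro integral_cong_AE) auto
    then show ?thesis using J(3) by metis
  qed
  then have "\<forall>n. \<exists>y. (\<integral>\<omega>. (g \<omega> - I y \<omega>)\<^sup>2 \<partial>M) < 1 / real (Suc n)" by simp
  then obtain y where y: "\<And>n. (\<integral>\<omega>. (g \<omega> - I (y n) \<omega>)\<^sup>2 \<partial>M) < 1 / real (Suc n)" by metis
  have dL2: "(\<lambda>\<omega>. g \<omega> - I z \<omega>) \<in> L2 M" for z by (intro L2_diff gL2 I_L2)
  have tri: "(\<integral>\<omega>. (u \<omega> - v \<omega>)\<^sup>2 \<partial>M) \<le> 2 * (\<integral>\<omega>. (u \<omega>)\<^sup>2 \<partial>M) + 2 * (\<integral>\<omega>. (v \<omega>)\<^sup>2 \<partial>M)"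
    if "u \<in> L2 M" "v \<in> L2 M" for u v
  proof -
    have "(\<integral>\<omega>. (u \<omega> - v \<omega>)\<^sup>2 \<partial>M) \<le> (\<integral>\<omega>. 2 * (u \<omega>)\<^sup>2 + 2 * (v \<omega>)\<^sup>2 \<partial>M)"
    proof (rule integral_mono)
      have "(a - b)\<^sup>2 \<le> 2 * a\<^sup>2 + 2 * b\<^sup>2" for a b :: real
        using sum_squares_bound[of a "-b"] by (simp add: power2_diff)
      then show "(u \<omega> - v \<omega>)\<^sup>2 \<le> 2 * (u \<omega>)\<^sup>2 + 2 * (v \<omega>)\<^sup>2" for \<omega> .
    qed (use L2D(2)[OF that(1)] L2D(2)[OF that(2)] L2D(2)[OF L2_diff[OF that]] in auto)
    then show ?thesis using that by (simp add: L2D)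
  qed
  have dist: "(norm (y p - y q))\<^sup>2 \<le> 2 / real (Suc p) + 2 / real (Suc q)" for p q
  proof -
    have "(norm (y p - y q))\<^sup>2 = (\<integral>\<omega>. ((g \<omega> - I (y q) \<omega>) - (g \<omega> - I (y p) \<omega>))\<^sup>2 \<partial>M)"
      unfolding I_norm[symmetric] using I_diff[of "y p" "y q"] by (intro integral_cong_AE) auto
    also have "\<dots> \<le> 2 * (\<integral>\<omega>. (g \<omega> - I (y q) \<omega>)\<^sup>2 \<partial>M) + 2 * (\<integral>\<omega>. (g \<omega> - I (y p) \<omega>)\<^sup>2 \<partial>M)"
      by (rule tri[OF dL2 dL2])
    finally show ?thesis using y[of p] y[of q] by simp
  qed
  then have "Cauchy y" by (rule Cauchy_inverse_bound)
  then obtain l where l: "y \<longlonglongrightarrow> l" using Cauchy_convergent convergent_def by blast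
  have "(\<integral>\<omega>. (g \<omega> - I l \<omega>)\<^sup>2 \<partial>M) \<le> 2 * (1 / real (Suc n)) + 2 * (norm (y n - l))\<^sup>2" for n
  proof -
    have "(\<integral>\<omega>. (g \<omega> - I l \<omega>)\<^sup>2 \<partial>M) = (\<integral>\<omega>. ((g \<omega> - I (y n) \<omega>) - I (l - y n) \<omega>)\<^sup>2 \<partial>M)"
      using I_diff[of l "y n"] by (intro integral_cong_AE) auto
    also have "\<dots> \<le> 2 * (\<integral>\<omega>. (g \<omega> - I (y n) \<omega>)\<^sup>2 \<partial>M) + 2 * (\<integral>\<omega>. (I (l - y n) \<omega>)\<^sup>2 \<partial>M)"
      by (rule tri[OF dL2 I_L2])
    finally show ?thesis using y[of n] by (simp add: I_norm norm_minus_commute)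
  qed
  moreover have "(\<lambda>n. 2 * (1 / real (Suc n)) + 2 * (norm (y n - l))\<^sup>2) \<longlonglongrightarrow> 2 * 0 + 2 * 0\<^sup>2"
    by (intro tendsto_intros LIMSEQ_Suc[OF lim_1_over_n] tendsto_norm_zero LIM_zero l)
  ultimately have "(\<integral>\<omega>. (g \<omega> - I l \<omega>)\<^sup>2 \<partial>M) \<le> 2 * 0 + 2 * 0\<^sup>2"
    by (intro LIMSEQ_le_const) auto
  moreover have "0 \<le> (\<integral>\<omega>. (g \<omega> - I l \<omega>)\<^sup>2 \<partial>M)" by simp
  ultimately have "(\<integral>\<omega>. (g \<omega> - I l \<omega>)\<^sup>2 \<partial>M) = 0" by simp
  then have "AE \<omega> in M. (g \<omega> - I l \<omega>)\<^sup>2 = 0"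
    using integral_nonneg_eq_0_iff_AE[OF L2D(2)[OF dL2, of l]] by simp
  then have "AE \<omega> in M. I l \<omega> = g \<omega>" by eventually_elim simp
  then show ?thesis by (rule that)
qed

end

section \<open>Stieltjes integrals of adapted processes\<close>

text \<open>
  The Stieltjes integral is treated as an integral against an atomless measure \<open>\<nu>\<close> with a bounded weight
  \<open>\<sigma>\<close>.
\<close>

locale process_integral = gaussian_process M T X + nu: atomless_measure \<nu>
  for M :: "'w measure" and T X and \<nu> +
  fixes \<sigma> :: "real \<Rightarrow> real"
  assumes sigma [measurable]: "\<sigma> \<in> borel_measurable borel" and sigma_le: "\<And>u. \<bar>\<sigma> u\<bar> \<le> 1"
begin

definition signed_integral :: "real \<Rightarrow> real \<Rightarrow> (real \<Rightarrow> real) \<Rightarrow> real" where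
  "signed_integral s t g = (LINT u:{s<..t}|\<nu>. g u * \<sigma> u)"

sublocale pair: pair_sigma_finite \<nu> M ..

end

lemma clip_process_measurable:
  assumes "measurable_process M T V" "0 < T"
  shows "(\<lambda>(u, \<omega>). V (clip T u) \<omega>) \<in> borel_measurable (borel \<Otimes>\<^sub>M M)"
proof -
  have c: "clip T \<in> measurable borel (restrict_space borel {0..T})"
    using assms(2) clip_in[of T] by (intro measurable_restrict_space2) (auto intro: borel_measurable_continuous_onI[OF continuous_on_clip])
  have "(\<lambda>(u, \<omega>). (clip T u, \<omega>)) \<in> measurable (borel \<Otimes>\<^sub>M M) (restrict_space borel {0..T} \<Otimes>\<^sub>M M)"
    using c by measurable
  from measurable_compose[OF this assms(1)[unfolded measurable_process_def]]
  show ?thesis by (simp add: case_prod_beta')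
qed

locale square_integrable_process = process_integral M T X \<nu> \<sigma>
  for M :: "'w measure" and T X \<nu> \<sigma> +
  fixes V :: "real \<Rightarrow> 'w \<Rightarrow> real"
  assumes process: "measurable_process M T V"
    and bounded: "(\<integral>\<^sup>+\<omega>. (\<integral>\<^sup>+u\<in>{0..T}. ennreal \<bar>V u \<omega>\<bar> \<partial>\<nu>)\<^sup>2 \<partial>M) < \<infinity>"
begin

text \<open>
  Extending the process constantly beyond \<open>[0,T]\<close> gives a jointly measurable function on the whole line.
\<close>

definition W :: "real \<Rightarrow> 'w \<Rightarrow> real" where "W u \<omega> = V (clip T u) \<omega>"

definition N :: "'w \<Rightarrow> ennreal" where "N \<omega> = (\<integral>\<^sup>+u\<in>{0..T}. ennreal \<bar>V u \<omega>\<bar> \<partial>\<nu>)"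

lemma W_measurable [measurable]: "(\<lambda>(u, \<omega>). W u \<omega>) \<in> borel_measurable (borel \<Otimes>\<^sub>M M)"
  unfolding W_def by (rule clip_process_measurable[OF process T_pos])

lemma W_measurable_M [measurable]: "(\<lambda>\<omega>. W u \<omega>) \<in> borel_measurable M"
  by measurable

lemma N_eq: "N \<omega> = (\<integral>\<^sup>+u. ennreal \<bar>W u \<omega>\<bar> * indicator {0..T} u \<partial>\<nu>)"
  unfolding N_def by (intro nn_integral_cong) (auto simp: indicator_def W_def clip_id)

lemma N_measurable [measurable]: "N \<in> borel_measurable M"
  unfolding N_eq[abs_def] by measurable

lemma N_square: "(\<integral>\<^sup>+\<omega>. (N \<omega>)\<^sup>2 \<partial>M) < \<infinity>"
  using bounded unfolding N_def .

lemma N_finite: "AE \<omega> in M. N \<omega> < \<infinity>"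
proof -
  have "AE \<omega> in M. (N \<omega>)\<^sup>2 \<noteq> \<infinity>"
    using N_square by (intro nn_integral_PInf_AE) auto
  then show ?thesis by eventually_elim (auto simp: less_top power_eq_top_ennreal)
qed

lemma W_integrable: "AE \<omega> in M. 0 \<le> s \<longrightarrow> t \<le> T \<longrightarrow> set_integrable \<nu> {s<..t} (\<lambda>u. W u \<omega>)"
  using N_finite AE_space
proof eventually_elim
  case (elim \<omega>)
  note [measurable] = measurable_Pair1[OF W_measurable elim(2), simplified]
  show ?case
  proof (intro impI)
    assume st: "0 \<le> s" "t \<le> T"
    show "set_integrable \<nu> {s<..t} (\<lambda>u. W u \<omega>)"
      unfolding set_integrable_def
    proof (rule integrableI_bounded)
      have "(\<integral>\<^sup>+u. ennreal (norm (indicator {s<..t} u *\<^sub>R W u \<omega>)) \<partial>\<nu>) \<le> N \<omega>"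
        unfolding N_eq using st by (intro nn_integral_mono) (auto simp: indicator_def)
      with elim(1) show "(\<integral>\<^sup>+u. ennreal (norm (indicator {s<..t} u *\<^sub>R W u \<omega>)) \<partial>\<nu>) < \<infinity>"
        by (rule le_less_trans[rotated])
    qed measurable
  qed
qed

lemma signed_integral_measurable: "(\<lambda>\<omega>. signed_integral s t (\<lambda>u. W u \<omega>)) \<in> borel_measurable M"
  unfolding signed_integral_def set_lebesgue_integral_def by measurable

lemma signed_integral_bound:
  assumes st: "0 \<le> s" "t \<le> T"
  shows "ennreal \<bar>signed_integral s t (\<lambda>u. W u \<omega>)\<bar> \<le> N \<omega>"
proof -
  let ?f = "\<lambda>u. indicator {s<..t} u *\<^sub>R (W u \<omega> * \<sigma> u)"
  have "ennreal \<bar>signed_integral s t (\<lambda>u. W u \<omega>)\<bar> \<le> (\<integral>\<^sup>+u. ennreal (norm (?f u)) \<partial>\<nu>)"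
  proof (cases "integrable \<nu> ?f")
    case True
    then show ?thesis
      unfolding signed_integral_def set_lebesgue_integral_def using integral_norm_bound_ennreal[OF True] by simp
  next
    case False
    then show ?thesis
      unfolding signed_integral_def set_lebesgue_integral_def by (simp add: not_integrable_integral_eq)
  qed
  also have "\<dots> \<le> N \<omega>"
    unfolding N_eq using st sigma_le
    by (intro nn_integral_mono) (auto simp: indicator_def abs_mult intro!: ennreal_leI mult_left_le)
  finally show ?thesis .
qed

lemma signed_integral_L2:
  assumes st: "0 \<le> s" "t \<le> T"
  shows "(\<lambda>\<omega>. signed_integral s t (\<lambda>u. W u \<omega>)) \<in> L2 M"
proof -
  let ?J = "\<lambda>\<omega>. signed_integral s t (\<lambda>u. W u \<omega>)"
  note [measurable] = signed_integral_measurable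
  have "integrable M (\<lambda>\<omega>. (?J \<omega>)\<^sup>2)"
  proof (rule integrableI_bounded)
    have "(\<integral>\<^sup>+\<omega>. ennreal (norm ((?J \<omega>)\<^sup>2)) \<partial>M) \<le> (\<integral>\<^sup>+\<omega>. (N \<omega>)\<^sup>2 \<partial>M)"
    proof (rule nn_integral_mono)
      fix \<omega>
      have "ennreal (norm ((?J \<omega>)\<^sup>2)) = (ennreal \<bar>?J \<omega>\<bar>)\<^sup>2" by (simp add: ennreal_power)
      also have "\<dots> \<le> (N \<omega>)\<^sup>2" by (intro power_mono signed_integral_bound st) auto
      finally show "ennreal (norm ((?J \<omega>)\<^sup>2)) \<le> (N \<omega>)\<^sup>2" .
    qed
    then show "(\<integral>\<^sup>+\<omega>. ennreal (norm ((?J \<omega>)\<^sup>2)) \<partial>M) < \<infinity>" using N_square by (rule le_less_trans)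
  qed measurable
  then show ?thesis by (simp add: L2_def)
qed

lemma Fubini_integrable_W:
  assumes w: "w \<in> L2 M" and st: "0 \<le> s" "t \<le> T" and h [measurable]: "h \<in> borel_measurable borel" and "\<And>u. \<bar>h u\<bar> \<le> 1"
  shows "integrable (\<nu> \<Otimes>\<^sub>M M) (\<lambda>(u, \<omega>). indicator {s<..t} u * (W u \<omega> * w \<omega>) * h u)"
proof (rule integrableI_bounded)
  note [measurable] = L2D(1)[OF w]
  show "(\<lambda>(u, \<omega>). indicator {s<..t} u * (W u \<omega> * w \<omega>) * h u) \<in> borel_measurable (\<nu> \<Otimes>\<^sub>M M)" by measurable
  have "(\<integral>\<^sup>+z. ennreal (norm (case z of (u, \<omega>) \<Rightarrow> indicator {s<..t} u * (W u \<omega> * w \<omega>) * h u)) \<partial>(\<nu> \<Otimes>\<^sub>M M)) =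
      (\<integral>\<^sup>+\<omega>. \<integral>\<^sup>+u. ennreal (norm (indicator {s<..t} u * (W u \<omega> * w \<omega>) * h u)) \<partial>\<nu> \<partial>M)"
    by (subst pair.nn_integral_snd[symmetric]) auto
  also have "\<dots> \<le> (\<integral>\<^sup>+\<omega>. \<integral>\<^sup>+u. ennreal \<bar>w \<omega>\<bar> * (ennreal \<bar>W u \<omega>\<bar> * indicator {0..T} u) \<partial>\<nu> \<partial>M)"
  proof (intro nn_integral_mono)
    fix u \<omega>
    have "\<bar>W u \<omega> * w \<omega> * h u\<bar> \<le> \<bar>w \<omega>\<bar> * \<bar>W u \<omega>\<bar>"
      using assms(5)[of u] by (simp add: abs_mult mult_left_le mult.commute[of "\<bar>w \<omega>\<bar>"])
    then show "ennreal (norm (indicator {s<..t} u * (W u \<omega> * w \<omega>) * h u)) \<le> ennreal \<bar>w \<omega>\<bar> * (ennreal \<bar>W u \<omega>\<bar> * indicator {0..T} u)"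
      using st by (auto simp: indicator_def ennreal_leI simp flip: ennreal_mult)
  qed
  also have "\<dots> = (\<integral>\<^sup>+\<omega>. ennreal \<bar>w \<omega>\<bar> * N \<omega> \<partial>M)"
    unfolding N_eq
  proof (intro nn_integral_cong)
    fix \<omega> assume "\<omega> \<in> space M"
    note [measurable] = measurable_Pair1[OF W_measurable this, simplified]
    show "(\<integral>\<^sup>+u. ennreal \<bar>w \<omega>\<bar> * (ennreal \<bar>W u \<omega>\<bar> * indicator {0..T} u) \<partial>\<nu>) = ennreal \<bar>w \<omega>\<bar> * (\<integral>\<^sup>+u. ennreal \<bar>W u \<omega>\<bar> * indicator {0..T} u \<partial>\<nu>)"
      by (intro nn_integral_cmult) measurable
  qed
  also have "\<dots> < \<infinity>"
  proof -
    have "(\<integral>\<^sup>+\<omega>. ennreal \<bar>w \<omega>\<bar> * N \<omega> \<partial>M)\<^sup>2 \<le> (\<integral>\<^sup>+\<omega>. (ennreal \<bar>w \<omega>\<bar>)\<^sup>2 \<partial>M) * (\<integral>\<^sup>+\<omega>. (N \<omega>)\<^sup>2 \<partial>M)"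
      by (rule Cauchy_Schwarz_nn_integral) measurable
    also have "(\<integral>\<^sup>+\<omega>. (ennreal \<bar>w \<omega>\<bar>)\<^sup>2 \<partial>M) = ennreal (\<integral>\<omega>. (w \<omega>)\<^sup>2 \<partial>M)"
      using nn_integral_eq_integral[OF L2D(2)[OF w]] by (simp add: ennreal_power)
    also have "\<dots> * (\<integral>\<^sup>+\<omega>. (N \<omega>)\<^sup>2 \<partial>M) < \<infinity>"
      using N_square by (simp add: ennreal_mult_less_top)
    finally show ?thesis by (simp add: power_eq_top_ennreal flip: less_top)
  qed
  finally show "(\<integral>\<^sup>+z. ennreal (norm (case z of (u, \<omega>) \<Rightarrow> indicator {s<..t} u * (W u \<omega> * w \<omega>) * h u)) \<partial>(\<nu> \<Otimes>\<^sub>M M)) < \<infinity>" .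
qed

lemma expectation_measurable:
  assumes w: "w \<in> L2 M"
  shows "(\<lambda>u. \<integral>\<omega>. W u \<omega> * w \<omega> \<partial>M) \<in> borel_measurable borel"
proof -
  note [measurable] = L2D(1)[OF w]
  show ?thesis by measurable
qed

lemma expectation_integrable:
  assumes w: "w \<in> L2 M" and st: "0 \<le> s" "t \<le> T"
  shows "set_integrable \<nu> {s<..t} (\<lambda>u. \<integral>\<omega>. W u \<omega> * w \<omega> \<partial>M)"
  using pair.integrable_fst'[OF Fubini_integrable_W[OF w st, of "\<lambda>_. 1"]]
  by (simp add: set_integrable_def)

lemma expectation_signed_integral:
  assumes w: "w \<in> L2 M" and st: "0 \<le> s" "t \<le> T"
  shows "(\<integral>\<omega>. signed_integral s t (\<lambda>u. W u \<omega>) * w \<omega> \<partial>M) = signed_integral s t (\<lambda>u. \<integral>\<omega>. W u \<omega> * w \<omega> \<partial>M)"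
proof -
  let ?f = "\<lambda>u \<omega>. indicator {s<..t} u * (W u \<omega> * w \<omega>) * \<sigma> u"
  have "(\<integral>\<omega>. signed_integral s t (\<lambda>u. W u \<omega>) * w \<omega> \<partial>M) = (\<integral>\<omega>. \<integral>u. ?f u \<omega> \<partial>\<nu> \<partial>M)"
    unfolding signed_integral_def set_lebesgue_integral_def integral_mult_left_zero[symmetric]
    by (intro Bochner_Integration.integral_cong) auto
  also have "\<dots> = (\<integral>u. \<integral>\<omega>. ?f u \<omega> \<partial>M \<partial>\<nu>)"
    by (rule pair.Fubini_integral[OF Fubini_integrable_W[OF w st sigma sigma_le]])
  also have "\<dots> = signed_integral s t (\<lambda>u. \<integral>\<omega>. W u \<omega> * w \<omega> \<partial>M)"
    unfolding signed_integral_def set_lebesgue_integral_def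
  proof (intro Bochner_Integration.integral_cong refl)
    fix u
    have "(\<integral>\<omega>. ?f u \<omega> \<partial>M) = (\<integral>\<omega>. indicator {s<..t} u * (W u \<omega> * w \<omega>) \<partial>M) * \<sigma> u"
      by (rule integral_mult_left_zero)
    then show "(\<integral>\<omega>. ?f u \<omega> \<partial>M) = indicator {s<..t} u *\<^sub>R ((\<integral>\<omega>. W u \<omega> * w \<omega> \<partial>M) * \<sigma> u)"
      by simp
  qed
  finally show ?thesis .
qed

lemma signed_integral_cong_AE:
  assumes "f \<in> borel_measurable borel" "g \<in> borel_measurable borel"
    and "AE u in \<nu>. s < u \<longrightarrow> u \<le> t \<longrightarrow> f u = g u"
  shows "signed_integral s t f = signed_integral s t g"
  unfolding signed_integral_def set_lebesgue_integral_def
proof (rule integral_cong_AE)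
  note [measurable] = assms(1,2)
  show "(\<lambda>u. indicator {s<..t} u *\<^sub>R (f u * \<sigma> u)) \<in> borel_measurable \<nu>"
    "(\<lambda>u. indicator {s<..t} u *\<^sub>R (g u * \<sigma> u)) \<in> borel_measurable \<nu>" by measurable
  show "AE u in \<nu>. indicator {s<..t} u *\<^sub>R (f u * \<sigma> u) = indicator {s<..t} u *\<^sub>R (g u * \<sigma> u)"
    using assms(3) by eventually_elim (auto simp: indicator_def)
qed

text \<open>
  Measurability of the integral with respect to the past cannot be read off from that of the
  integrands at single times.  By Fubini the integral has the same expectation against an event as
  against the conditional probability of that event, so it agrees almost surely with its conditional
  expectation.
\<close>

lemma signed_integral_adapted:
  assumes st: "0 \<le> s" "t \<le> r" "r \<le> T" and adapted: "\<And>u. s < u \<Longrightarrow> u \<le> t \<Longrightarrow> V u \<in> borel_measurable (filtr M X r)"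
  shows "(\<lambda>\<omega>. signed_integral s t (\<lambda>u. W u \<omega>)) \<in> borel_measurable (filtr M X r)"
proof -
  let ?J = "\<lambda>\<omega>. signed_integral s t (\<lambda>u. W u \<omega>)"
  let ?F = "filtr M X r"
  have t: "t \<le> T" using st by simp
  interpret S: finite_measure_subalgebra M ?F
    by unfold_locales (rule subalgebra_filtr[OF st(3)])
  have J: "?J \<in> L2 M" by (rule signed_integral_L2[OF st(1) t])
  have J_int: "integrable M ?J" by (rule L2_integrable[OF J])
  have WF: "(\<lambda>\<omega>. W u \<omega>) \<in> borel_measurable ?F" if "s < u" "u \<le> t" for u
    using adapted[OF that] that st by (simp add: W_def[abs_def] clip_id)
  have W_int: "AE u in \<nu>. s < u \<longrightarrow> u \<le> t \<longrightarrow> integrable M (\<lambda>\<omega>. W u \<omega>)"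
  proof -
    have "(\<lambda>_. 1) \<in> L2 M" by (simp add: L2_def)
    from pair.AE_integrable_fst'[OF Fubini_integrable_W[OF this st(1) t, of "\<lambda>_. 1"]]
    have "AE u in \<nu>. integrable M (\<lambda>\<omega>. indicator {s<..t} u * W u \<omega>)" by simp
    then show ?thesis by eventually_elim (auto simp: indicator_def)
  qed
  have "AE \<omega> in M. ?J \<omega> = real_cond_exp M ?F ?J \<omega>"
  proof (rule density_unique_real[OF J_int])
    show "integrable M (real_cond_exp M ?F ?J)" using J_int by (rule S.real_cond_exp_int)
    fix A assume A [measurable]: "A \<in> sets M"
    let ?a = "indicator A :: 'w \<Rightarrow> real"
    have a_int: "integrable M ?a" by (intro integrable_const_bound[of _ 1]) (auto simp: indicator_def)
    have aL2: "?a \<in> L2 M" 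
    proof -
      have "(\<lambda>\<omega>. (?a \<omega>)\<^sup>2) = ?a" by (auto simp: indicator_def)
      then show ?thesis using a_int by (simp add: L2_def)
    qed
    \<comment> \<open>a bounded version of the conditional probability of \<open>A\<close>, which is therefore square integrable\<close>
    define c where "c \<omega> = max 0 (min 1 (real_cond_exp M ?F ?a \<omega>))" for \<omega>
    have cF: "c \<in> borel_measurable ?F" unfolding c_def by measurable
    have c_le: "0 \<le> c \<omega>" "c \<omega> \<le> 1" for \<omega> by (auto simp: c_def)
    have cM [measurable]: "c \<in> borel_measurable M" by (rule filtr_measurable[OF st(3) cF])
    have cL2: "c \<in> L2 M"
    proof -
      have "integrable M (\<lambda>\<omega>. (c \<omega>)\<^sup>2)"
        using c_le by (intro integrable_const_bound[of _ 1]) (auto simp: power_le_one)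
      then show ?thesis by (simp add: L2_def)
    qed
    have c_eq: "AE \<omega> in M. real_cond_exp M ?F ?a \<omega> = c \<omega>"
    proof -
      have "AE \<omega> in M. 0 \<le> real_cond_exp M ?F ?a \<omega>"
        by (rule S.real_cond_exp_ge_c[OF a_int]) simp
      moreover have "AE \<omega> in M. real_cond_exp M ?F ?a \<omega> \<le> 1"
        by (rule S.real_cond_exp_le_c[OF a_int]) (simp add: indicator_def)
      ultimately show ?thesis by eventually_elim (simp add: c_def)
    qed
    have cond: "(\<integral>\<omega>. f \<omega> * ?a \<omega> \<partial>M) = (\<integral>\<omega>. f \<omega> * c \<omega> \<partial>M)"
      if f: "f \<in> borel_measurable ?F" "integrable M f" for f
    proof -
      have [measurable]: "f \<in> borel_measurable M" using f by simp
      have "integrable M (\<lambda>\<omega>. f \<omega> * ?a \<omega>)"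
        by (rule integrable_real_mult_indicator[OF A f(2)])
      from S.real_cond_exp_intg(2)[OF this f(1)]
      have "(\<integral>\<omega>. f \<omega> * ?a \<omega> \<partial>M) = (\<integral>\<omega>. f \<omega> * real_cond_exp M ?F ?a \<omega> \<partial>M)" by simp
      also have "\<dots> = (\<integral>\<omega>. f \<omega> * c \<omega> \<partial>M)"
        using c_eq by (intro integral_cong_AE) auto
      finally show ?thesis .
    qed
    have "(LINT \<omega>:A|M. ?J \<omega>) = (\<integral>\<omega>. ?J \<omega> * ?a \<omega> \<partial>M)"
      by (simp add: set_lebesgue_integral_def mult.commute)
    also have "\<dots> = signed_integral s t (\<lambda>u. \<integral>\<omega>. W u \<omega> * ?a \<omega> \<partial>M)"
      by (rule expectation_signed_integral[OF aL2 st(1) t])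
    also have "\<dots> = signed_integral s t (\<lambda>u. \<integral>\<omega>. W u \<omega> * c \<omega> \<partial>M)"
    proof (rule signed_integral_cong_AE[OF expectation_measurable[OF aL2] expectation_measurable[OF cL2]])
      show "AE u in \<nu>. s < u \<longrightarrow> u \<le> t \<longrightarrow> (\<integral>\<omega>. W u \<omega> * ?a \<omega> \<partial>M) = (\<integral>\<omega>. W u \<omega> * c \<omega> \<partial>M)"
        using W_int by eventually_elim (use cond WF in blast)
    qed
    also have "\<dots> = (\<integral>\<omega>. ?J \<omega> * c \<omega> \<partial>M)"
      by (rule expectation_signed_integral[OF cL2 st(1) t, symmetric])
    also have "\<dots> = (\<integral>\<omega>. c \<omega> * ?J \<omega> \<partial>M)" by (simp add: mult.commute)
    also have "\<dots> = (\<integral>\<omega>. c \<omega> * real_cond_exp M ?F ?J \<omega> \<partial>M)"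
      by (rule S.real_cond_exp_intg(2)[symmetric, OF L2_mult_integrable[OF cL2 J] cF]) (use J_int in auto)
    also have "\<dots> = (\<integral>\<omega>. real_cond_exp M ?F ?J \<omega> * c \<omega> \<partial>M)" by (simp add: mult.commute)
    also have "\<dots> = (\<integral>\<omega>. real_cond_exp M ?F ?J \<omega> * ?a \<omega> \<partial>M)"
      by (rule cond[symmetric]) (use S.real_cond_exp_int(1)[OF J_int] in auto)
    also have "\<dots> = (LINT \<omega>:A|M. real_cond_exp M ?F ?J \<omega>)"
      by (simp add: set_lebesgue_integral_def mult.commute)
    finally show "(LINT \<omega>:A|M. ?J \<omega>) = (LINT \<omega>:A|M. real_cond_exp M ?F ?J \<omega>)" .
  qed
  then have "AE \<omega> in M. real_cond_exp M ?F ?J \<omega> = ?J \<omega>" by eventually_elim simp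
  then show ?thesis by (rule filtr_measurable_AE_cong[rotated]) simp
qed

end

text \<open>
  A density of \<open>d\<gamma>\<close> against the variation measure, chosen once so that the integrals of different
  processes share it.
\<close>

definition stieltjes_sign :: "real \<Rightarrow> (real \<Rightarrow> real) \<Rightarrow> real \<Rightarrow> real" where
  "stieltjes_sign T \<gamma> = (SOME \<sigma>. \<sigma> \<in> borel_measurable borel \<and> (\<forall>u. \<bar>\<sigma> u\<bar> \<le> 1) \<and>
     (\<forall>s t g. g \<in> borel_measurable borel \<longrightarrow> set_integrable (variation_measure T \<gamma>) {s<..t} g \<longrightarrow>
        stieltjes_integral T \<gamma> s t g = (LINT u:{s<..t}|variation_measure T \<gamma>. g u * \<sigma> u)))"

lemma (in bounded_variation) stieltjes_sign:
  shows "stieltjes_sign T \<gamma> \<in> borel_measurable borel" "\<bar>stieltjes_sign T \<gamma> u\<bar> \<le> 1"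
    and "k \<in> borel_measurable borel \<Longrightarrow> set_integrable (variation_measure T \<gamma>) {s<..t} k \<Longrightarrow>
      stieltjes_integral T \<gamma> s t k = (LINT u:{s<..t}|variation_measure T \<gamma>. k u * stieltjes_sign T \<gamma> u)"
proof -
  have "\<exists>\<sigma>. \<sigma> \<in> borel_measurable borel \<and> (\<forall>u. \<bar>\<sigma> u\<bar> \<le> 1) \<and>
     (\<forall>s t g. g \<in> borel_measurable borel \<longrightarrow> set_integrable (variation_measure T \<gamma>) {s<..t} g \<longrightarrow>
        stieltjes_integral T \<gamma> s t g = (LINT u:{s<..t}|variation_measure T \<gamma>. g u * \<sigma> u))"
    by (rule stieltjes_density) blast
  from someI_ex[OF this, folded stieltjes_sign_def]
  show "stieltjes_sign T \<gamma> \<in> borel_measurable borel" "\<bar>stieltjes_sign T \<gamma> u\<bar> \<le> 1"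
    and "k \<in> borel_measurable borel \<Longrightarrow> set_integrable (variation_measure T \<gamma>) {s<..t} k \<Longrightarrow>
      stieltjes_integral T \<gamma> s t k = (LINT u:{s<..t}|variation_measure T \<gamma>. k u * stieltjes_sign T \<gamma> u)"
    by blast+
qed

lemma (in bounded_variation) atomless_variation_measure: "atomless_measure (variation_measure T \<gamma>)"
proof -
  interpret finite_measure "variation_measure T \<gamma>" by (rule finite_stieltjes)
  show ?thesis by unfold_locales (simp_all add: variation_measure_singleton)
qed

lemma stieltjes_integral_cong:
  assumes "\<And>u. s < u \<Longrightarrow> u \<le> t \<Longrightarrow> g u = h u"
  shows "stieltjes_integral T \<gamma> s t g = stieltjes_integral T \<gamma> s t h"
  unfolding stieltjes_integral_def set_lebesgue_integral_def
  using assms by (intro arg_cong2[of _ _ _ _ "(-)"] Bochner_Integration.integral_cong refl) (auto simp: indicator_def)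

locale stieltjes_process = bv: bounded_variation T \<gamma> + gaussian_process M T X
  for M :: "'w measure" and T X \<gamma> +
  fixes V :: "real \<Rightarrow> 'w \<Rightarrow> real"
  assumes process: "measurable_process M T V"
    and bounded: "(\<integral>\<^sup>+\<omega>. (\<integral>\<^sup>+u\<in>{0..T}. ennreal \<bar>V u \<omega>\<bar> \<partial>variation_measure T \<gamma>)\<^sup>2 \<partial>M) < \<infinity>"

sublocale stieltjes_process \<subseteq> sq: square_integrable_process M T X "variation_measure T \<gamma>" "stieltjes_sign T \<gamma>" V
proof -
  interpret nu: atomless_measure "variation_measure T \<gamma>" by (rule bv.atomless_variation_measure)
  show "square_integrable_process M T X (variation_measure T \<gamma>) (stieltjes_sign T \<gamma>) V"
    by unfold_locales (simp_all add: bv.stieltjes_sign process bounded[simplified])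
qed

context stieltjes_process
begin

text \<open>
  The weighted form is available for every path that is integrable against the variation of \<open>\<gamma>\<close>, and
  almost all paths are.
\<close>

lemma stieltjes_eq:
  assumes st: "0 \<le> s" "t \<le> T"
  shows "AE \<omega> in M. stieltjes_integral T \<gamma> s t (\<lambda>u. V u \<omega>) = sq.signed_integral s t (\<lambda>u. sq.W u \<omega>)"
  using sq.W_integrable[of s t] AE_space
proof eventually_elim
  case (elim \<omega>)
  have "stieltjes_integral T \<gamma> s t (\<lambda>u. V u \<omega>) = stieltjes_integral T \<gamma> s t (\<lambda>u. sq.W u \<omega>)"
    using st by (intro stieltjes_integral_cong) (simp add: sq.W_def clip_id)
  also have "\<dots> = sq.signed_integral s t (\<lambda>u. sq.W u \<omega>)"
    unfolding sq.signed_integral_def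
    using elim st measurable_Pair1[OF sq.W_measurable elim(2)] by (intro bv.stieltjes_sign(3)) auto
  finally show ?case .
qed

lemma stieltjes_measurable:
  assumes st: "0 \<le> s" "t \<le> r" "r \<le> T" and adapted: "\<And>u. u \<in> {s<..t} \<Longrightarrow> V u \<in> borel_measurable (filtr M X r)"
  shows "(\<lambda>\<omega>. stieltjes_integral T \<gamma> s t (\<lambda>u. V u \<omega>)) \<in> borel_measurable (filtr M X r)"
proof (rule filtr_measurable_AE_cong)
  show "(\<lambda>\<omega>. sq.signed_integral s t (\<lambda>u. sq.W u \<omega>)) \<in> borel_measurable (filtr M X r)"
    using st adapted by (intro sq.signed_integral_adapted) auto
  show "AE \<omega> in M. sq.signed_integral s t (\<lambda>u. sq.W u \<omega>) = stieltjes_integral T \<gamma> s t (\<lambda>u. V u \<omega>)"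
    using stieltjes_eq[of s t] st by (auto elim: eventually_mono)
qed

lemma stieltjes_L2:
  assumes st: "0 \<le> s" "t \<le> T"
  shows "(\<lambda>\<omega>. stieltjes_integral T \<gamma> s t (\<lambda>u. V u \<omega>)) \<in> L2 M"
proof (rule L2_cong_AE[OF sq.signed_integral_L2[OF st]])
  have *: "AE \<omega> in M. sq.signed_integral s t (\<lambda>u. sq.W u \<omega>) = stieltjes_integral T \<gamma> s t (\<lambda>u. V u \<omega>)"
    using stieltjes_eq[OF st] by (auto elim: eventually_mono)
  show "(\<lambda>\<omega>. stieltjes_integral T \<gamma> s t (\<lambda>u. V u \<omega>)) \<in> borel_measurable M"
    by (rule borel_measurable_AE_cong_complete[OF complete _ _ sq.signed_integral_measurable *])
      (auto simp: null_sets_def)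
  show "AE \<omega> in M. sq.signed_integral s t (\<lambda>u. sq.W u \<omega>) = stieltjes_integral T \<gamma> s t (\<lambda>u. V u \<omega>)" by (rule *)
qed

lemma expectation_stieltjes:
  assumes st: "0 \<le> s" "t \<le> T" and w: "w \<in> L2 M"
  shows "(\<integral>\<omega>. stieltjes_integral T \<gamma> s t (\<lambda>u. V u \<omega>) * w \<omega> \<partial>M) = sq.signed_integral s t (\<lambda>u. \<integral>\<omega>. sq.W u \<omega> * w \<omega> \<partial>M)"
proof -
  note [measurable] = L2D(1)[OF stieltjes_L2[OF st]] L2D(1)[OF w] sq.signed_integral_measurable
  have "(\<integral>\<omega>. stieltjes_integral T \<gamma> s t (\<lambda>u. V u \<omega>) * w \<omega> \<partial>M) = (\<integral>\<omega>. sq.signed_integral s t (\<lambda>u. sq.W u \<omega>) * w \<omega> \<partial>M)"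
    using stieltjes_eq[OF st] by (intro integral_cong_AE) auto
  then show ?thesis unfolding sq.expectation_signed_integral[OF w st] .
qed

end

section \<open>Random variables with values in a Hilbert space\<close>

definition tensor_map :: "('h \<Rightarrow> 'h2) \<Rightarrow> (('w \<Rightarrow> real) \<times> 'h) list \<Rightarrow> (('w \<Rightarrow> real) \<times> 'h2) list" where
  "tensor_map P ps = map (\<lambda>(\<xi>, k). (\<xi>, P k)) ps"

lemma tensor_sum_simps [simp]:
  "tensor_sum [] \<omega> = 0" "tensor_sum ((\<xi>, k) # ps) \<omega> = \<xi> \<omega> *\<^sub>R k + tensor_sum ps \<omega>"
  by (simp_all add: tensor_sum_def)

lemma tensor_sum_map:
  assumes "linear P"
  shows "tensor_sum (tensor_map P ps) \<omega> = P (tensor_sum ps \<omega>)"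
proof -
  interpret linear P by fact
  show ?thesis by (induction ps) (auto simp: tensor_map_def zero add scale)
qed

lemma fst_tensor_map [simp]: "fst ` set (tensor_map P ps) = fst ` set ps"
  by (force simp: tensor_map_def image_image split_beta)

lemma tensor_sum_append: "tensor_sum (ps @ qs) \<omega> = tensor_sum ps \<omega> + tensor_sum qs \<omega>"
  by (simp add: tensor_sum_def)

context gaussian_process
begin

text \<open>
  Almost sure limits stay measurable because the \<open>\<sigma>\<close>-algebra contains the null sets of a complete measure.
\<close>

lemma measurable_AE_limit:
  fixes f :: "nat \<Rightarrow> 'w \<Rightarrow> real"
  assumes F: "space F = space M" "null_sets M \<subseteq> sets F"
    and f: "\<And>n. f n \<in> borel_measurable F" and lim: "AE \<omega> in M. (\<lambda>n. f n \<omega>) \<longlonglongrightarrow> g \<omega>"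
  shows "g \<in> borel_measurable F"
proof (rule borel_measurable_AE_cong_complete[OF complete F])
  show "(\<lambda>\<omega>. lim (\<lambda>n. f n \<omega>)) \<in> borel_measurable F"
    using f by (rule borel_measurable_lim_metric)
  show "AE \<omega> in M. lim (\<lambda>n. f n \<omega>) = g \<omega>"
    using lim by eventually_elim (rule limI)
qed

lemma tensor_sum_inner_L2X:
  assumes "fst ` set ps \<subseteq> L2X M T X"
  shows "(\<lambda>\<omega>. inner (tensor_sum ps \<omega>) u) \<in> L2X M T X"
  using assms
proof (induction ps)
  case Nil
  then show ?case by (simp add: L2X_iff L2_def)
next
  case (Cons p ps)
  obtain \<xi> k where p: "p = (\<xi>, k)" by force
  have "\<xi> \<in> L2X M T X" "(\<lambda>\<omega>. inner (tensor_sum ps \<omega>) u) \<in> L2X M T X" using Cons p by auto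
  then have "(\<lambda>\<omega>. inner k u * \<xi> \<omega> + inner (tensor_sum ps \<omega>) u) \<in> L2X M T X"
    by (auto simp: L2X_iff intro!: L2_add L2_scale borel_measurable_add borel_measurable_times)
  then show ?case by (simp add: p inner_simps mult.commute)
qed

lemma tensor_sum_norm_L2:
  fixes ps :: "(('w \<Rightarrow> real) \<times> 'h::real_inner) list"
  assumes "fst ` set ps \<subseteq> L2X M T X"
  shows "(\<lambda>\<omega>. norm (tensor_sum ps \<omega>)) \<in> L2 M"
proof -
  have *: "integrable M (\<lambda>\<omega>. inner (tensor_sum qs \<omega>) (tensor_sum ps \<omega>))" if "fst ` set qs \<subseteq> L2X M T X" for qs
    using that
  proof (induction qs)
    case (Cons q qs)
    obtain \<xi> k where q: "q = (\<xi>, k)" by force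
    have "\<xi> \<in> L2 M" using Cons q L2XD by auto
    moreover have "(\<lambda>\<omega>. inner (tensor_sum ps \<omega>) k) \<in> L2 M" using L2XD[OF tensor_sum_inner_L2X[OF assms]] .
    ultimately have "integrable M (\<lambda>\<omega>. \<xi> \<omega> * inner (tensor_sum ps \<omega>) k)" by (rule L2_mult_integrable)
    then show ?case using Cons by (simp add: q inner_simps inner_commute[of k])
  qed simp
  from *[OF assms] have int: "integrable M (\<lambda>\<omega>. (norm (tensor_sum ps \<omega>))\<^sup>2)"
    by (simp add: power2_norm_eq_inner)
  then have "(\<lambda>\<omega>. sqrt ((norm (tensor_sum ps \<omega>))\<^sup>2)) \<in> borel_measurable M" by measurable
  with int show ?thesis by (simp add: L2_def)
qed

lemma tensor_approx_AE_subseq: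
  assumes "tensor_approx M T X Z ps"
  obtains r where "AE \<omega> in M. (\<lambda>n. tensor_sum (ps (r n)) \<omega>) \<longlonglongrightarrow> Z \<omega>"
proof -
  let ?D = "\<lambda>n \<omega>. norm (Z \<omega> - tensor_sum (ps n) \<omega>)"
  have [measurable]: "?D n \<in> borel_measurable M" for n using assms by (simp add: tensor_approx_def)
  have lim: "(\<lambda>n. \<integral>\<^sup>+\<omega>. ennreal ((?D n \<omega>)\<^sup>2) \<partial>M) \<longlonglongrightarrow> 0" using assms by (simp add: tensor_approx_def)
  then have "\<forall>\<^sub>F n in sequentially. (\<integral>\<^sup>+\<omega>. ennreal ((?D n \<omega>)\<^sup>2) \<partial>M) < 1"
    by (rule order_tendstoD) simp
  then obtain N where N: "\<And>n. N \<le> n \<Longrightarrow> (\<integral>\<^sup>+\<omega>. ennreal ((?D n \<omega>)\<^sup>2) \<partial>M) < 1"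
    by (auto simp: eventually_sequentially)
  have int: "integrable M (\<lambda>\<omega>. (?D (n + N) \<omega>)\<^sup>2)" for n
  proof (rule integrableI_bounded)
    have "(\<integral>\<^sup>+\<omega>. ennreal (norm ((?D (n + N) \<omega>)\<^sup>2)) \<partial>M) < 1" using N[of "n + N"] by simp
    also have "(1::ennreal) < \<infinity>" by simp
    finally show "(\<integral>\<^sup>+\<omega>. ennreal (norm ((?D (n + N) \<omega>)\<^sup>2)) \<partial>M) < \<infinity>" .
  qed measurable
  have "(\<lambda>n. \<integral>\<omega>. norm ((?D (n + N) \<omega>)\<^sup>2) \<partial>M) \<longlonglongrightarrow> 0"
  proof -
    have "(\<lambda>n. ennreal (\<integral>\<omega>. norm ((?D (n + N) \<omega>)\<^sup>2) \<partial>M)) \<longlonglongrightarrow> ennreal 0"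
      using LIMSEQ_ignore_initial_segment[OF lim, of N] int by (simp add: nn_integral_eq_integral)
    then show ?thesis by (subst (asm) tendsto_ennreal_iff) auto
  qed
  from tendsto_L1_AE_subseq[OF int this]
  obtain r where "AE \<omega> in M. (\<lambda>n. (?D (r n + N) \<omega>)\<^sup>2) \<longlonglongrightarrow> 0" by blast
  then have "AE \<omega> in M. (\<lambda>n. tensor_sum (ps (r n + N)) \<omega>) \<longlonglongrightarrow> Z \<omega>"
  proof eventually_elim
    case (elim \<omega>)
    then have "(\<lambda>n. ?D (r n + N) \<omega>) \<longlonglongrightarrow> 0" using tendsto_real_sqrt[OF elim] by simp
    then have "(\<lambda>n. Z \<omega> - tensor_sum (ps (r n + N)) \<omega>) \<longlonglongrightarrow> 0"
      by (simp only: tendsto_norm_zero_iff)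
    from tendsto_diff[OF tendsto_const[of "Z \<omega>"] this] show ?case by simp
  qed
  then show ?thesis by (rule that)
qed

lemma tensor_approx_L2:
  assumes "tensor_approx M T X Z ps"
  obtains N where "(\<lambda>\<omega>. norm (Z \<omega> - tensor_sum (ps N) \<omega>)) \<in> L2 M"
proof -
  let ?D = "\<lambda>n \<omega>. norm (Z \<omega> - tensor_sum (ps n) \<omega>)"
  have D [measurable]: "?D n \<in> borel_measurable M" for n using assms by (simp add: tensor_approx_def)
  have "(\<lambda>n. \<integral>\<^sup>+\<omega>. ennreal ((?D n \<omega>)\<^sup>2) \<partial>M) \<longlonglongrightarrow> 0" using assms by (simp add: tensor_approx_def)
  then have "\<forall>\<^sub>F n in sequentially. (\<integral>\<^sup>+\<omega>. ennreal ((?D n \<omega>)\<^sup>2) \<partial>M) < \<infinity>"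
    by (rule order_tendstoD) simp
  then obtain N where "(\<integral>\<^sup>+\<omega>. ennreal ((?D N \<omega>)\<^sup>2) \<partial>M) < \<infinity>"
    by (auto simp: eventually_sequentially)
  then have "integrable M (\<lambda>\<omega>. (?D N \<omega>)\<^sup>2)" by (intro integrableI_bounded) auto
  then show ?thesis using D[of N] by (intro that[of N]) (simp add: L2_def)
qed

lemma L2H_inner_L2X:
  assumes Z: "Z \<in> L2H M T X"
  shows "(\<lambda>\<omega>. inner (Z \<omega>) u) \<in> L2X M T X"
proof -
  obtain ps where ps: "tensor_approx M T X Z ps" using Z by (auto simp: L2H_def)
  have L2X: "fst ` set (ps n) \<subseteq> L2X M T X" for n using ps by (simp add: tensor_approx_def)
  obtain r where r: "AE \<omega> in M. (\<lambda>n. tensor_sum (ps (r n)) \<omega>) \<longlonglongrightarrow> Z \<omega>"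
    using tensor_approx_AE_subseq[OF ps] .
  have meas: "(\<lambda>\<omega>. inner (Z \<omega>) u) \<in> borel_measurable (filtr M X T)"
  proof (rule measurable_AE_limit[OF space_filtr null_sets_filtr])
    show "(\<lambda>\<omega>. inner (tensor_sum (ps (r n)) \<omega>) u) \<in> borel_measurable (filtr M X T)" for n
      using tensor_sum_inner_L2X[OF L2X] by (simp add: L2X_iff)
    show "AE \<omega> in M. (\<lambda>n. inner (tensor_sum (ps (r n)) \<omega>) u) \<longlonglongrightarrow> inner (Z \<omega>) u"
      using r by eventually_elim (intro tendsto_intros)
  qed
  obtain N where N: "(\<lambda>\<omega>. norm (Z \<omega> - tensor_sum (ps N) \<omega>)) \<in> L2 M" using tensor_approx_L2[OF ps] .
  let ?b = "\<lambda>\<omega>. norm u * norm (Z \<omega> - tensor_sum (ps N) \<omega>) + \<bar>inner (tensor_sum (ps N) \<omega>) u\<bar>"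
  have "(\<lambda>\<omega>. \<bar>inner (tensor_sum (ps N) \<omega>) u\<bar>) \<in> L2 M"
    using L2XD[OF tensor_sum_inner_L2X[OF L2X[of N]], of u] by (auto simp: L2_def)
  then have b: "?b \<in> L2 M" by (intro L2_add L2_scale N)
  have "integrable M (\<lambda>\<omega>. (inner (Z \<omega>) u)\<^sup>2)"
  proof (rule Bochner_Integration.integrable_bound[OF L2D(2)[OF b]])
    show "(\<lambda>\<omega>. (inner (Z \<omega>) u)\<^sup>2) \<in> borel_measurable M"
      using filtr_measurable[OF order_refl meas] by measurable
    show "AE \<omega> in M. norm ((inner (Z \<omega>) u)\<^sup>2) \<le> norm ((?b \<omega>)\<^sup>2)"
    proof (rule AE_I2)
      fix \<omega>
      have "inner (Z \<omega>) u = inner (Z \<omega> - tensor_sum (ps N) \<omega>) u + inner (tensor_sum (ps N) \<omega>) u"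
        by (simp add: inner_simps)
      moreover have "\<bar>inner (Z \<omega> - tensor_sum (ps N) \<omega>) u\<bar> \<le> norm u * norm (Z \<omega> - tensor_sum (ps N) \<omega>)"
        by (metis Cauchy_Schwarz_ineq2 mult.commute)
      ultimately have "\<bar>inner (Z \<omega>) u\<bar> \<le> ?b \<omega>" by linarith
      then show "norm ((inner (Z \<omega>) u)\<^sup>2) \<le> norm ((?b \<omega>)\<^sup>2)"
        using power_mono[of "\<bar>inner (Z \<omega>) u\<bar>" "?b \<omega>" 2] by simp
    qed
  qed
  then show ?thesis using meas by (simp add: L2X_def)
qed

text \<open>
  Measurability of the new distances is the point: they are almost sure limits of norms of tensors.
\<close>

lemma tensor_approx_map:
  assumes ps: "tensor_approx M T X Z ps" and P: "bounded_linear P"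
  shows "tensor_approx M T X (\<lambda>\<omega>. P (Z \<omega>)) (\<lambda>n. tensor_map P (ps n))"
proof -
  interpret P: bounded_linear P by fact
  have L2X: "fst ` set (ps n) \<subseteq> L2X M T X" for n using ps by (simp add: tensor_approx_def)
  obtain r where r: "AE \<omega> in M. (\<lambda>n. tensor_sum (ps (r n)) \<omega>) \<longlonglongrightarrow> Z \<omega>"
    using tensor_approx_AE_subseq[OF ps] .
  have ts: "tensor_sum (tensor_map P (ps n)) \<omega> = P (tensor_sum (ps n) \<omega>)" for n \<omega>
    by (rule tensor_sum_map[OF P.linear_axioms])
  have meas: "(\<lambda>\<omega>. norm (P (Z \<omega>) - P (tensor_sum (ps n) \<omega>))) \<in> borel_measurable M" for n
  proof (rule measurable_AE_limit[of M])
    have "(\<lambda>\<omega>. norm (tensor_sum (tensor_map P (ps (r m)) @ tensor_map (\<lambda>k. - P k) (ps n)) \<omega>)) \<in> borel_measurable M" for m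
      using L2X by (intro L2D(1) tensor_sum_norm_L2) (auto simp: image_Un)
    moreover have "linear (\<lambda>k. - P k)" using P.linear_axioms by (rule linear_compose_neg)
    ultimately show "(\<lambda>\<omega>. norm (P (tensor_sum (ps (r m)) \<omega>) - P (tensor_sum (ps n) \<omega>))) \<in> borel_measurable M" for m
      by (simp add: tensor_sum_append ts tensor_sum_map)
    show "AE \<omega> in M. (\<lambda>m. norm (P (tensor_sum (ps (r m)) \<omega>) - P (tensor_sum (ps n) \<omega>)))
        \<longlonglongrightarrow> norm (P (Z \<omega>) - P (tensor_sum (ps n) \<omega>))"
      using r by eventually_elim (intro tendsto_intros P.tendsto)
  qed (auto simp: null_sets_def)
  obtain K where K: "\<And>x. norm (P x) \<le> norm x * K" "0 < K" using P.pos_bounded by blast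
  have [measurable]: "(\<lambda>\<omega>. norm (Z \<omega> - tensor_sum (ps n) \<omega>)) \<in> borel_measurable M" for n
    using ps by (simp add: tensor_approx_def)
  have le: "(\<integral>\<^sup>+\<omega>. ennreal ((norm (P (Z \<omega>) - P (tensor_sum (ps n) \<omega>)))\<^sup>2) \<partial>M)
      \<le> ennreal (K\<^sup>2) * (\<integral>\<^sup>+\<omega>. ennreal ((norm (Z \<omega> - tensor_sum (ps n) \<omega>))\<^sup>2) \<partial>M)" for n
  proof -
    have "(norm (P (Z \<omega>) - P (tensor_sum (ps n) \<omega>)))\<^sup>2 \<le> K\<^sup>2 * (norm (Z \<omega> - tensor_sum (ps n) \<omega>))\<^sup>2" for \<omega>
      using power_mono[OF K(1)[of "Z \<omega> - tensor_sum (ps n) \<omega>"], of 2]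
      by (simp add: P.diff power_mult_distrib mult.commute)
    then have "(\<integral>\<^sup>+\<omega>. ennreal ((norm (P (Z \<omega>) - P (tensor_sum (ps n) \<omega>)))\<^sup>2) \<partial>M)
        \<le> (\<integral>\<^sup>+\<omega>. ennreal (K\<^sup>2) * ennreal ((norm (Z \<omega> - tensor_sum (ps n) \<omega>))\<^sup>2) \<partial>M)"
      by (intro nn_integral_mono) (simp flip: ennreal_mult)
    then show ?thesis by (subst (asm) nn_integral_cmult) auto
  qed
  have "(\<lambda>n. ennreal (K\<^sup>2) * (\<integral>\<^sup>+\<omega>. ennreal ((norm (Z \<omega> - tensor_sum (ps n) \<omega>))\<^sup>2) \<partial>M)) \<longlonglongrightarrow> ennreal (K\<^sup>2) * 0"
    using ps by (intro ennreal_tendsto_cmult) (auto simp: tensor_approx_def)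
  then have lim: "(\<lambda>n. ennreal (K\<^sup>2) * (\<integral>\<^sup>+\<omega>. ennreal ((norm (Z \<omega> - tensor_sum (ps n) \<omega>))\<^sup>2) \<partial>M)) \<longlonglongrightarrow> 0"
    by (simp only: mult_zero_right)
  have "(\<lambda>n. \<integral>\<^sup>+\<omega>. ennreal ((norm (P (Z \<omega>) - P (tensor_sum (ps n) \<omega>)))\<^sup>2) \<partial>M) \<longlonglongrightarrow> 0"
    using le by (intro tendsto_sandwich[OF always_eventually always_eventually tendsto_const lim]) auto
  then show ?thesis using L2X meas by (simp add: tensor_approx_def ts)
qed

lemma L2H_bounded_linear: "Z \<in> L2H M T X \<Longrightarrow> bounded_linear P \<Longrightarrow> (\<lambda>\<omega>. P (Z \<omega>)) \<in> L2H M T X"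
  using tensor_approx_map unfolding L2H_def by blast

end

context wiener
begin

lemma S_tensor_sum:
  assumes "fst ` set ps \<subseteq> L2X M T X"
  shows "(\<integral>\<omega>. inner (tensor_sum ps \<omega>) u * wick_exp M (I x) \<omega> \<partial>M) =
    inner (\<Sum>(\<xi>, k)\<leftarrow>ps. S_transform M I \<xi> x *\<^sub>R k) u"
  using assms
proof (induction ps)
  case (Cons p ps)
  obtain \<xi> k where p: "p = (\<xi>, k)" by force
  have "\<xi> \<in> L2 M" "fst ` set ps \<subseteq> L2X M T X" using Cons p L2XD by auto
  then have ints: "integrable M (\<lambda>\<omega>. \<xi> \<omega> * wick_exp M (I x) \<omega>)"
      "integrable M (\<lambda>\<omega>. inner (tensor_sum ps \<omega>) u * wick_exp M (I x) \<omega>)"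
    by (auto intro!: S_integrable L2XD[OF tensor_sum_inner_L2X])
  have "(\<integral>\<omega>. inner (tensor_sum (p # ps) \<omega>) u * wick_exp M (I x) \<omega> \<partial>M) =
      (\<integral>\<omega>. inner k u * (\<xi> \<omega> * wick_exp M (I x) \<omega>) + inner (tensor_sum ps \<omega>) u * wick_exp M (I x) \<omega> \<partial>M)"
    by (intro Bochner_Integration.integral_cong) (auto simp: p inner_simps algebra_simps)
  also have "\<dots> = inner k u * S_transform M I \<xi> x + inner (\<Sum>(\<xi>, k)\<leftarrow>ps. S_transform M I \<xi> x *\<^sub>R k) u"
    using ints Cons by (simp add: S_transform_def)
  finally show ?case by (simp add: p inner_simps mult.commute)
qed simp

text \<open>
  The limit is the weak expectation of \<open>Z\<close> against the Wick exponential, obtained by representing the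
  functional \<open>u \<mapsto> E[(Z,u) e\<^bsup>\<diamond>I(x)\<^esup>]\<close>.  The S-transform of an approximating tensor represents the
  functional of that tensor, and the two differ by at most the \<open>L\<^sup>2\<close> distance times the norm of the Wick
  exponential.
\<close>

lemma S_transform_H_limit_ex:
  assumes Z: "Z \<in> L2H M T X"
  obtains v where "\<And>u. inner v u = (\<integral>\<omega>. inner (Z \<omega>) u * wick_exp M (I x) \<omega> \<partial>M)"
    and "\<And>ps. tensor_approx M T X Z ps \<Longrightarrow>
      (\<lambda>n. \<Sum>(\<xi>, k)\<leftarrow>ps n. S_transform M I \<xi> x *\<^sub>R k) \<longlonglongrightarrow> v"
proof -
  let ?w = "wick_exp M (I x)"
  define C where "C = sqrt (\<integral>\<omega>. (?w \<omega>)\<^sup>2 \<partial>M)"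
  have w_nonneg: "0 \<le> ?w \<omega>" for \<omega> by (simp add: wick_exp_def)
  have int: "integrable M (\<lambda>\<omega>. inner (Z \<omega>) u * ?w \<omega>)" for u
    by (intro S_integrable L2XD L2H_inner_L2X Z)
  let ?\<phi> = "\<lambda>u. \<integral>\<omega>. inner (Z \<omega>) u * ?w \<omega> \<partial>M"
  let ?S = "\<lambda>ps. \<Sum>(\<xi>, k)\<leftarrow>ps. S_transform M I \<xi> x *\<^sub>R k"
  have close: "\<bar>?\<phi> u - inner (?S ps) u\<bar> \<le> norm u * (C * sqrt (\<integral>\<omega>. (norm (Z \<omega> - tensor_sum ps \<omega>))\<^sup>2 \<partial>M))"
    if L2X: "fst ` set ps \<subseteq> L2X M T X" and D: "(\<lambda>\<omega>. norm (Z \<omega> - tensor_sum ps \<omega>)) \<in> L2 M" for u ps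
  proof -
    have int': "integrable M (\<lambda>\<omega>. inner (tensor_sum ps \<omega>) u * ?w \<omega>)"
      by (intro S_integrable L2XD tensor_sum_inner_L2X L2X)
    have "?\<phi> u - inner (?S ps) u = (\<integral>\<omega>. inner (Z \<omega> - tensor_sum ps \<omega>) u * ?w \<omega> \<partial>M)"
      unfolding S_tensor_sum[OF L2X, symmetric] using int int' by (simp add: inner_simps left_diff_distrib)
    also have "\<bar>\<dots>\<bar> \<le> (\<integral>\<omega>. \<bar>inner (Z \<omega> - tensor_sum ps \<omega>) u * ?w \<omega>\<bar> \<partial>M)" by (rule integral_abs_bound)
    also have "\<dots> \<le> (\<integral>\<omega>. norm u * (norm (Z \<omega> - tensor_sum ps \<omega>) * ?w \<omega>) \<partial>M)"
    proof (rule integral_mono)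
      show "integrable M (\<lambda>\<omega>. \<bar>inner (Z \<omega> - tensor_sum ps \<omega>) u * ?w \<omega>\<bar>)"
        using int int' by (auto simp: inner_simps left_diff_distrib)
      show "integrable M (\<lambda>\<omega>. norm u * (norm (Z \<omega> - tensor_sum ps \<omega>) * ?w \<omega>))"
        using S_integrable[OF D] by simp
      show "\<bar>inner (Z \<omega> - tensor_sum ps \<omega>) u * ?w \<omega>\<bar> \<le> norm u * (norm (Z \<omega> - tensor_sum ps \<omega>) * ?w \<omega>)" for \<omega>
        using mult_right_mono[OF Cauchy_Schwarz_ineq2[of "Z \<omega> - tensor_sum ps \<omega>" u] w_nonneg[of \<omega>]] w_nonneg[of \<omega>]
        by (simp add: abs_mult mult_ac)
    qed
    also have "\<dots> = norm u * (\<integral>\<omega>. norm (Z \<omega> - tensor_sum ps \<omega>) * ?w \<omega> \<partial>M)" by simp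
    also have "\<dots> \<le> norm u * sqrt ((\<integral>\<omega>. (norm (Z \<omega> - tensor_sum ps \<omega>))\<^sup>2 \<partial>M) * (\<integral>\<omega>. (?w \<omega>)\<^sup>2 \<partial>M))"
      by (intro mult_left_mono real_le_rsqrt L2_Cauchy_Schwarz D wick_L2) auto
    finally show ?thesis by (simp add: C_def real_sqrt_mult mult_ac)
  qed
  obtain qs where qs: "tensor_approx M T X Z qs" using Z by (auto simp: L2H_def)
  obtain N where N: "(\<lambda>\<omega>. norm (Z \<omega> - tensor_sum (qs N) \<omega>)) \<in> L2 M" using tensor_approx_L2[OF qs] .
  have qsL: "fst ` set (qs N) \<subseteq> L2X M T X" using qs by (simp add: tensor_approx_def)
  have "bounded_linear ?\<phi>"
  proof (rule bounded_linear_intro)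
    show "?\<phi> (u + v) = ?\<phi> u + ?\<phi> v" for u v using int by (simp add: inner_simps distrib_right)
    show "?\<phi> (c *\<^sub>R u) = c *\<^sub>R ?\<phi> u" for c u by (simp add: mult.assoc)
    show "norm (?\<phi> u) \<le> norm u * (C * sqrt (\<integral>\<omega>. (norm (Z \<omega> - tensor_sum (qs N) \<omega>))\<^sup>2 \<partial>M) + norm (?S (qs N)))" for u
      using close[OF qsL N, of u] Cauchy_Schwarz_ineq2[of "?S (qs N)" u]
      by (simp add: distrib_left mult.commute)
  qed
  then obtain v where v: "\<And>u. ?\<phi> u = inner u v" by (rule riesz_representation) blast
  show ?thesis
  proof (rule that[of v])
    show "inner v u = (\<integral>\<omega>. inner (Z \<omega>) u * ?w \<omega> \<partial>M)" for u
      unfolding v by (rule inner_commute)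
    fix ps assume ps: "tensor_approx M T X Z ps"
    let ?D = "\<lambda>n \<omega>. norm (Z \<omega> - tensor_sum (ps n) \<omega>)"
    have L2X: "fst ` set (ps n) \<subseteq> L2X M T X" for n using ps by (simp add: tensor_approx_def)
    have D [measurable]: "?D n \<in> borel_measurable M" for n using ps by (simp add: tensor_approx_def)
    have lim: "(\<lambda>n. \<integral>\<^sup>+\<omega>. ennreal ((?D n \<omega>)\<^sup>2) \<partial>M) \<longlonglongrightarrow> 0" using ps by (simp add: tensor_approx_def)
    then have "\<forall>\<^sub>F n in sequentially. (\<integral>\<^sup>+\<omega>. ennreal ((?D n \<omega>)\<^sup>2) \<partial>M) < \<infinity>"
      by (rule order_tendstoD) simp
    then have fin: "\<forall>\<^sub>F n in sequentially. ?D n \<in> L2 M"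
      by eventually_elim (auto simp: L2_def intro!: integrableI_bounded)
    have "(\<lambda>n. enn2real (\<integral>\<^sup>+\<omega>. ennreal ((?D n \<omega>)\<^sup>2) \<partial>M)) \<longlonglongrightarrow> 0"
      using lim by (intro tendsto_enn2real) simp_all
    then have "(\<lambda>n. C * sqrt (enn2real (\<integral>\<^sup>+\<omega>. ennreal ((?D n \<omega>)\<^sup>2) \<partial>M))) \<longlonglongrightarrow> C * sqrt 0"
      by (intro tendsto_mult tendsto_const tendsto_real_sqrt)
    then have lim0: "(\<lambda>n. C * sqrt (enn2real (\<integral>\<^sup>+\<omega>. ennreal ((?D n \<omega>)\<^sup>2) \<partial>M))) \<longlonglongrightarrow> 0" by simp
    have "\<forall>\<^sub>F n in sequentially. norm (?S (ps n) - v) \<le> C * sqrt (enn2real (\<integral>\<^sup>+\<omega>. ennreal ((?D n \<omega>)\<^sup>2) \<partial>M))"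
      using fin
    proof eventually_elim
      case (elim n)
      let ?u = "v - ?S (ps n)"
      have eq: "(\<integral>\<omega>. (?D n \<omega>)\<^sup>2 \<partial>M) = enn2real (\<integral>\<^sup>+\<omega>. ennreal ((?D n \<omega>)\<^sup>2) \<partial>M)"
        by (rule integral_eq_nn_integral) auto
      have "norm ?u * norm ?u = inner ?u (v - ?S (ps n))"
        by (simp only: power2_norm_eq_inner flip: power2_eq_square)
      also have "\<dots> = inner ?u v - inner (?S (ps n)) ?u"
        using inner_diff_right[of ?u v "?S (ps n)"] inner_commute[of "?S (ps n)" ?u] by linarith
      also have "\<dots> = ?\<phi> ?u - inner (?S (ps n)) ?u" by (simp only: v)
      also have "\<dots> \<le> norm ?u * (C * sqrt (\<integral>\<omega>. (?D n \<omega>)\<^sup>2 \<partial>M))"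
        using close[OF L2X elim, of ?u] by linarith
      finally have "norm ?u * norm ?u \<le> norm ?u * (C * sqrt (\<integral>\<omega>. (?D n \<omega>)\<^sup>2 \<partial>M))" .
      moreover have "0 \<le> C * sqrt (\<integral>\<omega>. (?D n \<omega>)\<^sup>2 \<partial>M)" by (simp add: C_def)
      ultimately have "norm ?u \<le> C * sqrt (\<integral>\<omega>. (?D n \<omega>)\<^sup>2 \<partial>M)"
        by (cases "norm ?u = 0") (auto simp: mult_le_cancel_left)
      then show ?case by (simp only: eq norm_minus_commute)
    qed
    then have "(\<lambda>n. ?S (ps n) - v) \<longlonglongrightarrow> 0"
      using lim0 by (rule Lim_null_comparison)
    then show "(\<lambda>n. ?S (ps n)) \<longlonglongrightarrow> v" by (simp add: LIM_zero_iff)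
  qed
qed

lemma S_transform_H_inner:
  assumes Z: "Z \<in> L2H M T X"
  shows "inner (S_transform_H M T X I Z x) u = (\<integral>\<omega>. inner (Z \<omega>) u * wick_exp M (I x) \<omega> \<partial>M)"
proof -
  obtain v where v: "\<And>u. inner v u = (\<integral>\<omega>. inner (Z \<omega>) u * wick_exp M (I x) \<omega> \<partial>M)"
    "\<And>ps. tensor_approx M T X Z ps \<Longrightarrow> (\<lambda>n. \<Sum>(\<xi>, k)\<leftarrow>ps n. S_transform M I \<xi> x *\<^sub>R k) \<longlonglongrightarrow> v"
    using S_transform_H_limit_ex[OF Z, of x] by blast
  obtain qs where qs: "tensor_approx M T X Z qs" using Z by (auto simp: L2H_def)
  have "S_transform_H M T X I Z x = v"
    unfolding S_transform_H_def
  proof (rule the_equality)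
    fix v' assume "\<forall>ps. tensor_approx M T X Z ps \<longrightarrow> (\<lambda>n. \<Sum>(\<xi>, k)\<leftarrow>ps n. S_transform M I \<xi> x *\<^sub>R k) \<longlonglongrightarrow> v'"
    then show "v' = v" using qs v(2)[OF qs] LIMSEQ_unique by blast
  qed (use v(2) in blast)
  then show ?thesis using v(1) by simp
qed

text \<open>
  Move the operator to the test vector by its adjoint.
\<close>

lemma S_transform_H_bounded_linear:
  fixes P :: "'h::{real_inner,complete_space} \<Rightarrow> 'h"
  assumes Z: "Z \<in> L2H M T X" and P: "bounded_linear P"
  shows "S_transform_H M T X I (\<lambda>\<omega>. P (Z \<omega>)) x = P (S_transform_H M T X I Z x)"
proof (subst vector_eq_rdot[symmetric], intro allI)
  fix u
  have "inner (S_transform_H M T X I (\<lambda>\<omega>. P (Z \<omega>)) x) u = (\<integral>\<omega>. inner (P (Z \<omega>)) u * wick_exp M (I x) \<omega> \<partial>M)"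
    by (rule S_transform_H_inner[OF L2H_bounded_linear[OF Z P]])
  also have "\<dots> = inner (S_transform_H M T X I Z x) (adjoint P u)"
    unfolding adjoint_hilbert_inner[OF P] S_transform_H_inner[OF Z] ..
  finally show "inner (S_transform_H M T X I (\<lambda>\<omega>. P (Z \<omega>)) x) u = inner (P (S_transform_H M T X I Z x)) u"
    by (simp add: adjoint_hilbert_inner[OF P])
qed

lemma L2H_functional:
  assumes Z: "Z \<in> L2H M T X" and \<phi>: "bounded_linear \<phi>"
  shows L2H_functional_L2X: "(\<lambda>\<omega>. \<phi> (Z \<omega>)) \<in> L2X M T X"
    and S_transform_functional: "S_transform M I (\<lambda>\<omega>. \<phi> (Z \<omega>)) x = \<phi> (S_transform_H M T X I Z x)"
proof -
  obtain y where y: "\<And>z. \<phi> z = inner z y" using riesz_representation[OF \<phi>] by blast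
  show "(\<lambda>\<omega>. \<phi> (Z \<omega>)) \<in> L2X M T X" unfolding y by (rule L2H_inner_L2X[OF Z])
  show "S_transform M I (\<lambda>\<omega>. \<phi> (Z \<omega>)) x = \<phi> (S_transform_H M T X I Z x)"
    unfolding y S_transform_H_inner[OF Z] S_transform_def ..
qed

end

section \<open>Mild solutions\<close>

locale bsde = wiener M T X e I
  for M :: "'w measure" and T X and e :: "real \<Rightarrow> 'k::{real_inner,complete_space}" and I +
  fixes a \<gamma> c :: "real \<Rightarrow> real" and Y G :: "real \<Rightarrow> 'w \<Rightarrow> real" and \<cc> :: 'k and \<xi> :: "'w \<Rightarrow> real"
    and Z :: "'w \<Rightarrow> 'h::{real_inner,complete_space}" and f :: "real \<Rightarrow> 'h"
  assumes trunc: "has_truncations T e"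
    and standing: "standing_assumptions M T X a \<gamma> c G"
    and terminal: "\<xi> \<in> L2X M T X"
    and associated: "underline M T X (I \<cc>) = c"
    and mild: "mild_solution M T X I a \<gamma> c G \<xi> Y Z f"

sublocale bsde \<subseteq> bv: bounded_variation T \<gamma>
  using standing T_pos by unfold_locales (auto simp: standing_assumptions_def)

sublocale bsde \<subseteq> nu: atomless_measure "variation_measure T \<gamma>"
  by (rule bv.atomless_variation_measure)

sublocale bsde \<subseteq> si: process_integral M T X "variation_measure T \<gamma>" "stieltjes_sign T \<gamma>"
  by unfold_locales (simp_all add: bv.stieltjes_sign)

context bsde
begin

abbreviation "\<nu> \<equiv> variation_measure T \<gamma>"
abbreviation "\<sigma> \<equiv> stieltjes_sign T \<gamma>"

definition A :: "real \<Rightarrow> real" where "A t = exp (stieltjes_integral T \<gamma> t T a)"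

definition \<alpha> :: "real \<Rightarrow> real" where "\<alpha> u = indicator {0<..T} u * a (clip T u) * \<sigma> u"

text \<open>\<open>A\<close> is controlled on \<open>[0,T]\<close>, where \<open>a\<close> is measurable; this version is measurable and bounded
  on the whole line.\<close>

definition A' :: "real \<Rightarrow> real" where "A' t = exp (nu.tail_integral T \<alpha> t)"

lemma a_measurable [measurable]: "(\<lambda>u. a (clip T u)) \<in> borel_measurable borel"
proof -
  have "clip T \<in> measurable borel (restrict_space borel {0..T})"
    using T_pos clip_in[of T]
    by (intro measurable_restrict_space2) (auto intro: borel_measurable_continuous_onI[OF continuous_on_clip])
  moreover have "a \<in> borel_measurable (restrict_space borel {0..T})"
    using standing by (simp add: standing_assumptions_def)
  ultimately show ?thesis by (rule measurable_compose)
qed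

lemmas sign_measurable [measurable] = bv.stieltjes_sign(1)

lemma a_bound: "(\<integral>\<^sup>+u\<in>{0..T}. ennreal \<bar>a u\<bar> \<partial>\<nu>) < \<infinity>"
  using standing by (auto simp: standing_assumptions_def less_top)

lemma G_bound: "(\<integral>\<^sup>+\<omega>. (\<integral>\<^sup>+u\<in>{0..T}. ennreal \<bar>G u \<omega>\<bar> \<partial>\<nu>)\<^sup>2 \<partial>M) < \<infinity>"
  using standing by (auto simp: standing_assumptions_def less_top)

lemma integrable_times_sign: "integrable \<nu> g \<Longrightarrow> integrable \<nu> (\<lambda>u. g u * \<sigma> u)"
  by (rule nu.integrable_times_bounded[OF _ bv.stieltjes_sign(1,2)])

lemma a_integrable: "integrable \<nu> (\<lambda>u. indicator {0<..T} u * a (clip T u))"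
proof (rule integrableI_bounded)
  have "(\<integral>\<^sup>+u. ennreal (norm (indicator {0<..T} u * a (clip T u))) \<partial>\<nu>) \<le> (\<integral>\<^sup>+u\<in>{0..T}. ennreal \<bar>a u\<bar> \<partial>\<nu>)"
    by (intro nn_integral_mono) (auto simp: indicator_def clip_id)
  then show "(\<integral>\<^sup>+u. ennreal (norm (indicator {0<..T} u * a (clip T u))) \<partial>\<nu>) < \<infinity>"
    using a_bound by (rule le_less_trans)
qed measurable

lemma \<alpha>_integrable: "integrable \<nu> \<alpha>"
  unfolding \<alpha>_def by (rule integrable_times_sign[OF a_integrable])

text \<open>
  On \<open>[0,T]\<close> the exponent of \<open>A\<close> is the tail integral of the density of \<open>a d\<gamma>\<close> against the variation
  measure.
\<close>

lemma A_eq: "A t = A' t" if "t \<in> {0..T}"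
proof -
  have "stieltjes_integral T \<gamma> t T a = stieltjes_integral T \<gamma> t T (\<lambda>u. indicator {0<..T} u * a (clip T u))"
    using that by (intro stieltjes_integral_cong) (simp add: clip_id)
  also have "\<dots> = (LINT u:{t<..T}|\<nu>. (indicator {0<..T} u * a (clip T u)) * \<sigma> u)"
  proof (rule bv.stieltjes_sign(3))
    show "set_integrable \<nu> {t<..T} (\<lambda>u. indicator {0<..T} u * a (clip T u))"
      unfolding set_integrable_def by (intro integrable_mult_indicator a_integrable) simp
  qed measurable
  also have "\<dots> = nu.tail_integral T \<alpha> t" by (simp add: nu.tail_integral_def \<alpha>_def)
  finally show ?thesis by (simp add: A_def A'_def)
qed

lemma A'_measurable [measurable]: "A' \<in> borel_measurable borel"
proof -
  have "\<alpha> \<in> borel_measurable borel" using \<alpha>_integrable by auto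
  note [measurable] = nu.borel_measurable_tail_integral[OF this]
  show ?thesis unfolding A'_def[abs_def] by measurable
qed

lemma A'_bound: "\<bar>A' u\<bar> \<le> exp (\<integral>u. \<bar>\<alpha> u\<bar> \<partial>\<nu>)"
  unfolding A'_def using nu.tail_integral_bound[OF \<alpha>_integrable, of T u] by simp

lemma A_pos: "0 < A t" by (simp add: A_def)

lemma Y_L2X: "t \<in> {0..T} \<Longrightarrow> Y t \<in> L2X M T X" using mild by (simp add: mild_solution_def)

lemma measurable_process_mult:
  assumes "measurable_process M T V" and g: "g \<in> borel_measurable (restrict_space borel {0..T})"
  shows "measurable_process M T (\<lambda>u \<omega>. g u * V u \<omega>)"
proof -
  note [measurable] = assms(1)[unfolded measurable_process_def] g
  have "(\<lambda>z. g (fst z) * (case z of (u, \<omega>) \<Rightarrow> V u \<omega>)) \<in> borel_measurable (restrict_space borel {0..T} \<Otimes>\<^sub>M M)"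
    by measurable
  then show ?thesis by (simp add: measurable_process_def case_prod_beta')
qed

end

sublocale bsde \<subseteq> aY: stieltjes_process M T X \<gamma> "\<lambda>u \<omega>. a u * Y u \<omega>"
proof unfold_locales
  show "measurable_process M T (\<lambda>u \<omega>. a u * Y u \<omega>)"
    using mild standing by (intro measurable_process_mult) (auto simp: mild_solution_def standing_assumptions_def)
  show "(\<integral>\<^sup>+\<omega>. (\<integral>\<^sup>+u\<in>{0..T}. ennreal \<bar>a u * Y u \<omega>\<bar> \<partial>\<nu>)\<^sup>2 \<partial>M) < \<infinity>"
    using mild unfolding mild_solution_def by blast
qed

sublocale bsde \<subseteq> G: stieltjes_process M T X \<gamma> G
proof unfold_locales
  show "measurable_process M T G" using standing by (simp add: standing_assumptions_def)
qed (rule G_bound)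

sublocale bsde \<subseteq> AG: stieltjes_process M T X \<gamma> "\<lambda>u \<omega>. A' u * G u \<omega>"
proof unfold_locales
  let ?C = "exp (\<integral>u. \<bar>\<alpha> u\<bar> \<partial>\<nu>)"
  show "measurable_process M T (\<lambda>u \<omega>. A' u * G u \<omega>)"
    using G.process measurable_restrict_space1[OF A'_measurable] by (rule measurable_process_mult)
  have inner: "(\<integral>\<^sup>+u\<in>{0..T}. ennreal \<bar>A' u * G u \<omega>\<bar> \<partial>\<nu>) \<le> ennreal ?C * (\<integral>\<^sup>+u\<in>{0..T}. ennreal \<bar>G u \<omega>\<bar> \<partial>\<nu>)"
    if "\<omega> \<in> space M" for \<omega>
  proof -
    note [measurable] = measurable_Pair1[OF G.sq.W_measurable that, simplified]
    have "(\<integral>\<^sup>+u\<in>{0..T}. ennreal \<bar>A' u * G u \<omega>\<bar> \<partial>\<nu>) \<le> (\<integral>\<^sup>+u. ennreal ?C * (ennreal \<bar>G.sq.W u \<omega>\<bar> * indicator {0..T} u) \<partial>\<nu>)"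
      using A'_bound
      by (intro nn_integral_mono)
        (auto simp: indicator_def G.sq.W_def clip_id abs_mult simp flip: ennreal_mult intro!: ennreal_leI mult_right_mono)
    also have "\<dots> = ennreal ?C * (\<integral>\<^sup>+u. ennreal \<bar>G.sq.W u \<omega>\<bar> * indicator {0..T} u \<partial>\<nu>)"
      by (intro nn_integral_cmult) measurable
    also have "(\<integral>\<^sup>+u. ennreal \<bar>G.sq.W u \<omega>\<bar> * indicator {0..T} u \<partial>\<nu>) = (\<integral>\<^sup>+u\<in>{0..T}. ennreal \<bar>G u \<omega>\<bar> \<partial>\<nu>)"
      unfolding G.sq.N_eq[symmetric] G.sq.N_def ..
    finally show ?thesis .
  qed
  have "(\<integral>\<^sup>+\<omega>. (\<integral>\<^sup>+u\<in>{0..T}. ennreal \<bar>A' u * G u \<omega>\<bar> \<partial>\<nu>)\<^sup>2 \<partial>M) \<le>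
      (\<integral>\<^sup>+\<omega>. (ennreal ?C)\<^sup>2 * (G.sq.N \<omega>)\<^sup>2 \<partial>M)"
    using inner unfolding G.sq.N_def power_mult_distrib[symmetric]
    by (intro nn_integral_mono power_mono) auto
  also have "\<dots> = (ennreal ?C)\<^sup>2 * (\<integral>\<^sup>+\<omega>. (G.sq.N \<omega>)\<^sup>2 \<partial>M)"
    by (intro nn_integral_cmult) measurable
  also have "\<dots> < \<infinity>" using G.sq.N_square by (simp add: ennreal_mult_less_top ennreal_power)
  finally show "(\<integral>\<^sup>+\<omega>. (\<integral>\<^sup>+u\<in>{0..T}. ennreal \<bar>A' u * G u \<omega>\<bar> \<partial>\<nu>)\<^sup>2 \<partial>M) < \<infinity>" .
qed

context bsde
begin

section \<open>Admissible integrators\<close>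

abbreviation "Adm \<equiv> admissible M T X I f"
abbreviation "\<Phi> x \<equiv> integral_wrt T f (underline M T X (I x))"
abbreviation "Q r \<equiv> truncation T f r"
abbreviation "P r \<equiv> integrand_upto T e r"

lemma f_total: "indicators_total T f" and f_trunc: "has_truncations T f"
  using mild by (auto simp: mild_solution_def space_of_integrands_def)

lemma Z_L2H: "Z \<in> L2H M T X" using mild by (simp add: mild_solution_def)

lemma admD:
  assumes "x \<in> Adm"
  shows bounded_linear_\<Phi>: "bounded_linear (\<Phi> x)" and \<Phi>_indicator: "s \<in> {0..T} \<Longrightarrow> \<Phi> x (f s) = inner (e s) x"
  using assms integral_wrt_works[of T f "underline M T X (I x)"] by (auto simp: admissible_def underline_I)

lemma admI:
  assumes "bounded_linear \<phi>" "\<And>s. s \<in> {0..T} \<Longrightarrow> \<phi> (f s) = inner (e s) x"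
  shows "x \<in> Adm" "\<Phi> x = \<phi>"
proof -
  show "x \<in> Adm"
    using assms f_total by (auto simp: admissible_def space_of_integrands_def is_integrator_functional_def underline_I)
  show "\<Phi> x = \<phi>" using assms f_total by (intro integral_wrt_eqI) (auto simp: underline_I)
qed

lemma \<cc>_adm: "\<cc> \<in> Adm"
  using mild associated by (simp add: admissible_def mild_solution_def)

lemma \<Phi>_\<cc>: "\<Phi> \<cc> = integral_wrt T f c" using associated by simp

lemma bounded_linear_P: "r \<in> {0..T} \<Longrightarrow> bounded_linear (P r)"
  unfolding integrand_upto_def
  by (intro bounded_linear_adjoint_hilbert bounded_linear_truncation[OF total trunc])

lemma inner_P: "r \<in> {0..T} \<Longrightarrow> s \<in> {0..T} \<Longrightarrow> inner (e s) (P r x) = inner (e (min s r)) x"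
  unfolding integrand_upto_def
  by (simp add: truncation_indicator[OF total trunc]
      flip: adjoint_hilbert_inner[OF bounded_linear_truncation[OF total trunc]])

text \<open>
  The function associated with \<open>P t (h + c)\<close> is the one of \<open>h + c\<close> stopped at \<open>t\<close>; integrating against it
  means truncating the integrand at \<open>t\<close>.
\<close>

lemma shift_adm:
  assumes h: "h \<in> Adm" and t: "t \<in> {0..T}"
  shows "P t (h + \<cc>) - \<cc> \<in> Adm"
    and "\<Phi> (P t (h + \<cc>) - \<cc>) z + \<Phi> \<cc> z = \<Phi> (h + \<cc>) (Q t z)"
    and "bounded_linear (\<Phi> (h + \<cc>))"
proof -
  have hc: "h + \<cc> \<in> Adm"
    using admD[OF h] admD[OF \<cc>_adm]
    by (intro admI(1)[of "\<lambda>z. \<Phi> h z + \<Phi> \<cc> z"]) (auto intro: bounded_linear_add simp: inner_simps)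
  show "bounded_linear (\<Phi> (h + \<cc>))" by (rule bounded_linear_\<Phi>[OF hc])
  let ?\<phi> = "\<lambda>z. \<Phi> (h + \<cc>) (Q t z) - \<Phi> \<cc> z"
  have "bounded_linear ?\<phi>"
    by (intro bounded_linear_sub bounded_linear_compose[OF bounded_linear_\<Phi>[OF hc]]
        bounded_linear_\<Phi>[OF \<cc>_adm] bounded_linear_truncation[OF f_total f_trunc t])
  moreover have "?\<phi> (f s) = inner (e s) (P t (h + \<cc>) - \<cc>)" if s: "s \<in> {0..T}" for s
  proof -
    have "min s t \<in> {0..T}" using s t by auto
    then show ?thesis
      using s t by (simp add: truncation_indicator[OF f_total f_trunc] \<Phi>_indicator[OF hc]
          \<Phi>_indicator[OF \<cc>_adm] inner_P inner_diff_right)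
  qed
  ultimately show "P t (h + \<cc>) - \<cc> \<in> Adm" "\<Phi> (P t (h + \<cc>) - \<cc>) z + \<Phi> \<cc> z = \<Phi> (h + \<cc>) (Q t z)"
    using admI[of ?\<phi> "P t (h + \<cc>) - \<cc>"] by auto
qed

lemma Q_cut:
  assumes "0 \<le> t" "t \<le> s" "s \<le> T"
  shows "Q t (Q T z - Q s z) = 0"
proof -
  have st: "t \<in> {0..T}" "s \<in> {0..T}" "T \<in> {0..T}" using assms by auto
  note bl = bounded_linear_truncation[OF f_total f_trunc]
  have "(\<lambda>z. Q t (Q T z - Q s z)) = (\<lambda>z. 0)"
  proof (rule bounded_linear_eq_on_total[OF _ _ f_total])
    show "bounded_linear (\<lambda>z. Q t (Q T z - Q s z))"
      by (intro bounded_linear_compose[OF bl[OF st(1)]] bounded_linear_sub bl st)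
    fix u assume u: "u \<in> {0..T}"
    interpret linear "Q t" using bl[OF st(1)] bounded_linear.linear by blast
    have "min (min u T) t = min (min u s) t" using u assms by auto
    moreover have "min u s \<in> {0..T}" "min u T \<in> {0..T}" using u assms by auto
    ultimately show "Q t (Q T (f u) - Q s (f u)) = 0"
      using u st by (simp add: truncation_indicator[OF f_total f_trunc] diff)
  qed simp
  then show ?thesis by meson
qed

text \<open>
  Elements close to \<open>I h\<close> in the first chaos whose associated functions are admissible integrators exist
  by appropriateness; by surjectivity they are Wiener integrals, and \<open>I\<close> is isometric.
\<close>

lemma adm_dense:
  obtains y where "\<And>n. y n \<in> Adm" "y \<longlonglongrightarrow> h"
proof -
  obtain D where D: "cm_dense M T X D" "\<And>c. c \<in> D \<Longrightarrow> space_of_integrands T f c"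
    using mild by (auto simp: mild_solution_def appropriate_def)
  have "\<exists>y\<in>Adm. (norm (y - h))\<^sup>2 < \<epsilon>" if "0 < \<epsilon>" for \<epsilon>
  proof -
    obtain g where g: "g \<in> first_chaos M T X" "underline M T X g \<in> D" "(\<integral>\<omega>. (I h \<omega> - g \<omega>)\<^sup>2 \<partial>M) < \<epsilon>"
      using D(1) I_chaos[of h] \<open>0 < \<epsilon>\<close> unfolding cm_dense_def by blast
    obtain y where y: "AE \<omega> in M. I y \<omega> = g \<omega>" using I_surjective[OF g(1)] .
    have [measurable]: "g \<in> borel_measurable M" using g(1) L2XD by (auto simp: first_chaos_def)
    have "underline M T X (I y) = underline M T X g"
      unfolding underline_def
    proof (intro restrict_ext integral_cong_AE)
      fix t assume "t \<in> {0..T}"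
      then show "(\<lambda>\<omega>. X t \<omega> * I y \<omega>) \<in> borel_measurable M" "(\<lambda>\<omega>. X t \<omega> * g \<omega>) \<in> borel_measurable M"
        using X_measurable by measurable
      show "AE \<omega> in M. X t \<omega> * I y \<omega> = X t \<omega> * g \<omega>" using y by eventually_elim simp
    qed
    then have "y \<in> Adm" using D(2)[OF g(2)] by (simp add: admissible_def)
    moreover have "(norm (y - h))\<^sup>2 = (\<integral>\<omega>. (I h \<omega> - g \<omega>)\<^sup>2 \<partial>M)"
      unfolding I_norm[symmetric]
    proof (intro integral_cong_AE)
      show "AE \<omega> in M. (I (y - h) \<omega>)\<^sup>2 = (I h \<omega> - g \<omega>)\<^sup>2"
        using I_diff[of y h] y by eventually_elim (simp add: power2_commute)
    qed measurable
    ultimately have "y \<in> Adm \<and> (norm (y - h))\<^sup>2 < \<epsilon>" using g(3) by simp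
    then show ?thesis by blast
  qed
  then have "\<forall>n. \<exists>y\<in>Adm. (norm (y - h))\<^sup>2 < 1 / real (Suc n)" by simp
  then obtain y where y: "\<And>n. y n \<in> Adm" "\<And>n. (norm (y n - h))\<^sup>2 < 1 / real (Suc n)" by metis
  have "(\<lambda>n. (norm (y n - h))\<^sup>2) \<longlonglongrightarrow> 0"
    by (rule Lim_null_comparison[OF _ LIMSEQ_Suc[OF lim_1_over_n]]) (use y(2) in \<open>auto intro!: always_eventually less_imp_le\<close>)
  then have "(\<lambda>n. norm (y n - h)) \<longlonglongrightarrow> 0" using tendsto_real_sqrt[of "\<lambda>n. (norm (y n - h))\<^sup>2" 0] by simp
  then have "y \<longlonglongrightarrow> h" by (simp add: tendsto_norm_zero_iff LIM_zero_iff)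
  with y(1) show ?thesis by (rule that)
qed

section \<open>The equation under the S-transform\<close>

abbreviation "S \<eta> x \<equiv> S_transform M I \<eta> x"
abbreviation "stj s t g \<equiv> stieltjes_integral T \<gamma> s t g"

text \<open>
  The S-transform of \<open>Y\<close> as a function of time, and that of \<open>G\<close> as a density against the variation
  measure.
\<close>

definition SY :: "'k \<Rightarrow> real \<Rightarrow> real" where "SY x u = S (Y (clip T u)) x"
definition SG :: "'k \<Rightarrow> real \<Rightarrow> real" where "SG x u = indicator {0<..T} u * S (G.sq.W u) x * \<sigma> u"

lemma S_aY_W: "u \<in> {0<..T} \<Longrightarrow> S (aY.sq.W u) x * \<sigma> u = \<alpha> u * SY x u"
  by (simp add: aY.sq.W_def[abs_def] S_scale SY_def \<alpha>_def)

lemma integrable_S: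
  shows "integrable \<nu> (\<lambda>u. \<alpha> u * SY x u)" and "integrable \<nu> (SG x)"
proof -
  have "integrable \<nu> (\<lambda>u. indicator {0<..T} u * S (aY.sq.W u) x)"
    using aY.sq.expectation_integrable[OF wick_L2, of 0 T x]
    by (simp add: set_integrable_def S_transform_def)
  from integrable_times_sign[OF this]
  have "integrable \<nu> (\<lambda>u. indicator {0<..T} u * S (aY.sq.W u) x * \<sigma> u)" .
  also have "(\<lambda>u. indicator {0<..T} u * S (aY.sq.W u) x * \<sigma> u) = (\<lambda>u. \<alpha> u * SY x u)"
    using S_aY_W[of _ x] by (auto simp: fun_eq_iff indicator_def \<alpha>_def)
  finally show "integrable \<nu> (\<lambda>u. \<alpha> u * SY x u)" .
  have "integrable \<nu> (\<lambda>u. indicator {0<..T} u * S (G.sq.W u) x)"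
    using G.sq.expectation_integrable[OF wick_L2, of 0 T x]
    by (simp add: set_integrable_def S_transform_def)
  from integrable_times_sign[OF this] show "integrable \<nu> (SG x)" by (simp add: SG_def[abs_def])
qed

lemma S_stj_aY:
  assumes "0 \<le> s"
  shows "S (\<lambda>\<omega>. stj s T (\<lambda>u. a u * Y u \<omega>)) x = nu.tail_integral T (\<lambda>u. \<alpha> u * SY x u) s"
proof -
  have "S (\<lambda>\<omega>. stj s T (\<lambda>u. a u * Y u \<omega>)) x = si.signed_integral s T (\<lambda>u. S (aY.sq.W u) x)"
    using aY.expectation_stieltjes[OF assms order_refl wick_L2, of x] by (simp add: S_transform_def)
  also have "\<dots> = nu.tail_integral T (\<lambda>u. S (aY.sq.W u) x * \<sigma> u) s"
    by (simp add: si.signed_integral_def nu.tail_integral_def)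
  also have "\<dots> = nu.tail_integral T (\<lambda>u. \<alpha> u * SY x u) s"
    using assms S_aY_W by (intro nu.tail_integral_cong) auto
  finally show ?thesis .
qed

lemma S_stj_G:
  assumes "0 \<le> s"
  shows "S (\<lambda>\<omega>. stj s T (\<lambda>u. G u \<omega>)) x = nu.tail_integral T (SG x) s"
proof -
  have "S (\<lambda>\<omega>. stj s T (\<lambda>u. G u \<omega>)) x = si.signed_integral s T (\<lambda>u. S (G.sq.W u) x)"
    using G.expectation_stieltjes[OF assms order_refl wick_L2, of x] by (simp add: S_transform_def)
  also have "\<dots> = nu.tail_integral T (\<lambda>u. S (G.sq.W u) x * \<sigma> u) s"
    by (simp add: si.signed_integral_def nu.tail_integral_def)
  also have "\<dots> = nu.tail_integral T (SG x) s"
    using assms by (intro nu.tail_integral_cong) (auto simp: SG_def)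
  finally show ?thesis .
qed

lemma S_stj_AG:
  assumes "0 \<le> s" "t \<le> T"
  shows "S (\<lambda>\<omega>. stj s t (\<lambda>u. A u * G u \<omega>)) x = (LINT u:{s<..t}|\<nu>. A' u * SG x u)"
proof -
  have "S (\<lambda>\<omega>. stj s t (\<lambda>u. A u * G u \<omega>)) x = S (\<lambda>\<omega>. stj s t (\<lambda>u. A' u * G u \<omega>)) x"
    using assms A_eq by (intro arg_cong[of _ _ "\<lambda>h. S h x"] ext stieltjes_integral_cong) auto
  also have "\<dots> = si.signed_integral s t (\<lambda>u. S (AG.sq.W u) x)"
    using AG.expectation_stieltjes[OF assms wick_L2, of x] by (simp add: S_transform_def)
  also have "\<dots> = (LINT u:{s<..t}|\<nu>. A' u * SG x u)"
    unfolding si.signed_integral_def set_lebesgue_integral_def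
  proof (intro Bochner_Integration.integral_cong refl)
    fix u
    show "indicator {s<..t} u *\<^sub>R (S (AG.sq.W u) x * \<sigma> u) = indicator {s<..t} u *\<^sub>R (A' u * SG x u)"
    proof (cases "u \<in> {s<..t}")
      case True
      then have u: "u \<in> {0<..T}" using assms by auto
      then have "AG.sq.W u = (\<lambda>\<omega>. A' u * G.sq.W u \<omega>)"
        by (simp add: AG.sq.W_def[abs_def] G.sq.W_def clip_id)
      then show ?thesis using u by (simp add: S_scale SG_def)
    qed simp
  qed
  finally show ?thesis .
qed

text \<open>
  Take S-transforms at the shifted point.  There the two integrals of \<open>Z\<close> over \<open>(s,T]\<close> contribute the
  functional of \<open>h + c\<close> at an integrand truncated at \<open>t \<le> s\<close>, which is zero.
\<close>

lemma S_equation: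
  assumes h: "h \<in> Adm" and t: "0 \<le> t" and s: "t \<le> s" "s \<le> T"
  defines "x \<equiv> P t (h + \<cc>) - \<cc>"
  shows "SY x s = S \<xi> x - nu.tail_integral T (\<lambda>u. \<alpha> u * SY x u + SG x u) s"
proof -
  have s0: "0 \<le> s" "s \<in> {0..T}" "t \<in> {0..T}" "T \<in> {0..T}" using t s by auto
  note shift = shift_adm[OF h s0(3), folded x_def]
  let ?J1 = "\<lambda>\<omega>. stj s T (\<lambda>u. a u * Y u \<omega>)" and ?J2 = "\<lambda>\<omega>. stj s T (\<lambda>u. G u \<omega>)"
  let ?R = "\<lambda>z. Q T z - Q s z"
  let ?cut = "cut T f s T Z"
  let ?K = "skorokhod M T X I f ?cut"
  have cut: "?cut = (\<lambda>\<omega>. ?R (Z \<omega>))" by (simp add: cut_def fun_eq_iff)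
  have R: "bounded_linear ?R"
    by (intro bounded_linear_sub bounded_linear_truncation[OF f_total f_trunc] s0)
  have cutL: "?cut \<in> L2H M T X" unfolding cut by (rule L2H_bounded_linear[OF Z_L2H R])
  have sk: "is_skorokhod M T X I f ?cut ?K"
  proof -
    have "\<exists>V. is_skorokhod M T X I f ?cut V"
      using mild s0(2) unfolding mild_solution_def by blast
    then show ?thesis unfolding skorokhod_def by (rule someI_ex)
  qed
  let ?C = "\<lambda>\<omega>. \<Phi> \<cc> (?cut \<omega>)"
  have CL: "?C \<in> L2 M" by (intro L2XD L2H_functional_L2X cutL bounded_linear_\<Phi>[OF \<cc>_adm])
  have KL: "?K \<in> L2 M" using sk L2XD by (auto simp: is_skorokhod_def)
  have J1: "?J1 \<in> L2 M" by (rule aY.stieltjes_L2[OF s0(1) order_refl])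
  have J2: "?J2 \<in> L2 M" by (rule G.stieltjes_L2[OF s0(1) order_refl])
  have \<xi>: "\<xi> \<in> L2 M" by (rule L2XD[OF terminal])
  have Ys: "Y s \<in> L2 M" by (rule L2XD[OF Y_L2X[OF s0(2)]])
  have rhs: "(\<lambda>\<omega>. \<xi> \<omega> - (?J1 \<omega> + ?J2 \<omega>) - ?C \<omega> - ?K \<omega>) \<in> L2 M"
    by (intro L2_diff L2_add \<xi> J1 J2 CL KL)
  have Yeq: "AE \<omega> in M. Y s \<omega> = \<xi> \<omega> - stj s T (\<lambda>u. a u * Y u \<omega> + G u \<omega>) - ?C \<omega> - ?K \<omega>"
    using mild s0(2) unfolding \<Phi>_\<cc> mild_solution_def by blast
  have split: "AE \<omega> in M. stj s T (\<lambda>u. a u * Y u \<omega> + G u \<omega>) = ?J1 \<omega> + ?J2 \<omega>"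
    using aY.sq.W_integrable[of s T] G.sq.W_integrable[of s T] aY.stieltjes_eq[OF s0(1) order_refl]
      G.stieltjes_eq[OF s0(1) order_refl] AE_space
  proof eventually_elim
    case (elim \<omega>)
    have int: "set_integrable \<nu> {s<..T} (\<lambda>u. aY.sq.W u \<omega>)" "set_integrable \<nu> {s<..T} (\<lambda>u. G.sq.W u \<omega>)"
      using elim s0 by auto
    note [measurable] = measurable_Pair1[OF aY.sq.W_measurable elim(5), simplified] measurable_Pair1[OF G.sq.W_measurable elim(5), simplified]
    have "stj s T (\<lambda>u. a u * Y u \<omega> + G u \<omega>) = stj s T (\<lambda>u. aY.sq.W u \<omega> + G.sq.W u \<omega>)"
      using s0(1) by (intro stieltjes_integral_cong) (simp add: aY.sq.W_def G.sq.W_def clip_id)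
    also have "\<dots> = (LINT u:{s<..T}|\<nu>. (aY.sq.W u \<omega> + G.sq.W u \<omega>) * \<sigma> u)"
      using int by (intro bv.stieltjes_sign(3) set_integral_add) measurable
    also have "\<dots> = si.signed_integral s T (\<lambda>u. aY.sq.W u \<omega>) + si.signed_integral s T (\<lambda>u. G.sq.W u \<omega>)"
    proof -
      have 1: "set_integrable \<nu> {s<..T} (\<lambda>u. aY.sq.W u \<omega> * \<sigma> u)" and 2: "set_integrable \<nu> {s<..T} (\<lambda>u. G.sq.W u \<omega> * \<sigma> u)"
        using integrable_times_sign[OF int(1)[unfolded set_integrable_def]] integrable_times_sign[OF int(2)[unfolded set_integrable_def]]
        by (simp_all add: set_integrable_def mult.assoc)
      show ?thesis
        unfolding si.signed_integral_def si.signed_integral_def set_integral_add(2)[OF 1 2, symmetric]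
        by (simp add: distrib_right)
    qed
    also have "\<dots> = ?J1 \<omega> + ?J2 \<omega>" using elim(3,4) by simp
    finally show ?case .
  qed
  have "SY x s = S (Y s) x" using s0(2) by (simp add: SY_def clip_id)
  also have "\<dots> = S (\<lambda>\<omega>. \<xi> \<omega> - (?J1 \<omega> + ?J2 \<omega>) - ?C \<omega> - ?K \<omega>) x"
    by (intro S_cong_AE L2D(1) Ys rhs) (use Yeq split in eventually_elim, simp)
  also have "\<dots> = S \<xi> x - (S ?J1 x + S ?J2 x) - S ?C x - S ?K x"
    by (simp only: S_diff S_add L2_diff L2_add \<xi> J1 J2 CL KL)
  also have "S ?C x = \<Phi> \<cc> (S_transform_H M T X I ?cut x)"
    by (rule S_transform_functional[OF cutL bounded_linear_\<Phi>[OF \<cc>_adm]])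
  also have "S ?K x = \<Phi> x (S_transform_H M T X I ?cut x)"
    using sk shift(1) by (simp add: is_skorokhod_def)
  also have "S \<xi> x - (S ?J1 x + S ?J2 x) - \<Phi> \<cc> (S_transform_H M T X I ?cut x) - \<Phi> x (S_transform_H M T X I ?cut x)
      = S \<xi> x - (S ?J1 x + S ?J2 x)"
  proof -
    have "S_transform_H M T X I ?cut x = ?R (S_transform_H M T X I Z x)"
      unfolding cut by (rule S_transform_H_bounded_linear[OF Z_L2H R])
    then have "Q t (S_transform_H M T X I ?cut x) = 0" using Q_cut[OF t s] by simp
    then have "\<Phi> x (S_transform_H M T X I ?cut x) + \<Phi> \<cc> (S_transform_H M T X I ?cut x) = 0"
      unfolding shift(2) using linear_0[OF bounded_linear.linear[OF shift(3)]] by simp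
    then show ?thesis by simp
  qed
  also have "S ?J1 x + S ?J2 x = nu.tail_integral T (\<lambda>u. \<alpha> u * SY x u + SG x u) s"
    unfolding S_stj_aY[OF s0(1)] S_stj_G[OF s0(1)]
    by (rule nu.tail_integral_add[OF integrable_S, symmetric])
  finally show ?thesis .
qed

lemma S_solution:
  assumes h: "h \<in> Adm" and t: "t \<in> {0..T}"
  defines "x \<equiv> P t (h + \<cc>) - \<cc>"
  shows "A t * S (Y t) x = S \<xi> x - (LINT u:{t<..T}|\<nu>. A' u * SG x u)"
proof -
  have "A' t * SY x t = S \<xi> x - nu.tail_integral T (\<lambda>u. A' u * SG x u) t"
    unfolding A'_def
    using t S_equation[OF h, of t] unfolding x_def
    by (intro nu.linear_backward_equation \<alpha>_integrable integrable_S) auto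
  then show ?thesis using t by (simp add: A_eq SY_def clip_id nu.tail_integral_def)
qed

section \<open>Identification of the solution\<close>

definition \<xi>' :: "'w \<Rightarrow> real" where "\<xi>' \<omega> = \<xi> \<omega> - stj 0 T (\<lambda>u. A u * G u \<omega>)"

definition \<eta> :: "real \<Rightarrow> 'w \<Rightarrow> real" where "\<eta> t \<omega> = A t * Y t \<omega> - stj 0 t (\<lambda>u. A u * G u \<omega>)"

lemma AG_cong: "t \<le> T \<Longrightarrow> stj 0 t (\<lambda>u. A u * G u \<omega>) = stj 0 t (\<lambda>u. A' u * G u \<omega>)"
  using A_eq by (intro stieltjes_integral_cong) auto

lemma AG_L2: "t \<le> T \<Longrightarrow> (\<lambda>\<omega>. stj 0 t (\<lambda>u. A u * G u \<omega>)) \<in> L2 M"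
  using AG.stieltjes_L2[of 0 t] by (simp add: AG_cong)

lemma AG_adapted: "t \<le> T \<Longrightarrow> (\<lambda>\<omega>. stj 0 t (\<lambda>u. A u * G u \<omega>)) \<in> borel_measurable (filtr M X t)"
proof -
  assume t: "t \<le> T"
  have "(\<lambda>\<omega>. A' u * G u \<omega>) \<in> borel_measurable (filtr M X t)" if "u \<in> {0<..t}" for u
  proof -
    have "G u \<in> borel_measurable (filtr M X u)"
      using standing that t by (auto simp: standing_assumptions_def adapted_process_def)
    then have "G u \<in> borel_measurable (filtr M X t)" using that by (intro filtr_measurable_mono[of u t]) auto
    then show ?thesis by measurable
  qed
  then show ?thesis using AG.stieltjes_measurable[of 0 t t] t by (simp add: AG_cong)
qed

lemma \<xi>'_L2X: "\<xi>' \<in> L2X M T X"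
  unfolding L2X_iff \<xi>'_def
  using terminal AG_adapted[of T] AG_L2[of T] by (auto simp: L2X_iff intro!: L2_diff)

lemma \<eta>_L2: "t \<in> {0..T} \<Longrightarrow> \<eta> t \<in> L2 M"
  unfolding \<eta>_def[abs_def] using AG_L2[of t] Y_L2X[of t] by (auto simp: L2X_iff intro!: L2_diff L2_scale)

lemma \<eta>_adapted: "t \<in> {0..T} \<Longrightarrow> \<eta> t \<in> borel_measurable (filtr M X t)"
proof -
  assume t: "t \<in> {0..T}"
  then have "t \<le> T" by simp
  have "Y t \<in> borel_measurable (filtr M X t)" using mild t by (auto simp: mild_solution_def adapted_process_def)
  then show ?thesis unfolding \<eta>_def[abs_def] using AG_adapted[OF \<open>t \<le> T\<close>] by measurable
qed

lemma \<eta>_L2X: "t \<in> {0..T} \<Longrightarrow> \<eta> t \<in> L2X M T X"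
  using \<eta>_L2[of t] filtr_measurable_mono[OF _ \<eta>_adapted, of t T] by (simp add: L2X_iff)

text \<open>
  Both sides equal the S-transform of \<open>\<eta> t\<close> at the shifted point: on the left by solving the backward
  equation, on the right because \<open>\<eta> t\<close> is adapted and the two points agree up to time \<open>t\<close>.
\<close>

lemma S_\<eta>_adm:
  assumes h: "h \<in> Adm" and t: "t \<in> {0..T}"
  shows "S \<xi>' (P t (h + \<cc>) - \<cc>) = S (\<eta> t) h"
proof -
  let ?x = "P t (h + \<cc>) - \<cc>"
  have "integrable \<nu> (\<lambda>u. SG ?x u * A' u)"
    by (rule nu.integrable_times_bounded[OF integrable_S(2) A'_measurable A'_bound])
  then have int: "set_integrable \<nu> B (\<lambda>u. A' u * SG ?x u)" if "B \<in> sets borel" for B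
    unfolding set_integrable_def using that by (intro integrable_mult_indicator) (simp_all add: mult.commute)
  have "S \<xi>' ?x = S \<xi> ?x - (LINT u:{0<..T}|\<nu>. A' u * SG ?x u)"
    unfolding \<xi>'_def[abs_def] using AG_L2[of T] L2XD[OF terminal] by (simp add: S_diff S_stj_AG)
  also have "(LINT u:{0<..T}|\<nu>. A' u * SG ?x u) = (LINT u:{0<..t}|\<nu>. A' u * SG ?x u) + (LINT u:{t<..T}|\<nu>. A' u * SG ?x u)"
  proof -
    have "{0<..T} = {0<..t} \<union> {t<..T}" using t by auto
    then show ?thesis using int by (auto intro!: set_integral_Un)
  qed
  also have "S \<xi> ?x - \<dots> = A t * S (Y t) ?x - (LINT u:{0<..t}|\<nu>. A' u * SG ?x u)"
    using S_solution[OF h t] by simp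
  also have "\<dots> = S (\<eta> t) ?x"
    unfolding \<eta>_def[abs_def] using AG_L2[of t] L2XD[OF Y_L2X[OF t]] t
    by (simp add: S_diff S_scale L2_scale S_stj_AG)
  also have "\<dots> = S (\<eta> t) h"
  proof (rule S_transform_adapted[OF \<eta>_L2[OF t] \<eta>_adapted[OF t]])
    show "t \<le> T" using t by simp
    fix s assume "s \<in> {0..t}"
    then have "s \<in> {0..T}" "min s t = s" using t by auto
    then show "inner (e s) ?x = inner (e s) h" using t by (simp add: inner_diff_right inner_P inner_add_right)
  qed
  finally show ?thesis .
qed

lemma quasi_cond_exp_\<eta>:
  assumes t: "t \<in> {0..T}"
  shows "is_quasi_cond_exp M T X e I \<cc> t \<xi>' (\<eta> t)"
  unfolding is_quasi_cond_exp_def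
proof (intro conjI allI \<eta>_L2X t)
  fix h
  obtain y where y: "\<And>n. y n \<in> Adm" "y \<longlonglongrightarrow> h" by (rule adm_dense[of h]) blast
  interpret P: bounded_linear "P t" by (rule bounded_linear_P[OF t])
  have "(\<lambda>n. P t (y n + \<cc>) - \<cc>) \<longlonglongrightarrow> P t (h + \<cc>) - \<cc>"
    by (intro tendsto_intros P.tendsto y)
  from S_tendsto[OF L2XD[OF \<xi>'_L2X] this]
  have "(\<lambda>n. S (\<eta> t) (y n)) \<longlonglongrightarrow> S \<xi>' (P t (h + \<cc>) - \<cc>)"
    by (simp add: S_\<eta>_adm[OF y(1) t])
  then show "S \<xi>' (P t (h + \<cc>) - \<cc>) = S (\<eta> t) h"
    using S_tendsto[OF \<eta>_L2[OF t] y(2)] by (rule LIMSEQ_unique)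
qed

lemma solution_formula:
  assumes t: "t \<in> {0..T}"
  shows "\<xi>' \<in> quasi_dom M T X e I \<cc> t"
    and "AE \<omega> in M. Y t \<omega> = inverse (A t) * quasi_cond_exp M T X e I \<cc> t \<xi>' \<omega> +
      inverse (A t) * stj 0 t (\<lambda>u. A u * G u \<omega>)"
proof -
  note \<eta> = quasi_cond_exp_\<eta>[OF t]
  show "\<xi>' \<in> quasi_dom M T X e I \<cc> t"
    unfolding quasi_dom_def using \<xi>'_L2X \<eta> by blast
  have q: "is_quasi_cond_exp M T X e I \<cc> t \<xi>' (quasi_cond_exp M T X e I \<cc> t \<xi>')"
    unfolding quasi_cond_exp_def by (rule someI[where P = "is_quasi_cond_exp M T X e I \<cc> t \<xi>'", OF \<eta>])
  have "AE \<omega> in M. quasi_cond_exp M T X e I \<cc> t \<xi>' \<omega> = \<eta> t \<omega>"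
    using \<eta> q unfolding is_quasi_cond_exp_def by (intro S_transform_injective) auto
  then show "AE \<omega> in M. Y t \<omega> = inverse (A t) * quasi_cond_exp M T X e I \<cc> t \<xi>' \<omega> +
      inverse (A t) * stj 0 t (\<lambda>u. A u * G u \<omega>)"
    by eventually_elim (use A_pos[of t] in \<open>simp add: \<eta>_def field_simps\<close>)
qed

end

theorem theorem3p8:
  fixes M :: "'w measure" and T :: real
    and X Y G :: "real \<Rightarrow> 'w \<Rightarrow> real"
    and e :: "real \<Rightarrow> 'k::{real_inner,complete_space}" and I :: "'k \<Rightarrow> 'w \<Rightarrow> real"
    and a \<gamma> c A :: "real \<Rightarrow> real" and \<cc> :: 'k
    and \<xi> \<xi>' :: "'w \<Rightarrow> real"
    and Z :: "'w \<Rightarrow> 'h::{real_inner,complete_space}" and f :: "real \<Rightarrow> 'h"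
  assumes "gaussian_setting M T X"
    and "deterministic_integrands M T X e"
    and "wiener_integral M T X e I"
    and "has_truncations T e"
    and "standing_assumptions M T X a \<gamma> c G"
    and "\<xi> \<in> L2X M T X"
    and "underline M T X (I \<cc>) = c"
    and "mild_solution M T X I a \<gamma> c G \<xi> Y Z f"
  defines "A \<equiv> \<lambda>t. exp (stieltjes_integral T \<gamma> t T a)"
    and "\<xi>' \<equiv> \<lambda>\<omega>. \<xi> \<omega> - stieltjes_integral T \<gamma> 0 T (\<lambda>s. A s * G s \<omega>)"
  shows "\<forall>t\<in>{0..T}.
           \<xi>' \<in> quasi_dom M T X e I \<cc> t \<and>
           (AE \<omega> in M. Y t \<omega> =
              inverse (A t) * quasi_cond_exp M T X e I \<cc> t \<xi>' \<omega> +
              inverse (A t) * stieltjes_integral T \<gamma> 0 t (\<lambda>s. A s * G s \<omega>))"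
proof -
  interpret B: bsde M T X e I a \<gamma> c Y G \<cc> \<xi> Z f
    using assms(1-8) by unfold_locales
  have "A = B.A" by (simp add: A_def B.A_def fun_eq_iff)
  moreover from this have "\<xi>' = B.\<xi>'" by (simp add: \<xi>'_def B.\<xi>'_def fun_eq_iff)
  ultimately show ?thesis using B.solution_formula by simp
qed

end
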